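(* Let $0<\alpha<1$ and $s\in\mathbb{R}$. For $k$ with $0<\arg(k)<\pi$, the integral kernel of the resolvent of $h_{0,\alpha}(s)$ is $$\frac{1}{h_{0,\alpha}(s)-k^2}(r,r')=\frac{i\pi}{2}\sqrt{rr'}\,J_\alpha(kr_<)H^{(1)}_\alpha(kr_>)-A(k,\alpha;s)\sqrt{rr'}\,H^{(1)}_\alpha(kr)H^{(1)}_\alpha(kr'),$$ where $$A(k,\alpha;s)=\frac\pi2\Big[\Big(\frac k2\Big)^{-2\alpha}(2s\alpha-1)\frac{1}{\sin\pi\alpha}\frac{\Gamma(1+\alpha)}{\Gamma(1-\alpha)}+\cot\pi\alpha-i\Big]^{-1},$$ with powers of $k$ evaluated on the sheet $0<\arg k<\pi$.
   Context: On $L^2(\mathbb{R}^+,dr)$ let $h_{0,\alpha}=-\partial_r^2+\frac{\alpha^2-1/4}{r^2}$ with domain consisting of functions $\psi$ with compact support away from the origin such that $\psi$ and $\partial_r\psi$ are locally absolutely continuous and $h_{0,\alpha}\psi\in L^2(\mathbb{R}^+)$. For $0<\alpha<1$ let $F_\alpha(r)=r^{1/2+\alpha}$, $G_\alpha(r)=\frac{1}{2\alpha}(r^{1/2-\alpha}-r^{1/2+\alpha})$, and for $s\in\mathbb{R}$ let $\psi_{\alpha,s}=G_\alpha+sF_\alpha$. The self-adjoint extension $h_{0,\alpha}(s)$ (the "$\delta$-potential" or contact interaction with coupling parameter $s$) is the restriction of the adjoint $h_{0,\alpha}^*$ to $\{\psi\in\mathcal{D}(h_{0,\alpha}^* ):\lim_{r\downarrow0}W(\psi_{\alpha,s},\psi)(r)=0\}$,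 where $W(f,g)=fg'-gf'$. $r_<=\min(r,r')$, $r_>=\max(r,r')$; $J_\alpha$ and $H^{(1)}_\alpha$ are the Bessel and first Hankel functions.
   Formalization: Assumes in addition that k² is not an eigenvalue of h_{0,α}(s): e.g. for α=1/2, s=0, k=i the function e^{-r} is an eigenfunction, the bracket in A vanishes and the resolvent does not exist; for non-real k² the assumption holds automatically by self-adjointness. *)

theory Defs
  imports "HOL-Analysis.Analysis"
begin

definition L2pos :: "(real \<Rightarrow> complex) \<Rightarrow> bool" where
  "L2pos f \<longleftrightarrow> set_borel_measurable lborel {0<..} f \<and>
                 set_integrable lborel {0<..} (\<lambda>r. (norm (f r))\<^sup>2)"

definition Vpot :: "real \<Rightarrow> real \<Rightarrow> real" where
  "Vpot \<alpha> r = (\<alpha>\<^sup>2 - 1/4) / r\<^sup>2"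

text \<open>Maximal domain of the adjoint: psi and psi' locally absolutely continuous on (0,oo)
  (psi has derivative psi' at every r > 0, and psi' is the indefinite integral of a
  locally integrable function psi''), psi in L2 and h psi = -psi'' + V psi in L2.\<close>
definition in_dom_adj :: "real \<Rightarrow> (real \<Rightarrow> complex) \<Rightarrow> (real \<Rightarrow> complex) \<Rightarrow> (real \<Rightarrow> complex) \<Rightarrow> bool" where
  "in_dom_adj \<alpha> \<psi> \<psi>' \<psi>'' \<longleftrightarrow>
     (\<forall>r>0. (\<psi> has_vector_derivative \<psi>' r) (at r)) \<and>
     (\<forall>a b. 0 < a \<longrightarrow> a \<le> b \<longrightarrow>
        set_integrable lborel {a..b} \<psi>'' \<and>
        \<psi>' b - \<psi>' a = (LINT x:{a..b}|lborel. \<psi>'' x)) \<and>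
     L2pos \<psi> \<and>
     L2pos (\<lambda>r. - \<psi>'' r + of_real (Vpot \<alpha> r) * \<psi> r)"

definition F_fun :: "real \<Rightarrow> real \<Rightarrow> real" where
  "F_fun \<alpha> r = r powr (1/2 + \<alpha>)"

definition G_fun :: "real \<Rightarrow> real \<Rightarrow> real" where
  "G_fun \<alpha> r = (1 / (2*\<alpha>)) * (r powr (1/2 - \<alpha>) - r powr (1/2 + \<alpha>))"

definition psi_fun :: "real \<Rightarrow> real \<Rightarrow> real \<Rightarrow> real" where
  "psi_fun \<alpha> s r = G_fun \<alpha> r + s * F_fun \<alpha> r"

definition Wr :: "real \<Rightarrow> real \<Rightarrow> (real \<Rightarrow> complex) \<Rightarrow> (real \<Rightarrow> complex) \<Rightarrow> real \<Rightarrow> complex" where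
  "Wr \<alpha> s u u' r = of_real (psi_fun \<alpha> s r) * u' r - u r * of_real (deriv (psi_fun \<alpha> s) r)"

definition in_dom_s :: "real \<Rightarrow> real \<Rightarrow> (real \<Rightarrow> complex) \<Rightarrow> (real \<Rightarrow> complex) \<Rightarrow> (real \<Rightarrow> complex) \<Rightarrow> bool" where
  "in_dom_s \<alpha> s \<psi> \<psi>' \<psi>'' \<longleftrightarrow> in_dom_adj \<alpha> \<psi> \<psi>' \<psi>'' \<and>
     ((Wr \<alpha> s \<psi> \<psi>') \<longlongrightarrow> 0) (at_right 0)"

definition BesselJ :: "real \<Rightarrow> complex \<Rightarrow> complex" where
  "BesselJ \<nu> z = (\<Sum>m. (-1)^m / of_real (fact m * Gamma (real m + \<nu> + 1)) *
                        (z/2) powr (of_real (2 * real m + \<nu>)))"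

text \<open>Hankel function of the first kind, for non-integer order.\<close>
definition Hankel1 :: "real \<Rightarrow> complex \<Rightarrow> complex" where
  "Hankel1 \<nu> z = (BesselJ (-\<nu>) z - exp (- \<i> * of_real (pi * \<nu>)) * BesselJ \<nu> z)
                  / (\<i> * of_real (sin (pi * \<nu>)))"

definition A_coef :: "complex \<Rightarrow> real \<Rightarrow> real \<Rightarrow> complex" where
  "A_coef k \<alpha> s = of_real (pi/2) * inverse
     ((k/2) powr (of_real (-2*\<alpha>)) * of_real (2 * s * \<alpha> - 1) * of_real (1 / sin (pi*\<alpha>))
        * of_real (Gamma (1+\<alpha>) / Gamma (1-\<alpha>)) + of_real (cot (pi*\<alpha>)) - \<i>)"

definition res_kernel :: "real \<Rightarrow> real \<Rightarrow> complex \<Rightarrow> real \<Rightarrow> real \<Rightarrow> complex" where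
  "res_kernel \<alpha> s k r r' =
     \<i> * of_real (pi/2) * of_real (sqrt (r*r')) * BesselJ \<alpha> (k * of_real (min r r'))
       * Hankel1 \<alpha> (k * of_real (max r r'))
     - A_coef k \<alpha> s * of_real (sqrt (r*r')) * Hankel1 \<alpha> (k * of_real r) * Hankel1 \<alpha> (k * of_real r')"

end

theory Submission
  imports Defs
begin

text \<open>
  The kernel factors as $\varphi(r_<)\,\xi(r_>)$, where $\xi(r) = \sqrt r\,H^{(1)}_\alpha(kr)$ and
  $\varphi = \frac{i\pi}2\sqrt r\,J_\alpha(kr) - A\,\xi$ solve the eigenvalue equation with Wronskian $-1$; the
  coefficient $A$ is exactly the one for which $\varphi$ satisfies the boundary condition at $0$. It is
  singular only if $\xi$ itself satisfies the boundary condition, i.e. is an eigenfunction.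
  With $\eta = \mathrm{Im}\,k$ and up to an integrable singularity at $0$, one has
  $|\xi(r)| \le C e^{-\eta r}$, since $\xi$ is a multiple of the Macdonald function of $-ikr$, and
  $|\varphi(r)| \le C e^{\eta r}$ by an energy estimate. So the kernel is dominated
  by $e^{-\eta|r-r'|}$ and maps $L^2$ to itself by a Schur test.
\<close>

text \<open>The definitions give power series, which show the behaviour at 0 but not at infinity:
  \<open>Hankel1\<close> combines two solutions that both grow exponentially, and its decay is an
  exact cancellation. The decay is therefore read off an integral, and integral and series are
  identified without asymptotics at infinity: the Macdonald integral has the same Wronskian with the
  modified Bessel functions of order alpha and -alpha, which fixes it once the Wronskian of those
  two is known from the reflection formula. For phi an upper bound of the right rate is enough.

  The other obstacle is regularity. As f is only in L2, the coefficients of variation of parameters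
  are absolutely continuous, and the product rule may fail at any given point. One integration by
  parts, proved with Fubini, replaces it; u'' occurs only as an integrand.

  Branches of powers affect only constants in k, since the dependence on r is a real power times an
  entire function. The exceptional case does occur: if 2 s alpha < 1, the bracket in A vanishes at
  exactly one k, on the positive imaginary axis (the bound state).\<close>

section \<open>The entire factor common to all Bessel functions\<close>

text \<open>The regularised hypergeometric function 0F1(; nu + 1; w) / Gamma(nu + 1). J and I of
  order nu are (z/2)^nu times its value at -z^2/4 and z^2/4. With \<open>rGamma\<close> in place of
  1/Gamma the recurrences hold for every real nu, poles included.\<close>

definition bessel_entire :: "real \<Rightarrow> complex \<Rightarrow> complex" where
  "bessel_entire \<nu> w = (\<Sum>m. of_real (rGamma (real m + 1 + \<nu>) / fact m) * w ^ m)"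

lemma rGamma_shift: "rGamma (real m + \<nu>) = (real m + \<nu>) * rGamma (real m + 1 + \<nu>)"
  using rGamma_plus1[of "real m + \<nu>"] by (simp add: algebra_simps)

lemma summable_bessel_entire:
  "summable (\<lambda>m. of_real (rGamma (real m + 1 + \<nu>) / fact m) * (w::complex) ^ m)"
proof -
  \<comment> \<open>From N on, n + 1 + nu >= 1 makes the \<open>rGamma\<close> factors nonincreasing
    in absolute value, and norm w / (n + 1) <= 1/2 supplies the ratio.\<close>
  obtain N :: nat where N: "\<bar>\<nu>\<bar> \<le> real N" "2 * norm w \<le> real N"
    using real_arch_simple[of "max \<bar>\<nu>\<bar> (2 * norm w)"] by auto
  show ?thesis
  proof (rule summable_ratio_test[of "1/2" N])
    fix n assume n: "N \<le> n"
    hence n': "real n \<ge> real N" by simp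
    have r: "rGamma (real n + 1 + \<nu>) = (real n + 1 + \<nu>) * rGamma (real (Suc n) + 1 + \<nu>)"
      using rGamma_shift[of "Suc n" \<nu>] by (simp add: algebra_simps)
    have ge1: "1 \<le> real n + 1 + \<nu>" using N n' by linarith
    have "\<bar>rGamma (real (Suc n) + 1 + \<nu>)\<bar> \<le> \<bar>rGamma (real n + 1 + \<nu>)\<bar>"
      unfolding r abs_mult using ge1
      by (intro order_trans[OF _ mult_right_mono[of 1 "\<bar>real n + 1 + \<nu>\<bar>"]]) auto
    moreover have "norm w / real (Suc n) \<le> 1/2" using N n' by (simp add: field_simps)
    ultimately have "\<bar>rGamma (real (Suc n) + 1 + \<nu>)\<bar> * (norm w / real (Suc n)) \<le> \<bar>rGamma (real n + 1 + \<nu>)\<bar> * (1/2)"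
      by (intro mult_mono) auto
    hence "(\<bar>rGamma (real (Suc n) + 1 + \<nu>)\<bar> * (norm w / real (Suc n))) * (norm w ^ n / fact n)
       \<le> (\<bar>rGamma (real n + 1 + \<nu>)\<bar> * (1/2)) * (norm w ^ n / fact n)"
      by (intro mult_right_mono) auto
    thus "norm (of_real (rGamma (real (Suc n) + 1 + \<nu>) / fact (Suc n)) * w ^ Suc n)
      \<le> 1/2 * norm (of_real (rGamma (real n + 1 + \<nu>) / fact n) * w ^ n)"
      unfolding norm_mult norm_power norm_of_real abs_divide
      by (simp add: field_simps del: of_nat_Suc)
  qed simp
qed

lemma bessel_entire_sums:
  "(\<lambda>m. of_real (rGamma (real m + 1 + \<nu>) / fact m) * w ^ m) sums bessel_entire \<nu> w"
  unfolding bessel_entire_def using summable_bessel_entire by (rule summable_sums)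

lemma bessel_entire_0 [simp]: "bessel_entire \<nu> 0 = of_real (rGamma (1 + \<nu>))"
  unfolding bessel_entire_def by (subst powser_zero) simp

text \<open>Termwise differentiation cancels m + 1 against the factorial and moves the Gamma
  argument up by one, so it only raises the order.\<close>

lemma has_field_derivative_bessel_entire [derivative_intros]:
  assumes "(f has_field_derivative f') (at x within A)"
  shows "((\<lambda>x. bessel_entire \<nu> (f x)) has_field_derivative bessel_entire (\<nu> + 1) (f x) * f') (at x within A)"
proof -
  have d: "diffs (\<lambda>m. of_real (rGamma (real m + 1 + \<nu>) / fact m))
      = (\<lambda>m. complex_of_real (rGamma (real m + 1 + (\<nu> + 1)) / fact m))"
    by (rule ext) (simp add: diffs_def field_simps del: of_nat_Suc, simp add: add_ac)
  have "DERIV (\<lambda>w. bessel_entire \<nu> w) w :> bessel_entire (\<nu> + 1) w" for w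
    using termdiffs_strong_converges_everywhere[OF summable_bessel_entire[of \<nu>], of w]
    unfolding bessel_entire_def d .
  from DERIV_chain2[OF this assms] show ?thesis by simp
qed

lemma continuous_on_bessel_entire [continuous_intros]:
  assumes "continuous_on A f" shows "continuous_on A (\<lambda>x. bessel_entire \<nu> (f x))"
proof -
  have "continuous_on UNIV (bessel_entire \<nu>)"
    by (rule continuous_at_imp_continuous_on)
       (auto intro!: DERIV_isCont[OF has_field_derivative_bessel_entire[OF DERIV_ident, simplified]])
  from continuous_on_compose2[OF this assms] show ?thesis by simp
qed

text \<open>Compares coefficients: in rGamma(m + nu) = (m + nu) rGamma(m + 1 + nu) the summand nu
  gives the first term, and the summand m gives w times the derivative.\<close>

lemma bessel_entire_recurrence:
  "bessel_entire (\<nu> - 1) w = of_real \<nu> * bessel_entire \<nu> w + w * bessel_entire (\<nu> + 1) w"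
proof -
  let ?c = "\<lambda>\<nu> m. complex_of_real (rGamma (real m + 1 + \<nu>) / fact m)"
  have "(\<lambda>m. w * (?c (\<nu> + 1) m * w ^ m)) sums (w * bessel_entire (\<nu> + 1) w)"
    by (intro sums_mult bessel_entire_sums)
  hence "(\<lambda>m. of_nat (Suc m) * ?c \<nu> (Suc m) * w ^ Suc m) sums (w * bessel_entire (\<nu> + 1) w)"
    by (rule back_subst[of "\<lambda>f. f sums _"])
       (rule ext, simp add: fact_reduce field_simps del: of_nat_Suc, simp add: algebra_simps)
  hence "(\<lambda>m. of_nat m * ?c \<nu> m * w ^ m) sums (w * bessel_entire (\<nu> + 1) w)"
    using sums_Suc_iff[of "\<lambda>m. of_nat m * ?c \<nu> m * w ^ m"] by simp
  from sums_add[OF sums_mult[OF bessel_entire_sums[of \<nu> w], of "of_real \<nu>"] this]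
  have "(\<lambda>m. ?c (\<nu> - 1) m * w ^ m) sums (of_real \<nu> * bessel_entire \<nu> w + w * bessel_entire (\<nu> + 1) w)"
  proof (rule back_subst[of "\<lambda>f. f sums _"], intro ext)
    fix m
    have "?c (\<nu> - 1) m = (of_real \<nu> + of_nat m) * ?c \<nu> m"
      using rGamma_shift[of m \<nu>] by (simp add: algebra_simps)
    thus "of_real \<nu> * (?c \<nu> m * w ^ m) + of_nat m * ?c \<nu> m * w ^ m = ?c (\<nu> - 1) m * w ^ m"
      by (simp only: ring_distribs mult.assoc)
  qed
  thus ?thesis using bessel_entire_sums[of "\<nu> - 1" w] sums_unique2 by blast
qed

text \<open>The recurrences make the derivative in w vanish, so the left side equals its value at w
  = 0, which the reflection formula evaluates. This is the Wronskian of orders mu and -mu with the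
  powers of z stripped off.\<close>

lemma bessel_entire_wronskian:
  "bessel_entire \<mu> w * bessel_entire (- \<mu> - 1) w - w * bessel_entire (\<mu> + 1) w * bessel_entire (- \<mu>) w
     = of_real (- sin (pi * \<mu>) / pi)"
proof -
  let ?E = bessel_entire
  let ?S = "\<lambda>w. ?E \<mu> w * ?E (- \<mu> - 1) w - w * ?E (\<mu> + 1) w * ?E (- \<mu>) w"
  have "(?S has_field_derivative 0) (at w)" for w
  proof -
    have r1: "?E (-\<mu> - 1) w = of_real (- \<mu>) * ?E (- \<mu>) w + w * ?E (1 - \<mu>) w"
      using bessel_entire_recurrence[of "- \<mu>" w] by simp
    have r2: "?E \<mu> w = of_real (\<mu> + 1) * ?E (\<mu> + 1) w + w * ?E (\<mu> + 2) w"
      using bessel_entire_recurrence[of "\<mu> + 1" w] by (simp add: add.assoc)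
    have "(?S has_field_derivative
       (?E (\<mu> + 1) w * ?E (- \<mu> - 1) w + ?E \<mu> w * ?E (- \<mu>) w
        - (?E (\<mu> + 1) w * ?E (- \<mu>) w + w * (?E (\<mu> + 2) w * ?E (- \<mu>) w + ?E (\<mu> + 1) w * ?E (1 - \<mu>) w)))) (at w)"
      by (auto intro!: derivative_eq_intros simp: algebra_simps)
    also have "(?E (\<mu> + 1) w * ?E (- \<mu> - 1) w + ?E \<mu> w * ?E (- \<mu>) w
        - (?E (\<mu> + 1) w * ?E (- \<mu>) w + w * (?E (\<mu> + 2) w * ?E (- \<mu>) w + ?E (\<mu> + 1) w * ?E (1 - \<mu>) w))) = 0"
      unfolding r1 r2 by (simp add: algebra_simps)
    finally show ?thesis .
  qed
  hence "?S w = ?S 0"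
    using has_field_derivative_zero_constant[of UNIV ?S] by (metis UNIV_I convex_UNIV)
  also have "?S 0 = of_real (rGamma (1 + \<mu>) * rGamma (- \<mu>))" by simp
  also have "rGamma (1 + \<mu>) * rGamma (- \<mu>) = sin (pi * (- \<mu>)) / pi"
  proof -
    have "rGamma (complex_of_real (- \<mu>)) * rGamma (1 - complex_of_real (- \<mu>)) = sin (of_real pi * complex_of_real (-\<mu>)) / of_real pi"
      by (rule rGamma_reflection_complex)
    also have "rGamma (1 - complex_of_real (- \<mu>)) = of_real (rGamma (1 + \<mu>))"
      by (simp flip: rGamma_complex_of_real)
    finally have "complex_of_real (rGamma (- \<mu>) * rGamma (1 + \<mu>)) = of_real (sin (pi * (- \<mu>)) / pi)"
      by (simp flip: sin_of_real rGamma_complex_of_real)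
    thus ?thesis using of_real_eq_iff by (metis mult.commute)
  qed
  finally show ?thesis by simp
qed

section \<open>The Macdonald function\<close>

lemma nn_integral_exp_minus_abs_le:
  fixes \<eta> r :: real
  assumes "\<eta> > 0"
  shows "(\<integral>\<^sup>+t. ennreal (exp (- \<eta> * \<bar>r - t\<bar>)) \<partial>lborel) \<le> ennreal (2 / \<eta>)"
proof -
  let ?f = "\<lambda>t. ennreal (exp (- \<eta> * \<bar>r - t\<bar>))"
  have 1: "(\<integral>\<^sup>+t. ?f t * indicator {r..} t \<partial>lborel) = ennreal (1 / \<eta>)"
  proof -
    have "((\<lambda>t. exp (\<eta> * r) * exp (- \<eta> * t)) has_integral exp (\<eta> * r) * (exp (- \<eta> * r) / \<eta>)) {r..}"
      by (intro has_integral_mult_right has_integral_exp_minus_to_infinity assms)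
    moreover have "exp (\<eta> * r) * (exp (- \<eta> * r) / \<eta>) = 1 / \<eta>" by (simp add: exp_minus)
    ultimately have "((\<lambda>t. exp (- \<eta> * \<bar>r - t\<bar>)) has_integral 1 / \<eta>) {r..}"
      by (elim has_integral_eq[rotated, THEN has_integral_eq_rhs]) (auto simp: algebra_simps simp flip: exp_add)
    hence "((\<lambda>t. exp (- \<eta> * \<bar>r - t\<bar>) * indicator {r..} t) has_integral 1 / \<eta>) UNIV"
      by (subst (asm) has_integral_restrict_UNIV[symmetric])
         (erule back_subst[of "\<lambda>f. (f has_integral _) _"], auto simp: indicator_def)
    from nn_integral_has_integral_lborel[OF _ _ this]
    show ?thesis by (simp add: ennreal_mult' ennreal_indicator)
  qed
  \<comment> \<open>The reflection t -> 2 r - t maps the left half-line to the right one.\<close>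
  have 2: "(\<integral>\<^sup>+t. ?f t * indicator {..r} t \<partial>lborel) = ennreal (1 / \<eta>)"
    by (subst 1[symmetric], subst nn_integral_real_affine[where c = "-1" and t = "2 * r"])
       (auto intro!: nn_integral_cong simp: indicator_def abs_minus_commute)
  have "(\<integral>\<^sup>+t. ?f t \<partial>lborel) \<le> (\<integral>\<^sup>+t. ?f t * indicator {r..} t + ?f t * indicator {..r} t \<partial>lborel)"
    by (intro nn_integral_mono) (auto simp: indicator_def)
  also have "\<dots> = ennreal (1 / \<eta>) + ennreal (1 / \<eta>)"
    by (subst nn_integral_add) (simp, simp, simp only: 1 2)
  also have "\<dots> = ennreal (2 / \<eta>)" using assms by (simp flip: ennreal_plus)
  finally show ?thesis .
qed

lemma integrable_exp_minus_abs: "integrable lborel (\<lambda>t::real. exp (- \<bar>t\<bar>))"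
proof (rule integrableI_bounded)
  show "(\<integral>\<^sup>+t. ennreal (norm (exp (- \<bar>t::real\<bar>))) \<partial>lborel) < \<infinity>"
    using nn_integral_exp_minus_abs_le[of 1 0] by (simp add: le_less_trans)
qed simp

text \<open>The constant 1/4 comes from averaging exp t >= 1 + t + t^2/2 with the linear bound
  exp(-t) >= 1 - t. Any positive constant would give the Gaussian majorants below.\<close>

lemma cosh_ge_quadratic: "1 + t\<^sup>2 / 4 \<le> cosh (t::real)"
proof -
  have *: "1 + t\<^sup>2 / 4 \<le> cosh t" if "t \<ge> 0" for t :: real
    using exp_lower_Taylor_quadratic[OF that] exp_ge_add_one_self[of "- t"]
    unfolding cosh_field_def by (simp add: field_simps)
  show ?thesis using *[of t] *[of "- t"] by (cases "t \<ge> 0") auto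
qed

text \<open>Completing the square; a linear exponent is absorbed by a Gaussian one.\<close>

lemma linear_minus_quadratic_le:
  fixes a x u :: real
  assumes "x > 0"
  shows "a * u - x * u\<^sup>2 / 4 \<le> a\<^sup>2 / x"
proof -
  have "0 \<le> (x * u / 2 - a)\<^sup>2" by simp
  hence "a * u * x - x\<^sup>2 * u\<^sup>2 / 4 \<le> a\<^sup>2" by (simp add: power2_eq_square algebra_simps)
  thus ?thesis using assms by (simp add: field_simps power2_eq_square)
qed

text \<open>Applies the previous bound with slope |nu| + 1: the extra unit is what leaves the
  integrable factor exp(-|t|).\<close>

lemma exp_minus_cosh_le:
  fixes \<nu> x t :: real
  assumes "x > 0"
  shows "exp (\<nu> * t - x * cosh t) \<le> exp ((\<bar>\<nu>\<bar> + 1)\<^sup>2 / x) * exp (- \<bar>t\<bar>)"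
proof -
  have "x * (1 + t\<^sup>2 / 4) \<le> x * cosh t" using cosh_ge_quadratic assms by (intro mult_left_mono) auto
  moreover have "\<nu> * t \<le> \<bar>\<nu>\<bar> * \<bar>t\<bar>" by (metis abs_ge_self abs_mult)
  ultimately show ?thesis
    using linear_minus_quadratic_le[OF assms, of "\<bar>\<nu>\<bar> + 1" "\<bar>t\<bar>"] assms
    unfolding exp_add[symmetric] exp_le_cancel_iff by (simp add: algebra_simps)
qed

text \<open>Twice the Macdonald function, in its integral representation over the whole line.\<close>

definition macdonald :: "real \<Rightarrow> complex \<Rightarrow> complex" where
  "macdonald \<nu> z = (LBINT t. exp (of_real (\<nu> * t) - z * of_real (cosh t)))"

lemma norm_macdonald_integrand:
  "norm (exp (of_real (\<nu> * t) - z * of_real (cosh t))) = exp (\<nu> * t - Re z * cosh t)"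
  by simp

lemma continuous_cosh_real [continuous_intros]: "continuous_on A (cosh :: real \<Rightarrow> real)"
  by (intro continuous_intros)

lemma macdonald_integrand_measurable [measurable]:
  "(\<lambda>t. exp (of_real (\<nu> * t) - z * of_real (cosh t)) :: complex) \<in> borel_measurable borel"
  by (intro borel_measurable_continuous_onI continuous_intros)

lemma integrable_exp_minus_cosh:
  fixes \<nu> x :: real
  assumes "x > 0"
  shows "integrable lborel (\<lambda>t. exp (\<nu> * t - x * cosh t))"
proof (rule Bochner_Integration.integrable_bound)
  show "integrable lborel (\<lambda>t. exp ((\<bar>\<nu>\<bar> + 1)\<^sup>2 / x) * exp (- \<bar>t\<bar>))"
    by (intro integrable_mult_right integrable_exp_minus_abs)
  show "(\<lambda>t. exp (\<nu> * t - x * cosh t)) \<in> borel_measurable lborel"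
    by (simp, intro borel_measurable_continuous_onI continuous_intros)
qed (use exp_minus_cosh_le[OF assms] in auto)

lemma integrable_macdonald:
  assumes "Re z > 0"
  shows "integrable lborel (\<lambda>t. exp (of_real (\<nu> * t) - z * of_real (cosh t)) :: complex)"
  using integrable_exp_minus_cosh[OF assms, of \<nu>]
  unfolding norm_macdonald_integrand[symmetric]
  by (rule iffD1[OF integrable_norm_iff, rotated]) measurable

lemma norm_macdonald_le:
  assumes "Re z > 0"
  shows "norm (macdonald \<nu> z) \<le> (LBINT t. exp (\<nu> * t - Re z * cosh t))"
  unfolding macdonald_def by (rule order_trans[OF integral_norm_bound]) simp

lemma macdonald_minus: "macdonald (- \<nu>) z = macdonald \<nu> z"
  unfolding macdonald_def
  by (subst lborel_integral_real_affine[where c = "-1" and t = 0]) auto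

lemma macdonald_integrand_shift:
  "exp (of_real ((\<nu> + a) * t) - z * of_real c) = of_real (exp (a * t)) * (exp (of_real (\<nu> * t) - z * of_real c) :: complex)"
proof -
  have "of_real ((\<nu> + a) * t) - z * of_real c = of_real (a * t) + (of_real (\<nu> * t) - z * of_real c)"
    by (simp add: algebra_simps)
  thus ?thesis by (simp only: exp_add exp_of_real)
qed

lemma cosh_mult_macdonald_integrand:
  "of_real (cosh t) * exp (of_real (\<nu> * t) - z * of_real c) =
     (exp (of_real ((\<nu> + 1) * t) - z * of_real c) + exp (of_real ((\<nu> - 1) * t) - z * of_real c)) / (2::complex)"
  using macdonald_integrand_shift[of \<nu> 1 t z c] macdonald_integrand_shift[of \<nu> "-1" t z c]
  by (simp add: cosh_field_def[of t] field_simps)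

lemma sinh_mult_macdonald_integrand:
  "of_real (sinh t) * exp (of_real (\<nu> * t) - z * of_real c) =
     (exp (of_real ((\<nu> + 1) * t) - z * of_real c) - exp (of_real ((\<nu> - 1) * t) - z * of_real c)) / (2::complex)"
  using macdonald_integrand_shift[of \<nu> 1 t z c] macdonald_integrand_shift[of \<nu> "-1" t z c]
  by (simp add: sinh_field_def[of t] field_simps)

text \<open>Differentiation under the integral sign with an explicit error: the integrand's second
  order Taylor remainder in h is at most norm h squared times one integrable function
  \<open>b\<close>. The factor cosh t brought down is then split into the orders nu + 1 and nu -
  1.\<close>

lemma has_field_derivative_macdonald:
  assumes z: "Re z > 0"
  shows "(macdonald \<nu> has_field_derivative - (macdonald (\<nu> + 1) z + macdonald (\<nu> - 1) z) / 2) (at z)"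
proof -
  let ?e = "\<lambda>z t. exp (of_real (\<nu> * t) - z * of_real (cosh t)) :: complex"
  define D where "D = (macdonald (\<nu> + 1) z + macdonald (\<nu> - 1) z) / 2"
  \<comment> \<open>Half of Re z is given away: for norm h < x the perturbed integrand still decays
    like exp(-x cosh t), so a single majorant serves all such h.\<close>
  define x where "x = Re z / 2"
  have x: "x > 0" using z by (simp add: x_def)
  have Dint: "integrable lborel (\<lambda>t. of_real (cosh t) * ?e z t)"
    unfolding cosh_mult_macdonald_integrand using z by (intro integrable_divide Bochner_Integration.integrable_add integrable_macdonald)
  have D: "D = (LBINT t. of_real (cosh t) * ?e z t)"
    unfolding cosh_mult_macdonald_integrand D_def macdonald_def using z
    by (subst integral_divide_zero, subst Bochner_Integration.integral_add)
       (rule integrable_macdonald[OF z] refl)+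
  define b where "b = (\<lambda>t. (cosh t)\<^sup>2 * exp (\<nu> * t - x * cosh t))"
  have bint: "integrable lborel b"
  proof (rule Bochner_Integration.integrable_bound)
    \<comment> \<open>Expanding cosh^2 in exponentials shows that this sum is exactly 4 * b.\<close>
    show "integrable lborel (\<lambda>t. exp ((\<nu> + 2) * t - x * cosh t) + 2 * exp (\<nu> * t - x * cosh t) + exp ((\<nu> - 2) * t - x * cosh t))"
      using x by (intro Bochner_Integration.integrable_add integrable_mult_right integrable_exp_minus_cosh)
    show "b \<in> borel_measurable lborel" unfolding b_def
      by (simp, intro borel_measurable_continuous_onI continuous_intros)
    have "exp ((\<nu> + 2) * t - x * cosh t) + 2 * exp (\<nu> * t - x * cosh t) + exp ((\<nu> - 2) * t - x * cosh t) = 4 * b t" for t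
    proof -
      have "(cosh t)\<^sup>2 = (exp (2 * t) + 2 + exp (- 2 * t)) / 4"
        by (simp add: cosh_field_def power2_eq_square field_simps flip: exp_add)
      hence "4 * b t = exp (2 * t) * exp (\<nu> * t - x * cosh t) + 2 * exp (\<nu> * t - x * cosh t)
          + exp (- 2 * t) * exp (\<nu> * t - x * cosh t)"
        by (simp only: b_def) (simp add: algebra_simps)
      thus ?thesis by (simp add: algebra_simps flip: exp_add)
    qed
    thus "AE t in lborel. norm (b t) \<le> norm (exp ((\<nu> + 2) * t - x * cosh t) + 2 * exp (\<nu> * t - x * cosh t) + exp ((\<nu> - 2) * t - x * cosh t))"
      by (simp only:) simp
  qed
  define B where "B = (LBINT t. b t)"
  have err: "norm ((macdonald \<nu> (z + h) - macdonald \<nu> z) / h - (- D)) \<le> norm h * B"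
    if h: "h \<noteq> 0" "norm h < x" for h
  proof -
    have zh: "Re (z + h) > 0" using abs_Re_le_cmod[of h] h z unfolding x_def by (simp; linarith)
    have i1: "integrable lborel (?e (z + h))" "integrable lborel (?e z)"
      by (rule integrable_macdonald[OF zh] integrable_macdonald[OF z])+
    have eq: "macdonald \<nu> (z + h) - macdonald \<nu> z + h * D
      = (LBINT t. ?e (z + h) t - ?e z t + h * (of_real (cosh t) * ?e z t))"
      using i1 Dint by (simp add: macdonald_def D)
    have "norm (macdonald \<nu> (z + h) - macdonald \<nu> z + h * D) \<le> (LBINT t. (norm h)\<^sup>2 * b t)"
      unfolding eq
    proof (rule Bochner_Integration.integral_norm_bound_integral)
      show "integrable lborel (\<lambda>t. ?e (z + h) t - ?e z t + h * (of_real (cosh t) * ?e z t))"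
        using i1 Dint by auto
      show "integrable lborel (\<lambda>t. (norm h)\<^sup>2 * b t)" using bint by simp
      fix t :: real
      let ?c = "cosh t"
      have "?e (z + h) t = ?e z t * exp (- h * of_real ?c)"
        by (simp add: algebra_simps flip: exp_add)
      hence "?e (z + h) t - ?e z t + h * (of_real ?c * ?e z t)
         = ?e z t * (exp (- h * of_real ?c) - (\<Sum>k\<le>1. (- h * of_real ?c) ^ k / fact k))"
        by (simp add: algebra_simps)
      hence "norm (?e (z + h) t - ?e z t + h * (of_real ?c * ?e z t))
         = exp (\<nu> * t - Re z * ?c) * norm (exp (- h * of_real ?c) - (\<Sum>k\<le>1. (- h * of_real ?c) ^ k / fact k))"
        by (simp add: norm_mult)
      also have "\<dots> \<le> exp (\<nu> * t - Re z * ?c) * (exp \<bar>Re (- h * of_real ?c)\<bar> * norm (- h * of_real ?c) ^ Suc 1 / fact 1)"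
        by (intro mult_left_mono Taylor_exp) auto
      also have "\<dots> = (norm h)\<^sup>2 * ((?c)\<^sup>2 * exp (\<nu> * t - Re z * ?c + \<bar>Re h\<bar> * ?c))"
        by (simp add: norm_mult power2_eq_square abs_mult exp_add)
      also have "\<dots> \<le> (norm h)\<^sup>2 * ((?c)\<^sup>2 * exp (\<nu> * t - x * ?c))"
      proof -
        have "\<bar>Re h\<bar> * ?c \<le> x * ?c" using abs_Re_le_cmod[of h] h by (intro mult_right_mono) (auto simp: cosh_real_nonneg)
        moreover have "Re z * ?c = x * ?c + x * ?c" by (simp add: x_def)
        ultimately have "\<nu> * t - Re z * ?c + \<bar>Re h\<bar> * ?c \<le> \<nu> * t - x * ?c" by linarith
        thus ?thesis by (intro mult_left_mono) simp_all
      qed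
      finally show "norm (?e (z + h) t - ?e z t + h * (of_real ?c * ?e z t)) \<le> (norm h)\<^sup>2 * b t"
        by (simp add: b_def)
    qed
    also have "\<dots> = (norm h)\<^sup>2 * B" by (simp add: B_def)
    finally have "norm (macdonald \<nu> (z + h) - macdonald \<nu> z + h * D) / norm h \<le> norm h * B"
      using h by (simp add: field_simps power2_eq_square)
    moreover have "(macdonald \<nu> (z + h) - macdonald \<nu> z) / h - (- D) = (macdonald \<nu> (z + h) - macdonald \<nu> z + h * D) / h"
      using h by (simp add: field_simps)
    ultimately show ?thesis by (simp add: norm_divide)
  qed
  have "(\<lambda>h. (macdonald \<nu> (z + h) - macdonald \<nu> z) / h - (- D)) \<midarrow>0\<rightarrow> 0"
  proof (rule Lim_null_comparison)
    show "\<forall>\<^sub>F h in at 0. norm ((macdonald \<nu> (z + h) - macdonald \<nu> z) / h - (- D)) \<le> norm h * B"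
      unfolding eventually_at using x err by (intro exI[of _ x]) auto
    show "((\<lambda>h::complex. norm h * B) \<longlongrightarrow> 0) (at 0)"
      by (intro tendsto_eq_intros) auto
  qed
  hence "(macdonald \<nu> has_field_derivative - D) (at z)"
    unfolding DERIV_def by (subst (asm) LIM_zero_iff)
  thus ?thesis by (simp only: D_def minus_divide_left)
qed

text \<open>The t-derivative of exp(nu t - z cosh t) integrates to 0 over the line, since the
  function vanishes at both ends; its factor nu - z sinh t yields the three terms.\<close>

lemma macdonald_recurrence:
  assumes z: "Re z > 0"
  shows "z * (macdonald (\<nu> + 1) z - macdonald (\<nu> - 1) z) = of_real (2 * \<nu>) * macdonald \<nu> z"
proof -
  let ?e = "\<lambda>\<nu> t. exp (of_real (\<nu> * t) - z * of_real (cosh t)) :: complex"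
  let ?f = "\<lambda>t. of_real \<nu> * ?e \<nu> t - z / 2 * (?e (\<nu> + 1) t - ?e (\<nu> - 1) t)"
  have fint: "integrable lborel ?f"
    using z by (intro Bochner_Integration.integrable_diff integrable_mult_right integrable_macdonald)
  have lim: "(?e \<nu> \<longlongrightarrow> 0) F" if "F = at_top \<or> F = at_bot" for F
  proof (rule Lim_null_comparison)
    show "\<forall>\<^sub>F t in F. norm (?e \<nu> t) \<le> exp ((\<bar>\<nu>\<bar> + 1)\<^sup>2 / Re z) * exp (- \<bar>t\<bar>)"
      using exp_minus_cosh_le[OF z, of \<nu>] by (intro always_eventually) (simp add: norm_macdonald_integrand)
    have "filterlim (\<lambda>t::real. \<bar>t\<bar>) at_top F"
      using that filterlim_abs_real filterlim_compose[OF filterlim_abs_real filterlim_uminus_at_top_at_bot]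
      by auto
    hence "((\<lambda>t. exp (- \<bar>t\<bar>)) \<longlongrightarrow> 0) F"
      by (intro filterlim_compose[OF exp_at_bot]) (simp add: filterlim_uminus_at_bot)
    from tendsto_mult_left[OF this, of "exp ((\<bar>\<nu>\<bar> + 1)\<^sup>2 / Re z)"]
    show "((\<lambda>t. exp ((\<bar>\<nu>\<bar> + 1)\<^sup>2 / Re z) * exp (- \<bar>t\<bar>)) \<longlongrightarrow> 0) F" by simp
  qed
  have "(LBINT t=-\<infinity>..\<infinity>. ?f t) = 0 - 0"
  proof (rule interval_integral_FTC_integrable)
    fix t :: real
    have "(?e \<nu> has_vector_derivative ?e \<nu> t * (of_real \<nu> - z * of_real (sinh t))) (at t)"
      by (rule has_vector_derivative_eq_rhs, rule field_vector_diff_chain_at[OF _ DERIV_exp, unfolded o_def])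
         (auto intro!: derivative_eq_intros has_vector_derivative_of_real)
    also have "?e (\<nu> + 1) t - ?e (\<nu> - 1) t = 2 * (of_real (sinh t) * ?e \<nu> t)"
      unfolding sinh_mult_macdonald_integrand by simp
    hence "?e \<nu> t * (of_real \<nu> - z * of_real (sinh t)) = ?f t"
      by (simp only: right_diff_distrib) simp
    finally show "(?e \<nu> has_vector_derivative ?f t) (at t)" .
    show "isCont ?f t"
      by (intro continuous_on_interior[of UNIV] continuous_intros) auto
  next
    show "set_integrable lborel (einterval (-\<infinity>) \<infinity>) ?f" using fint by (simp add: set_integrable_def)
    show "((?e \<nu> \<circ> real_of_ereal) \<longlongrightarrow> 0) (at_right (-\<infinity>))" "((?e \<nu> \<circ> real_of_ereal) \<longlongrightarrow> 0) (at_left \<infinity>)"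
      unfolding ereal_tendsto_simps using lim by blast+
  qed simp
  hence "(LBINT t. ?f t) = 0" by (simp add: interval_lebesgue_integral_def set_lebesgue_integral_def)
  also have "(LBINT t. ?f t) = of_real \<nu> * macdonald \<nu> z - z / 2 * (macdonald (\<nu> + 1) z - macdonald (\<nu> - 1) z)"
    unfolding macdonald_def
    by (subst Bochner_Integration.integral_diff,
        (intro integrable_mult_right Bochner_Integration.integrable_diff integrable_macdonald z)+,
        subst (1 2) integral_mult_right_zero, subst Bochner_Integration.integral_diff)
       (rule integrable_macdonald[OF z] refl)+
  finally show ?thesis by (simp add: algebra_simps)
qed

text \<open>Rescaling t by 1 / sqrt(Re z) turns the quadratic lower bound for cosh into a Gaussian
  that does not depend on z. The resulting 1 / sqrt(Re z) later cancels the factor sqrt r of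
  xi.\<close>

lemma macdonald_decay:
  assumes a: "a > 0"
  obtains C where "\<And>z. Re z \<ge> a \<Longrightarrow> norm (macdonald \<nu> z) \<le> C * exp (- Re z) / sqrt (Re z)"
proof
  \<comment> \<open>After rescaling the linear term has slope |nu| / sqrt y, which is at most
    \<open>b\<close> uniformly for y >= a.\<close>
  define b where "b = \<bar>\<nu>\<bar> / sqrt a"
  define C where "C = (LBINT t. exp (b * \<bar>t\<bar> - t\<^sup>2 / 4))"
  have intC: "integrable lborel (\<lambda>t. exp (b * \<bar>t\<bar> - t\<^sup>2 / 4))"
  proof (rule Bochner_Integration.integrable_bound)
    show "integrable lborel (\<lambda>t. exp ((b + 1)\<^sup>2) * exp (- \<bar>t\<bar>))"
      by (intro integrable_mult_right integrable_exp_minus_abs)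
    have "b * \<bar>t\<bar> - t\<^sup>2 / 4 \<le> (b + 1)\<^sup>2 + - \<bar>t\<bar>" for t
      using linear_minus_quadratic_le[of 1 "b + 1" "\<bar>t\<bar>"] by (simp add: algebra_simps)
    thus "AE t in lborel. norm (exp (b * \<bar>t\<bar> - t\<^sup>2 / 4)) \<le> norm (exp ((b + 1)\<^sup>2) * exp (- \<bar>t\<bar>))"
      unfolding exp_add[symmetric] by auto
  qed measurable
  fix z :: complex assume z: "Re z \<ge> a"
  define y where "y = Re z"
  have y: "y > 0" "y \<ge> a" using z a by (auto simp: y_def)
  have "norm (macdonald \<nu> z) \<le> (LBINT t. exp (\<nu> * t - y * cosh t))"
    unfolding y_def using y by (intro norm_macdonald_le) (auto simp: y_def)
  also have "\<dots> = \<bar>1 / sqrt y\<bar> *\<^sub>R (LBINT t. exp (\<nu> * (0 + 1 / sqrt y * t) - y * cosh (0 + 1 / sqrt y * t)))"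
    using y by (intro lborel_integral_real_affine) auto
  also have "\<dots> \<le> \<bar>1 / sqrt y\<bar> *\<^sub>R (LBINT t. exp (- y) * exp (b * \<bar>t\<bar> - t\<^sup>2 / 4))"
  proof (intro scaleR_left_mono integral_mono)
    show "integrable lborel (\<lambda>t. exp (\<nu> * (0 + 1 / sqrt y * t) - y * cosh (0 + 1 / sqrt y * t)))"
      using y lborel_integrable_real_affine[OF integrable_exp_minus_cosh[OF y(1), of \<nu>], of "1 / sqrt y" 0] by simp
    show "integrable lborel (\<lambda>t. exp (- y) * exp (b * \<bar>t\<bar> - t\<^sup>2 / 4))" using intC by simp
    fix t :: real
    let ?t = "0 + 1 / sqrt y * t"
    have "y * (1 + ?t\<^sup>2 / 4) \<le> y * cosh ?t" using y cosh_ge_quadratic by (intro mult_left_mono) auto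
    moreover have "y * ?t\<^sup>2 = t\<^sup>2" using y by (simp add: power_divide)
    moreover have "\<nu> * ?t \<le> b * \<bar>t\<bar>"
    proof -
      have "\<nu> * ?t \<le> \<bar>\<nu> * ?t\<bar>" by (rule abs_ge_self)
      also have "\<dots> = \<bar>\<nu>\<bar> / sqrt y * \<bar>t\<bar>" using y by (simp add: abs_mult)
      also have "\<dots> \<le> b * \<bar>t\<bar>" unfolding b_def using y a by (intro mult_right_mono divide_left_mono) auto
      finally show ?thesis .
    qed
    ultimately show "exp (\<nu> * ?t - y * cosh ?t) \<le> exp (- y) * exp (b * \<bar>t\<bar> - t\<^sup>2 / 4)"
      unfolding exp_add[symmetric] exp_le_cancel_iff by (simp add: ring_distribs)
  qed auto
  also have "\<dots> = C * exp (- y) / sqrt y" using y by (simp add: C_def)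
  finally show "norm (macdonald \<nu> z) \<le> C * exp (- Re z) / sqrt (Re z)" by (simp add: y_def)
qed

text \<open>Euler's integral for Gamma under the substitution t = exp s / 2.\<close>

lemma has_bochner_integral_Gamma_exp:
  fixes \<nu> :: real
  assumes "\<nu> > 0"
  shows "has_bochner_integral lborel (\<lambda>s. exp (\<nu> * s - exp s / 2)) (2 powr \<nu> * Gamma \<nu>)"
proof -
  let ?f = "\<lambda>t::real. t powr (\<nu> - 1) / exp t" and ?g = "\<lambda>s::real. exp s / 2"
  have G: "(?f has_integral Gamma \<nu>) {0..}" by (rule Gamma_integral_real[OF assms])
  hence G': "(?f has_integral Gamma \<nu>) {0<..}"
    by (subst has_integral_spike_set_eq[of _ "{0..}"]) (auto intro: negligible_subset[of "{0}"])
  have img: "range ?g = {0<..}"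
  proof safe
    fix x :: real assume "x > 0"
    thus "x \<in> range ?g" by (intro image_eqI[of _ _ "ln (2 * x)"]) auto
  qed auto
  have "?f absolutely_integrable_on {0<..}"
    using G' by (intro nonnegative_absolutely_integrable_1) (auto simp: integrable_on_def)
  with G' have "?f absolutely_integrable_on (range ?g) \<and> integral (range ?g) ?f = Gamma \<nu>"
    by (simp add: img integral_unique)
  hence "(\<lambda>s. \<bar>exp s / 2\<bar> * ?f (exp s / 2)) absolutely_integrable_on UNIV \<and>
      integral UNIV (\<lambda>s. \<bar>exp s / 2\<bar> * ?f (exp s / 2)) = Gamma \<nu>"
    by (subst has_absolute_integral_change_of_variables_1'[of UNIV ?g])
       (auto intro!: derivative_eq_intros inj_onI)
  moreover have "\<bar>exp s / 2\<bar> * ?f (exp s / 2) = 2 powr (- \<nu>) * exp (\<nu> * s - exp s / 2)" for s :: real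
    by (simp add: powr_divide powr_minus exp_powr_real powr_diff field_simps) (simp add: field_simps flip: exp_add)
  ultimately have "((\<lambda>s. 2 powr (- \<nu>) * exp (\<nu> * s - exp s / 2)) has_integral Gamma \<nu>) UNIV"
    by (simp only: absolutely_integrable_on_def has_integral_iff)
  hence "((\<lambda>s. 2 powr \<nu> * (2 powr (- \<nu>) * exp (\<nu> * s - exp s / 2))) has_integral 2 powr \<nu> * Gamma \<nu>) UNIV"
    by (rule has_integral_mult_right)
  hence "((\<lambda>s. exp (\<nu> * s - exp s / 2)) has_integral 2 powr \<nu> * Gamma \<nu>) UNIV"
    by (simp add: powr_minus flip: mult.assoc)
  from nn_integral_has_integral_lborel[OF _ _ this] assms
  show ?thesis by (intro has_bochner_integral_nn_integral) (auto simp: Gamma_real_pos less_imp_le)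
qed

text \<open>Shifting t by -ln y turns y cosh t into exp t / 2 + y^2 exp(-t) / 2, whose second term
  disappears as y -> 0; dominated convergence then leaves the Gamma integral. One sequence suffices
  because the limit only serves to identify a constant.\<close>

lemma macdonald_at_0:
  fixes \<nu> :: real
  assumes \<nu>: "\<nu> > 0"
  shows "(\<lambda>n. of_real (inverse (real (Suc n)) powr \<nu>) * macdonald \<nu> (of_real (inverse (real (Suc n)))))
           \<longlonglongrightarrow> of_real (2 powr \<nu> * Gamma \<nu>)"
proof -
  let ?h = "\<lambda>y s. exp (\<nu> * s - exp s / 2 - y\<^sup>2 * exp (- s) / 2)"
  have eq: "of_real (y powr \<nu>) * macdonald \<nu> (of_real y) = of_real (LBINT s. ?h y s)" if y: "y > 0" for y :: real
  proof -
    have "macdonald \<nu> (of_real y) = (CLBINT t. of_real (exp (\<nu> * t - y * cosh t)))"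
      unfolding macdonald_def by (simp flip: exp_of_real)
    also have "\<dots> = of_real (LBINT t. exp (\<nu> * t - y * cosh t))" by simp
    also have "(LBINT t. exp (\<nu> * t - y * cosh t)) = (LBINT t. exp (\<nu> * (- ln y + 1 * t) - y * cosh (- ln y + 1 * t)))"
      by (subst lborel_integral_real_affine[of 1 _ "- ln y"]) auto
    also have "(\<lambda>t. exp (\<nu> * (- ln y + 1 * t) - y * cosh (- ln y + 1 * t))) = (\<lambda>t. y powr (- \<nu>) * ?h y t)"
    proof
      fix t
      have "y * cosh (- ln y + 1 * t) = exp t / 2 + y\<^sup>2 * exp (- t) / 2"
        using y by (simp add: cosh_field_def exp_add exp_diff exp_minus field_simps power2_eq_square)
      moreover have "y powr (- \<nu>) = exp (- \<nu> * ln y)" using y by (simp add: powr_def)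
      ultimately show "exp (\<nu> * (- ln y + 1 * t) - y * cosh (- ln y + 1 * t)) = y powr (- \<nu>) * ?h y t"
        by (simp add: algebra_simps flip: exp_add)
    qed
    finally show ?thesis using y by (simp add: powr_minus)
  qed
  have "(\<lambda>n. LBINT s. ?h (inverse (real (Suc n))) s) \<longlonglongrightarrow> (LBINT s. exp (\<nu> * s - exp s / 2))"
  proof (rule integral_dominated_convergence[where w = "\<lambda>s. exp (\<nu> * s - exp s / 2)"])
    show "integrable lborel (\<lambda>s. exp (\<nu> * s - exp s / 2))"
      using has_bochner_integral_Gamma_exp[OF \<nu>] has_bochner_integral_iff by blast
    show "AE s in lborel. (\<lambda>n. ?h (inverse (real (Suc n))) s) \<longlonglongrightarrow> exp (\<nu> * s - exp s / 2)"
    proof (rule AE_I2)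
      fix s
      have "(\<lambda>n. ?h (inverse (real (Suc n))) s) \<longlonglongrightarrow> exp (\<nu> * s - exp s / 2 - 0\<^sup>2 * exp (- s) / 2)"
        by (intro tendsto_intros LIMSEQ_inverse_real_of_nat) auto
      thus "(\<lambda>n. ?h (inverse (real (Suc n))) s) \<longlonglongrightarrow> exp (\<nu> * s - exp s / 2)" by simp
    qed
  qed (auto intro!: borel_measurable_continuous_onI continuous_intros)
  also have "(LBINT s. exp (\<nu> * s - exp s / 2)) = 2 powr \<nu> * Gamma \<nu>"
    using has_bochner_integral_Gamma_exp[OF \<nu>] by (simp add: has_bochner_integral_iff)
  finally have "(\<lambda>n. complex_of_real (LBINT s. ?h (inverse (real (Suc n))) s)) \<longlonglongrightarrow> of_real (2 powr \<nu> * Gamma \<nu>)"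
    by (rule tendsto_of_real)
  thus ?thesis by (subst eq) simp_all
qed

section \<open>Connection formula\<close>

definition bessel_I :: "real \<Rightarrow> complex \<Rightarrow> complex" where
  "bessel_I \<nu> z = (z / 2) powr of_real \<nu> * bessel_entire \<nu> (z\<^sup>2 / 4)"

lemma half_powr_add_1: "z \<noteq> 0 \<Longrightarrow> (z / 2) powr of_real (\<nu> + 1) = (z / 2) powr of_real \<nu> * (z / 2 :: complex)"
  by (simp add: powr_add)

lemma bessel_I_recurrence:
  assumes "z \<noteq> 0"
  shows "z * (bessel_I (\<nu> - 1) z - bessel_I (\<nu> + 1) z) = of_real (2 * \<nu>) * bessel_I \<nu> z"
proof -
  have p: "(z / 2) powr of_real \<nu> = (z / 2) powr of_real (\<nu> - 1) * (z / 2)"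
    using half_powr_add_1[OF assms, of "\<nu> - 1"] by simp
  show ?thesis
    unfolding bessel_I_def half_powr_add_1[OF assms] bessel_entire_recurrence[of \<nu>] p
    by (simp add: algebra_simps power2_eq_square)
qed

lemma has_field_derivative_bessel_I:
  assumes z: "Re z > 0"
  shows "(bessel_I \<nu> has_field_derivative bessel_I (\<nu> + 1) z + of_real \<nu> / z * bessel_I \<nu> z) (at z)"
proof -
  have z0: "z \<noteq> 0" and zr: "z / 2 \<notin> \<real>\<^sub>\<le>\<^sub>0" using z by (auto simp: complex_nonpos_Reals_iff)
  have "((\<lambda>z. (z / 2) powr of_real \<nu>) has_field_derivative of_real \<nu> * (z / 2) powr (of_real \<nu> - 1) * (1 / 2)) (at z)"
    by (rule DERIV_chain2[where g = "\<lambda>z. z / 2", OF has_field_derivative_powr[OF zr]]) (auto intro!: derivative_eq_intros)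
  moreover have "of_real \<nu> * (z / 2) powr (of_real \<nu> - 1) * (1 / 2) = of_real \<nu> / z * (z / 2) powr of_real \<nu>"
    using z0 by (simp add: powr_diff field_simps)
  ultimately have 1: "((\<lambda>z. (z / 2) powr of_real \<nu>) has_field_derivative of_real \<nu> / z * (z / 2) powr of_real \<nu>) (at z)"
    by (simp only:)
  have 2: "((\<lambda>z. bessel_entire \<nu> (z\<^sup>2 / 4)) has_field_derivative bessel_entire (\<nu> + 1) (z\<^sup>2 / 4) * (z / 2)) (at z)"
    by (auto intro!: derivative_eq_intros)
  from DERIV_mult[OF 1 2] show ?thesis
    unfolding bessel_I_def half_powr_add_1[OF z0] by (simp add: algebra_simps)
qed

text \<open>Involves only the orders nu and nu + 1, so that together with the previous lemma the
  pair of functions satisfies a closed first order system. The two forms for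
  \<open>macdonald\<close> below serve the same purpose; in the Wronskian all terms then
  cancel.\<close>

lemma has_field_derivative_bessel_I_Suc:
  assumes z: "Re z > 0"
  shows "(bessel_I (\<nu> + 1) has_field_derivative bessel_I \<nu> z - of_real (\<nu> + 1) / z * bessel_I (\<nu> + 1) z) (at z)"
proof -
  have z0: "z \<noteq> 0" using z by auto
  have "bessel_I \<nu> z - bessel_I (\<nu> + 1 + 1) z = of_real (2 * (\<nu> + 1)) * bessel_I (\<nu> + 1) z / z"
    using bessel_I_recurrence[OF z0, of "\<nu> + 1"] z0 by (simp add: field_simps)
  hence "bessel_I (\<nu> + 1 + 1) z = bessel_I \<nu> z - 2 * (of_real (\<nu> + 1) / z * bessel_I (\<nu> + 1) z)"
    by (simp add: field_simps)
  thus ?thesis using has_field_derivative_bessel_I[OF z, of "\<nu> + 1"] by simp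
qed

lemma has_field_derivative_macdonald_up:
  assumes z: "Re z > 0"
  shows "(macdonald \<nu> has_field_derivative of_real \<nu> / z * macdonald \<nu> z - macdonald (\<nu> + 1) z) (at z)"
proof -
  have z0: "z \<noteq> 0" using z by auto
  have "- (macdonald (\<nu> + 1) z + macdonald (\<nu> - 1) z) / 2 = of_real \<nu> / z * macdonald \<nu> z - macdonald (\<nu> + 1) z"
    using macdonald_recurrence[OF z, of \<nu>] z0 by (simp add: field_simps)
  thus ?thesis using has_field_derivative_macdonald[OF z, of \<nu>] by (simp only:)
qed

lemma has_field_derivative_macdonald_Suc:
  assumes z: "Re z > 0"
  shows "(macdonald (\<nu> + 1) has_field_derivative - macdonald \<nu> z - of_real (\<nu> + 1) / z * macdonald (\<nu> + 1) z) (at z)"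
proof -
  have z0: "z \<noteq> 0" using z by auto
  have "- (macdonald (\<nu> + 1 + 1) z + macdonald (\<nu> + 1 - 1) z) / 2 = - macdonald \<nu> z - of_real (\<nu> + 1) / z * macdonald (\<nu> + 1) z"
    using macdonald_recurrence[OF z, of "\<nu> + 1"] z0 by (simp add: field_simps)
  thus ?thesis using has_field_derivative_macdonald[OF z, of "\<nu> + 1"] by (simp only:)
qed

lemma bessel_I_at_0:
  "(\<lambda>n. of_real (inverse (real (Suc n)) powr (- \<nu>)) * bessel_I \<nu> (of_real (inverse (real (Suc n)))))
     \<longlonglongrightarrow> of_real (2 powr (- \<nu>) * rGamma (1 + \<nu>))"
proof -
  have eq: "of_real (y powr (- \<nu>)) * bessel_I \<nu> (of_real y) = of_real (2 powr (- \<nu>)) * bessel_entire \<nu> ((of_real y)\<^sup>2 / 4)"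
    if y: "y > 0" for y :: real
  proof -
    have "(complex_of_real y / 2) powr of_real \<nu> = of_real ((y / 2) powr \<nu>)"
      using y powr_of_real[of "y / 2" \<nu>] by simp
    moreover have "y powr (- \<nu>) * (y / 2) powr \<nu> = 2 powr (- \<nu>)"
      using y by (simp add: powr_minus powr_divide field_simps)
    ultimately show ?thesis unfolding bessel_I_def
      by (simp only: mult.assoc[symmetric] of_real_mult[symmetric])
  qed
  have c: "isCont (\<lambda>y::complex. bessel_entire \<nu> (y\<^sup>2 / 4)) 0"
    by (intro continuous_on_interior[of UNIV] continuous_intros) auto
  have "(\<lambda>n. complex_of_real (inverse (real (Suc n)))) \<longlonglongrightarrow> 0"
    using tendsto_of_real[OF LIMSEQ_inverse_real_of_nat, where ?'a = complex] by simp
  from isCont_tendsto_compose[OF c this]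
  have "(\<lambda>n. complex_of_real (2 powr (- \<nu>)) * bessel_entire \<nu> ((of_real (inverse (real (Suc n))))\<^sup>2 / 4))
     \<longlonglongrightarrow> of_real (2 powr (- \<nu>)) * bessel_entire \<nu> (0\<^sup>2 / 4)"
    by (intro tendsto_mult_left)
  thus ?thesis by (subst eq) simp_all
qed

text \<open>The left side has derivative 0 on the right half-plane, hence is constant, and its value
  is found by letting z -> 0 along 1/(n+1). It is 2 instead of the classical 1 because
  \<open>macdonald\<close> is twice K.\<close>

lemma wronskian_macdonald_bessel_I:
  assumes \<mu>: "- 1 < \<mu>" "\<mu> < 1" "\<mu> \<noteq> 0" and z: "Re z > 0"
  shows "z * (macdonald \<mu> z * bessel_I (\<mu> + 1) z + macdonald (\<mu> + 1) z * bessel_I \<mu> z) = 2"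
proof -
  let ?K = macdonald and ?I = bessel_I
  let ?T = "\<lambda>z. z * (?K \<mu> z * ?I (\<mu> + 1) z + ?K (\<mu> + 1) z * ?I \<mu> z)"
  have "(?T has_field_derivative 0) (at z)" if z: "Re z > 0" for z
  proof -
    have z0: "z \<noteq> 0" using z by auto
    let ?a = "of_real \<mu> / z" and ?b = "of_real (\<mu> + 1) / z"
    have ab: "?b = ?a + 1 / z" by (simp add: add_divide_distrib)
    have "(?T has_field_derivative
        (1 * (?K \<mu> z * ?I (\<mu> + 1) z + ?K (\<mu> + 1) z * ?I \<mu> z) +
         (((?a * ?K \<mu> z - ?K (\<mu> + 1) z) * ?I (\<mu> + 1) z + (?I \<mu> z - ?b * ?I (\<mu> + 1) z) * ?K \<mu> z) +
          ((- ?K \<mu> z - ?b * ?K (\<mu> + 1) z) * ?I \<mu> z + (?I (\<mu> + 1) z + ?a * ?I \<mu> z) * ?K (\<mu> + 1) z)) * z)) (at z)"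
      by (intro DERIV_mult DERIV_add DERIV_ident has_field_derivative_macdonald_up[OF z]
           has_field_derivative_macdonald_Suc[OF z] has_field_derivative_bessel_I[OF z] has_field_derivative_bessel_I_Suc[OF z])
    also have "(1 * (?K \<mu> z * ?I (\<mu> + 1) z + ?K (\<mu> + 1) z * ?I \<mu> z) +
         (((?a * ?K \<mu> z - ?K (\<mu> + 1) z) * ?I (\<mu> + 1) z + (?I \<mu> z - ?b * ?I (\<mu> + 1) z) * ?K \<mu> z) +
          ((- ?K \<mu> z - ?b * ?K (\<mu> + 1) z) * ?I \<mu> z + (?I (\<mu> + 1) z + ?a * ?I \<mu> z) * ?K (\<mu> + 1) z)) * z) = 0"
      unfolding ab using z0 by (simp add: ring_distribs)
    finally show ?thesis .
  qed
  hence "\<exists>c. \<forall>z\<in>{z. Re z > 0}. ?T z = c"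
    by (intro has_field_derivative_zero_constant)
       (auto intro: has_field_derivative_at_within convex_halfspace_Re_gt)
  then obtain c where c: "\<And>z. Re z > 0 \<Longrightarrow> ?T z = c" by auto
  let ?y = "\<lambda>n. inverse (real (Suc n))"
  have y: "?y n > 0" for n by simp
  \<comment> \<open>Each factor is paired with the power of y that gives it a finite limit.
    \<open>macdonald_at_0\<close> needs a positive order, whence |mu|. The power left over in the
    first product, 2 + mu - |mu|, is positive since mu > -1, so only the second product
    survives.\<close>
  have "?T (of_real (?y n)) =
      of_real (?y n powr (2 + \<mu> - \<bar>\<mu>\<bar>)) *
        ((of_real (?y n powr \<bar>\<mu>\<bar>) * ?K \<bar>\<mu>\<bar> (of_real (?y n))) * (of_real (?y n powr - (\<mu> + 1)) * ?I (\<mu> + 1) (of_real (?y n))))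
    + (of_real (?y n powr (\<mu> + 1)) * ?K (\<mu> + 1) (of_real (?y n))) * (of_real (?y n powr - \<mu>) * ?I \<mu> (of_real (?y n)))" for n
  proof -
    have K: "?K \<bar>\<mu>\<bar> w = ?K \<mu> w" for w using macdonald_minus[of \<mu> w] by (cases "\<mu> \<ge> 0") auto
    have e1: "?y n powr (2 + \<mu> - \<bar>\<mu>\<bar>) * ?y n powr \<bar>\<mu>\<bar> * ?y n powr - (\<mu> + 1) = ?y n"
      using y[of n] by (simp flip: powr_add del: of_nat_Suc)
    have e2: "?y n powr (\<mu> + 1) * ?y n powr - \<mu> = ?y n"
      using y[of n] by (simp flip: powr_add del: of_nat_Suc)
    have "?T (of_real (?y n)) = of_real (?y n) * (?K \<mu> (of_real (?y n)) * ?I (\<mu> + 1) (of_real (?y n)))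
       + of_real (?y n) * (?K (\<mu> + 1) (of_real (?y n)) * ?I \<mu> (of_real (?y n)))"
      by (simp only: distrib_left)
    also have "\<dots> = of_real (?y n powr (2 + \<mu> - \<bar>\<mu>\<bar>) * ?y n powr \<bar>\<mu>\<bar> * ?y n powr - (\<mu> + 1)) * (?K \<mu> (of_real (?y n)) * ?I (\<mu> + 1) (of_real (?y n)))
       + of_real (?y n powr (\<mu> + 1) * ?y n powr - \<mu>) * (?K (\<mu> + 1) (of_real (?y n)) * ?I \<mu> (of_real (?y n)))"
      by (simp only: e1 e2)
    finally show ?thesis by (simp only: K of_real_mult mult_ac)
  qed
  moreover have "(\<lambda>n. of_real (?y n powr (2 + \<mu> - \<bar>\<mu>\<bar>)) *
        ((of_real (?y n powr \<bar>\<mu>\<bar>) * ?K \<bar>\<mu>\<bar> (of_real (?y n))) * (of_real (?y n powr - (\<mu> + 1)) * ?I (\<mu> + 1) (of_real (?y n))))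
    + (of_real (?y n powr (\<mu> + 1)) * ?K (\<mu> + 1) (of_real (?y n))) * (of_real (?y n powr - \<mu>) * ?I \<mu> (of_real (?y n))))
    \<longlonglongrightarrow> of_real (0 powr (2 + \<mu> - \<bar>\<mu>\<bar>)) *
        (of_real (2 powr \<bar>\<mu>\<bar> * Gamma \<bar>\<mu>\<bar>) * of_real (2 powr (- (\<mu> + 1)) * rGamma (1 + (\<mu> + 1)))) +
      of_real (2 powr (\<mu> + 1) * Gamma (\<mu> + 1)) * of_real (2 powr (- \<mu>) * rGamma (1 + \<mu>))"
  proof (intro tendsto_mult tendsto_add macdonald_at_0 bessel_I_at_0 tendsto_of_real)
    show "(\<lambda>n. ?y n powr (2 + \<mu> - \<bar>\<mu>\<bar>)) \<longlonglongrightarrow> 0 powr (2 + \<mu> - \<bar>\<mu>\<bar>)"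
      by (rule tendsto_powr'[OF LIMSEQ_inverse_real_of_nat tendsto_const]) (use \<mu> in auto)
  qed (use \<mu> in auto)
  ultimately have "(\<lambda>n. ?T (of_real (?y n))) \<longlonglongrightarrow> of_real (2 powr (\<mu> + 1) * Gamma (\<mu> + 1)) * of_real (2 powr (- \<mu>) * rGamma (1 + \<mu>))"
    by (simp only:) simp
  moreover have "2 powr (\<mu> + 1) * Gamma (\<mu> + 1) * (2 powr (- \<mu>) * rGamma (1 + \<mu>)) = 2"
  proof -
    have "Gamma (\<mu> + 1) > 0" using \<mu> by (intro Gamma_real_pos) auto
    hence "Gamma (\<mu> + 1) * rGamma (1 + \<mu>) = 1" by (simp add: rGamma_inverse_Gamma add.commute)
    moreover have "2 powr (\<mu> + 1) * 2 powr (- \<mu>) = (2::real)" by (simp flip: powr_add)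
    moreover have "2 powr (\<mu> + 1) * Gamma (\<mu> + 1) * (2 powr (- \<mu>) * rGamma (1 + \<mu>))
        = (2 powr (\<mu> + 1) * 2 powr (- \<mu>)) * (Gamma (\<mu> + 1) * rGamma (1 + \<mu>))"
      by (simp only: mult_ac)
    ultimately show ?thesis by (simp only: mult_1_right)
  qed
  ultimately have "(\<lambda>n. ?T (of_real (?y n))) \<longlonglongrightarrow> 2"
    by (simp only: of_real_mult[symmetric] of_real_numeral)
  moreover have "?T (of_real (?y n)) = c" for n by (rule c) simp
  ultimately have "(\<lambda>n::nat. c) \<longlonglongrightarrow> 2" by (simp only:)
  hence "c = 2" by (simp add: LIMSEQ_const_iff)
  thus ?thesis using c[OF z] by simp
qed

text \<open>Cramer's rule: \<open>T1\<close> and \<open>T2'\<close> are two linear equations for the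
  Macdonald functions of order alpha and alpha + 1, and their determinant is the Wronskian
  \<open>S\<close> of the two modified Bessel functions.\<close>

lemma macdonald_eq_bessel_I:
  assumes \<alpha>: "0 < \<alpha>" "\<alpha> < 1" and z: "Re z > 0"
  shows "of_real (sin (pi * \<alpha>) / pi) * macdonald \<alpha> z = bessel_I (- \<alpha>) z - bessel_I \<alpha> z"
proof -
  let ?K = macdonald and ?I = bessel_I
  have z0: "z \<noteq> 0" using z by auto
  have S: "z * (?I \<alpha> z * ?I (- \<alpha> - 1) z - ?I (\<alpha> + 1) z * ?I (- \<alpha>) z) = of_real (- 2 * sin (pi * \<alpha>) / pi)"
  proof -
    have p: "(z / 2) powr of_real \<alpha> * (z / 2) powr of_real (- \<alpha>) = 1"
      using z0 by (simp add: powr_minus)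
    have p1: "(z / 2) powr of_real (- \<alpha>) = (z / 2) powr of_real (- \<alpha> - 1) * (z / 2)"
      using half_powr_add_1[OF z0, of "- \<alpha> - 1"] by simp
    have "z * (?I \<alpha> z * ?I (- \<alpha> - 1) z - ?I (\<alpha> + 1) z * ?I (- \<alpha>) z) =
      2 * ((z / 2) powr of_real \<alpha> * ((z / 2) powr of_real (- \<alpha> - 1) * (z / 2))) *
        (bessel_entire \<alpha> (z\<^sup>2 / 4) * bessel_entire (- \<alpha> - 1) (z\<^sup>2 / 4)
         - z\<^sup>2 / 4 * bessel_entire (\<alpha> + 1) (z\<^sup>2 / 4) * bessel_entire (- \<alpha>) (z\<^sup>2 / 4))"
      unfolding bessel_I_def half_powr_add_1[OF z0] p1 by (simp add: algebra_simps power2_eq_square)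
    also have "\<dots> = 2 * of_real (- sin (pi * \<alpha>) / pi)"
      unfolding p1[symmetric] p bessel_entire_wronskian by simp
    finally show ?thesis by simp
  qed
  have T1: "z * (?K \<alpha> z * ?I (\<alpha> + 1) z + ?K (\<alpha> + 1) z * ?I \<alpha> z) = 2"
    using \<alpha> z by (intro wronskian_macdonald_bessel_I) auto
  have T2: "z * (?K \<alpha> z * ?I (- \<alpha> + 1) z + ?K (\<alpha> - 1) z * ?I (- \<alpha>) z) = 2"
    using wronskian_macdonald_bessel_I[of "- \<alpha>" z] \<alpha> z macdonald_minus[of \<alpha> z] macdonald_minus[of "\<alpha> - 1" z] by simp
  have R1: "z * ?K (\<alpha> - 1) z = z * ?K (\<alpha> + 1) z - of_real (2 * \<alpha>) * ?K \<alpha> z"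
    using macdonald_recurrence[OF z, of \<alpha>] by (simp add: algebra_simps)
  have R2: "z * ?I (- \<alpha> + 1) z = z * ?I (- \<alpha> - 1) z + of_real (2 * \<alpha>) * ?I (- \<alpha>) z"
    using bessel_I_recurrence[OF z0, of "- \<alpha>"] by (simp add: algebra_simps)
  \<comment> \<open>Moves \<open>T2\<close> to the same unknowns as \<open>T1\<close>; the
    corrections 2 alpha K I from \<open>R1\<close> and \<open>R2\<close> have opposite signs and
    cancel.\<close>
  have T2': "z * (?K \<alpha> z * ?I (- \<alpha> - 1) z + ?K (\<alpha> + 1) z * ?I (- \<alpha>) z) = 2"
  proof -
    have "?K \<alpha> z * (z * ?I (- \<alpha> + 1) z) + (z * ?K (\<alpha> - 1) z) * ?I (- \<alpha>) z = 2"
      using T2 by (simp add: algebra_simps)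
    thus ?thesis unfolding R1 R2 by (simp add: algebra_simps)
  qed
  have "- (?K \<alpha> z * (z * (?I \<alpha> z * ?I (- \<alpha> - 1) z - ?I (\<alpha> + 1) z * ?I (- \<alpha>) z)))
      = (z * (?K \<alpha> z * ?I (\<alpha> + 1) z + ?K (\<alpha> + 1) z * ?I \<alpha> z)) * ?I (- \<alpha>) z
       - (z * (?K \<alpha> z * ?I (- \<alpha> - 1) z + ?K (\<alpha> + 1) z * ?I (- \<alpha>) z)) * ?I \<alpha> z"
    by (simp add: algebra_simps)
  also have "\<dots> = 2 * (?I (- \<alpha>) z - ?I \<alpha> z)"
    unfolding T1 T2' by (simp add: algebra_simps)
  finally have "- (?K \<alpha> z * (z * (?I \<alpha> z * ?I (- \<alpha> - 1) z - ?I (\<alpha> + 1) z * ?I (- \<alpha>) z)))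
      = 2 * (?I (- \<alpha>) z - ?I \<alpha> z)" .
  hence "2 * (of_real (sin (pi * \<alpha>) / pi) * ?K \<alpha> z) = 2 * (?I (- \<alpha>) z - ?I \<alpha> z)"
    unfolding S by (simp add: mult_ac)
  thus ?thesis by (simp only: mult_cancel_left) simp
qed

section \<open>Integration by parts and a Schur bound\<close>

lemma continuous_on_indefinite_lebesgue_integral:
  fixes h :: "real \<Rightarrow> complex"
  assumes h: "set_integrable lborel {a..b} h"
  shows "continuous_on {a..b} (\<lambda>x. LINT t:{a..x}|lborel. h t)"
proof -
  have "(LINT t:{a..x}|lborel. h t) = integral {a..x} h" if "x \<in> {a..b}" for x
    by (rule set_borel_integral_eq_integral, rule set_integrable_subset[OF h]) (use that in auto)
  moreover have "continuous_on {a..b} (\<lambda>x. integral {a..x} h)"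
    by (intro indefinite_integral_continuous_1 set_borel_integral_eq_integral h)
  ultimately show ?thesis by (subst continuous_on_cong[OF refl]) auto
qed

lemma lebesgue_integral_Icc_combine:
  fixes h :: "real \<Rightarrow> complex"
  assumes h: "set_integrable lborel {a..c} h" and "a \<le> b" "b \<le> c"
  shows "(LINT t:{a..c}|lborel. h t) = (LINT t:{a..b}|lborel. h t) + (LINT t:{b..c}|lborel. h t)"
proof -
  have h12: "set_integrable lborel {a..b} h" "set_integrable lborel {b..c} h"
    using assms by (auto intro: set_integrable_subset[OF h])
  show ?thesis
    using Henstock_Kurzweil_Integration.integral_combine[OF assms(2,3) set_borel_integral_eq_integral(1)[OF h]]
    by (simp add: set_borel_integral_eq_integral(2)[OF h] set_borel_integral_eq_integral(2)[OF h12(1)]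
         set_borel_integral_eq_integral(2)[OF h12(2)])
qed

text \<open>\<open>H\<close> is only an indefinite integral and may fail to be differentiable at
  given points, so there is no product rule. Instead g'(x) h(t) is integrated over the triangle t <=
  x in both orders.\<close>

lemma integral_by_parts_indefinite:
  fixes g g' h H :: "real \<Rightarrow> complex"
  assumes ab: "a \<le> b"
    and g: "\<And>x. x \<in> {a..b} \<Longrightarrow> (g has_vector_derivative g' x) (at x within {a..b})"
    and g': "continuous_on {a..b} g'"
    and h: "set_integrable lborel {a..b} h"
    and H: "\<And>x. x \<in> {a..b} \<Longrightarrow> H x = H a + (LINT t:{a..x}|lborel. h t)"
  shows "set_integrable lborel {a..b} (\<lambda>x. g' x * H x + g x * h x)"
    and "(LINT x:{a..b}|lborel. g' x * H x + g x * h x) = g b * H b - g a * H a"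
proof -
  define G where "G = (\<lambda>x. indicator {a..b} x *\<^sub>R g' x)"
  define k where "k = (\<lambda>t. indicator {a..b} t *\<^sub>R h t)"
  have G: "integrable lborel G" unfolding G_def
    using borel_integrable_atLeastAtMost'[OF g'] by (simp add: set_integrable_def)
  have k: "integrable lborel k" using h by (simp add: set_integrable_def k_def)
  have [measurable]: "G \<in> borel_measurable borel" "k \<in> borel_measurable borel"
    using borel_measurable_integrable[OF G] borel_measurable_integrable[OF k] by simp_all
  have gcont: "continuous_on {a..b} g"
    using g by (meson continuous_on_eq_continuous_within has_vector_derivative_continuous)
  \<comment> \<open>Integrating out t gives g' (H - H a); integrating out x gives (g b - g)
    h.\<close>
  define K where "K = (\<lambda>x t. (if t \<le> x then G x * k t else 0))"
  have Kint: "integrable (lborel \<Otimes>\<^sub>M lborel) (case_prod K)"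
  proof (rule Bochner_Integration.integrable_bound)
    show "integrable (lborel \<Otimes>\<^sub>M lborel) (\<lambda>(x, t). G x * k t)"
      using G k by (intro lborel_pair.Fubini_integrable) (auto simp: norm_mult)
    show "case_prod K \<in> borel_measurable (lborel \<Otimes>\<^sub>M lborel)"
      unfolding K_def by measurable
  qed (auto simp: K_def)
  have 1: "(\<integral>t. K x t \<partial>lborel) = indicator {a..b} x *\<^sub>R (g' x * (H x - H a))" for x
  proof (cases "x \<in> {a..b}")
    case True
    have "(\<integral>t. K x t \<partial>lborel) = (\<integral>t. G x * (indicator {a..x} t *\<^sub>R h t) \<partial>lborel)"
      using True by (intro Bochner_Integration.integral_cong) (auto simp: K_def k_def indicator_def)
    also have "\<dots> = G x * (LINT t:{a..x}|lborel. h t)"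
      unfolding set_lebesgue_integral_def by (rule integral_mult_right_zero)
    finally show ?thesis using True H[of x] by (simp add: G_def)
  next
    case False
    hence "K x = (\<lambda>t. 0)" by (auto simp: K_def G_def)
    thus ?thesis using False by simp
  qed
  have 2: "(\<integral>x. K x t \<partial>lborel) = indicator {a..b} t *\<^sub>R ((g b - g t) * h t)" for t
  proof (cases "t \<in> {a..b}")
    case True
    have "(\<integral>x. K x t \<partial>lborel) = (\<integral>x. (indicator {t..b} x *\<^sub>R g' x) * k t \<partial>lborel)"
      using True by (intro Bochner_Integration.integral_cong) (auto simp: K_def G_def indicator_def)
    also have "\<dots> = (\<integral>x. indicator {t..b} x *\<^sub>R g' x \<partial>lborel) * k t" by (rule integral_mult_left_zero)
    also have "(\<integral>x. indicator {t..b} x *\<^sub>R g' x \<partial>lborel) = g b - g t"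
      using True by (intro integral_FTC_atLeastAtMost continuous_on_subset[OF g'] has_vector_derivative_within_subset[OF g]) auto
    finally show ?thesis using True by (simp add: k_def)
  next
    case False
    hence "(\<lambda>x. K x t) = (\<lambda>x. 0)" by (auto simp: K_def k_def)
    thus ?thesis using False by simp
  qed
  have F: "integrable lborel (\<lambda>x. \<integral>t. K x t \<partial>lborel)" by (rule lborel_pair.integrable_fst[OF Kint])
  have E: "(LINT x:{a..b}|lborel. g' x * (H x - H a)) = (LINT t:{a..b}|lborel. (g b - g t) * h t)"
    using lborel_pair.Fubini_integral[OF Kint] unfolding 1 2 by (simp add: set_lebesgue_integral_def)
  have i1: "set_integrable lborel {a..b} (\<lambda>x. g' x * (H x - H a))"
    using F unfolding 1 by (simp add: set_integrable_def)
  have i2: "set_integrable lborel {a..b} (\<lambda>x. g x * h x)"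
  proof -
    obtain C where C: "\<And>x. x \<in> {a..b} \<Longrightarrow> norm (g x) \<le> C"
      using compact_imp_bounded[OF compact_continuous_image[OF gcont compact_Icc]] unfolding bounded_iff
      by (meson imageI)
    have [measurable]: "(\<lambda>x. indicator {a..b} x *\<^sub>R g x) \<in> borel_measurable borel"
      using borel_integrable_atLeastAtMost'[OF gcont] by (simp add: set_integrable_def borel_measurable_integrable)
    have eq: "(\<lambda>x. indicator {a..b} x *\<^sub>R (g x * h x)) = (\<lambda>x. (indicator {a..b} x *\<^sub>R g x) * k x)"
      by (auto simp: k_def indicator_def)
    show ?thesis unfolding set_integrable_def eq
    proof (rule Bochner_Integration.integrable_bound)
      show "integrable lborel (\<lambda>x. C *\<^sub>R norm (k x))" using k by simp
      show "AE x in lborel. norm ((indicator {a..b} x *\<^sub>R g x) * k x) \<le> norm (C *\<^sub>R norm (k x))"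
      proof (rule AE_I2)
        fix x
        show "norm ((indicator {a..b} x *\<^sub>R g x) * k x) \<le> norm (C *\<^sub>R norm (k x))"
        proof (cases "x \<in> {a..b}")
          case True
          have "norm (g x) * norm (k x) \<le> C * norm (k x)" using C[OF True] by (intro mult_right_mono) auto
          also have "\<dots> \<le> \<bar>C * norm (k x)\<bar>" by (rule abs_ge_self)
          finally show ?thesis using True by (simp add: norm_mult)
        qed (simp add: k_def)
      qed
      show "(\<lambda>x. (indicator {a..b} x *\<^sub>R g x) * k x) \<in> borel_measurable lborel" by measurable
    qed
  qed
  have i3: "set_integrable lborel {a..b} (\<lambda>x. g' x * H a)"
    by (intro borel_integrable_atLeastAtMost' continuous_intros g')
  have i4: "set_integrable lborel {a..b} (\<lambda>x. g b * h x)"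
    using h by (intro set_integrable_mult_right) auto
  have eq: "(\<lambda>x. g' x * H x + g x * h x) = (\<lambda>x. g' x * (H x - H a) + g' x * H a + g x * h x)"
    by (auto simp: algebra_simps)
  show "set_integrable lborel {a..b} (\<lambda>x. g' x * H x + g x * h x)"
    unfolding eq using i1 i2 i3 by (intro set_integral_add)
  have "(LINT x:{a..b}|lborel. g' x * H x + g x * h x) =
      (LINT x:{a..b}|lborel. g' x * (H x - H a)) + (LINT x:{a..b}|lborel. g' x * H a) + (LINT x:{a..b}|lborel. g x * h x)"
    unfolding eq using i1 i2 i3 by (simp add: set_integral_add)
  also have "(LINT x:{a..b}|lborel. g' x * (H x - H a)) = (LINT x:{a..b}|lborel. g b * h x) - (LINT x:{a..b}|lborel. g x * h x)"
    unfolding E left_diff_distrib using i4 i2 by (simp add: set_integral_diff)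
  also have "(LINT x:{a..b}|lborel. g b * h x) = g b * (H b - H a)"
    using H[of b] ab by simp
  also have "(LINT x:{a..b}|lborel. g' x * H a) = (g b - g a) * H a"
    using integral_FTC_atLeastAtMost[OF ab g g'] by (simp add: set_lebesgue_integral_def)
  finally show "(LINT x:{a..b}|lborel. g' x * H x + g x * h x) = g b * H b - g a * H a"
    by (simp add: algebra_simps)
qed

text \<open>Schur test: half of the exponential goes with \<open>w\<close>, half with
  \<open>n\<close>. Cauchy-Schwarz and \<open>M\<close> bound the square of the inner integral, and
  after exchanging the integrals the symmetry of the kernel allows \<open>M\<close> to be used a
  second time.\<close>

lemma exponential_kernel_L2_bound:
  fixes w n :: "real \<Rightarrow> real"
  assumes \<eta>: "\<eta> > 0"
    and [measurable]: "w \<in> borel_measurable borel" "n \<in> borel_measurable borel"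
    and w0: "\<And>t. w t \<ge> 0" and n0: "\<And>t. n t \<ge> 0"
    and M: "\<And>r. (\<integral>\<^sup>+t. ennreal ((w t)\<^sup>2 * exp (- \<eta> * \<bar>r - t\<bar>)) \<partial>lborel) \<le> ennreal M"
    and n2: "(\<integral>\<^sup>+t. ennreal ((n t)\<^sup>2) \<partial>lborel) < \<infinity>"
  shows "(\<integral>\<^sup>+t. ennreal (exp (- \<eta> * \<bar>r - t\<bar>) * w t * n t) \<partial>lborel) < \<infinity>"
    and "(\<integral>\<^sup>+r. (ennreal (w r) * (\<integral>\<^sup>+t. ennreal (exp (- \<eta> * \<bar>r - t\<bar>) * w t * n t) \<partial>lborel))\<^sup>2 \<partial>lborel) < \<infinity>"
proof -
  let ?e = "\<lambda>r t. exp (- \<eta> * \<bar>r - t\<bar>)"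
  let ?J = "\<lambda>r. \<integral>\<^sup>+t. ennreal (?e r t * w t * n t) \<partial>lborel"
  let ?N = "\<lambda>r. \<integral>\<^sup>+t. ennreal (?e r t * (n t)\<^sup>2) \<partial>lborel"
  have J: "(?J r)\<^sup>2 \<le> ennreal M * ?N r" for r
  proof -
    let ?h = "\<lambda>t. exp (- \<eta> / 2 * \<bar>r - t\<bar>)"
    have h2: "?e r t = ?h t * ?h t" for t by (simp flip: exp_add)
    have e: "?e r t * w t * n t = (?h t * w t) * (?h t * n t)" "(w t)\<^sup>2 * ?e r t = (?h t * w t)\<^sup>2"
      "?e r t * (n t)\<^sup>2 = (?h t * n t)\<^sup>2" for t
      unfolding h2 by (simp_all only: power2_eq_square mult_ac)
    have "?J r = (\<integral>\<^sup>+t. ennreal (?h t * w t) * ennreal (?h t * n t) \<partial>lborel)"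
      unfolding e using w0 n0 by (intro nn_integral_cong ennreal_mult) auto
    hence "(?J r)\<^sup>2 \<le> (\<integral>\<^sup>+t. (ennreal (?h t * w t))\<^sup>2 \<partial>lborel) * (\<integral>\<^sup>+t. (ennreal (?h t * n t))\<^sup>2 \<partial>lborel)"
      by (simp only:) (rule Cauchy_Schwarz_nn_integral, measurable)
    also have "(\<integral>\<^sup>+t. (ennreal (?h t * w t))\<^sup>2 \<partial>lborel) = (\<integral>\<^sup>+t. ennreal ((w t)\<^sup>2 * ?e r t) \<partial>lborel)"
      unfolding e using w0 by (intro nn_integral_cong ennreal_power) auto
    also have "(\<integral>\<^sup>+t. (ennreal (?h t * n t))\<^sup>2 \<partial>lborel) = ?N r"
      unfolding e using n0 by (intro nn_integral_cong ennreal_power) auto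
    also have "(\<integral>\<^sup>+t. ennreal ((w t)\<^sup>2 * ?e r t) \<partial>lborel) * ?N r \<le> ennreal M * ?N r"
      by (intro mult_right_mono M) simp
    finally show ?thesis .
  qed
  have "?N r \<le> (\<integral>\<^sup>+t. ennreal ((n t)\<^sup>2) \<partial>lborel)" for r
    using \<eta> by (intro nn_integral_mono ennreal_leI) (simp add: mult_left_le_one_le)
  hence "?N r < \<infinity>" for r using n2 le_less_trans by blast
  hence "(?J r)\<^sup>2 < \<infinity>"
    by (intro le_less_trans[OF J]) (simp add: ennreal_mult_less_top)
  thus "?J r < \<infinity>" by (simp add: power_less_top_ennreal)
  have "(\<integral>\<^sup>+r. (ennreal (w r) * ?J r)\<^sup>2 \<partial>lborel) \<le> (\<integral>\<^sup>+r. ennreal M * (ennreal ((w r)\<^sup>2) * ?N r) \<partial>lborel)"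
  proof (intro nn_integral_mono)
    fix r
    have "(ennreal (w r) * ?J r)\<^sup>2 = ennreal ((w r)\<^sup>2) * (?J r)\<^sup>2"
      using w0 by (simp add: power_mult_distrib ennreal_power)
    also have "\<dots> \<le> ennreal ((w r)\<^sup>2) * (ennreal M * ?N r)" using J by (intro mult_left_mono) auto
    finally show "(ennreal (w r) * ?J r)\<^sup>2 \<le> ennreal M * (ennreal ((w r)\<^sup>2) * ?N r)" by (simp add: mult_ac)
  qed
  also have "\<dots> = ennreal M * (\<integral>\<^sup>+r. (\<integral>\<^sup>+t. ennreal ((w r)\<^sup>2) * ennreal (?e r t * (n t)\<^sup>2) \<partial>lborel) \<partial>lborel)"
    by (subst nn_integral_cmult) (auto simp: nn_integral_cmult)
  also have "(\<integral>\<^sup>+r. (\<integral>\<^sup>+t. ennreal ((w r)\<^sup>2) * ennreal (?e r t * (n t)\<^sup>2) \<partial>lborel) \<partial>lborel)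
     = (\<integral>\<^sup>+t. (\<integral>\<^sup>+r. ennreal ((w r)\<^sup>2) * ennreal (?e r t * (n t)\<^sup>2) \<partial>lborel) \<partial>lborel)"
    by (rule lborel_pair.Fubini'[symmetric]) measurable
  also have "\<dots> = (\<integral>\<^sup>+t. ennreal ((n t)\<^sup>2) * (\<integral>\<^sup>+r. ennreal ((w r)\<^sup>2 * exp (- \<eta> * \<bar>t - r\<bar>)) \<partial>lborel) \<partial>lborel)"
    by (intro nn_integral_cong, subst nn_integral_cmult[symmetric], measurable, intro nn_integral_cong)
       (simp add: abs_minus_commute mult.commute mult.left_commute ennreal_mult)
  also have "\<dots> \<le> (\<integral>\<^sup>+t. ennreal ((n t)\<^sup>2) * ennreal M \<partial>lborel)"
    using M by (intro nn_integral_mono mult_left_mono) auto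
  also have "\<dots> = (\<integral>\<^sup>+t. ennreal ((n t)\<^sup>2) \<partial>lborel) * ennreal M" by (subst nn_integral_multc) auto
  finally have "(\<integral>\<^sup>+r. (ennreal (w r) * ?J r)\<^sup>2 \<partial>lborel) \<le> ennreal M * ((\<integral>\<^sup>+t. ennreal ((n t)\<^sup>2) \<partial>lborel) * ennreal M)"
    by (simp add: mult_left_mono)
  also have "\<dots> < \<infinity>" using n2 by (simp add: ennreal_mult_less_top)
  finally show "(\<integral>\<^sup>+r. (ennreal (w r) * ?J r)\<^sup>2 \<partial>lborel) < \<infinity>" .
qed

section \<open>The Green function of a pair of solutions\<close>

text \<open>Collects what the construction needs to know about the two solutions of y'' = q y, with
  no Bessel functions left. The weight \<open>w\<close> absorbs the singularity at 0, and
  \<open>w_bound\<close> is precisely the hypothesis of the Schur test.\<close>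

locale green_pair =
  fixes \<phi> \<phi>' \<xi> \<xi>' q :: "real \<Rightarrow> complex" and w :: "real \<Rightarrow> real" and \<eta> M :: real
  assumes \<eta>: "\<eta> > 0"
    and w_measurable [measurable]: "w \<in> borel_measurable borel"
    and w_nonneg: "w t \<ge> 0"
    and w_bound: "(\<integral>\<^sup>+t. ennreal ((w t)\<^sup>2 * exp (- \<eta> * \<bar>r - t\<bar>)) \<partial>lborel) \<le> ennreal M"
    and \<phi>_deriv: "r > 0 \<Longrightarrow> (\<phi> has_vector_derivative \<phi>' r) (at r)"
    and \<phi>'_deriv: "r > 0 \<Longrightarrow> (\<phi>' has_vector_derivative q r * \<phi> r) (at r)"
    and \<xi>_deriv: "r > 0 \<Longrightarrow> (\<xi> has_vector_derivative \<xi>' r) (at r)"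
    and \<xi>'_deriv: "r > 0 \<Longrightarrow> (\<xi>' has_vector_derivative q r * \<xi> r) (at r)"
    and q_cont: "continuous_on {0<..} q"
    and wronskian: "r > 0 \<Longrightarrow> \<phi> r * \<xi>' r - \<phi>' r * \<xi> r = -1"
    and \<phi>_bound: "r > 0 \<Longrightarrow> norm (\<phi> r) \<le> w r * exp (\<eta> * r)"
    and \<xi>_bound: "r > 0 \<Longrightarrow> norm (\<xi> r) \<le> w r * exp (- \<eta> * r)"
begin

definition green :: "real \<Rightarrow> real \<Rightarrow> complex" where
  "green r t = \<phi> (min r t) * \<xi> (max r t)"

lemma continuous_on_deriv:
  assumes "\<And>r. r > 0 \<Longrightarrow> (f has_vector_derivative f' r) (at r)"
  shows "continuous_on {0<..} (f :: real \<Rightarrow> complex)"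
  using assms by (intro continuous_at_imp_continuous_on) (auto intro: has_vector_derivative_continuous)

lemma cont_fns: "continuous_on {0<..} \<phi>" "continuous_on {0<..} \<phi>'"
    "continuous_on {0<..} \<xi>" "continuous_on {0<..} \<xi>'"
  by (rule continuous_on_deriv, erule \<phi>_deriv \<phi>'_deriv \<xi>_deriv \<xi>'_deriv)+

lemma green_bound:
  assumes "r > 0" "t > 0"
  shows "norm (green r t) \<le> w r * (exp (- \<eta> * \<bar>r - t\<bar>) * w t)"
proof -
  have "norm (green r t) \<le> (w (min r t) * exp (\<eta> * min r t)) * (w (max r t) * exp (- \<eta> * max r t))"
    unfolding green_def norm_mult using assms by (intro mult_mono \<phi>_bound \<xi>_bound) (auto simp: w_nonneg)
  also have "\<dots> = w r * (exp (- \<eta> * \<bar>r - t\<bar>) * w t)"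
    by (cases "r \<le> t") (auto simp: min_def max_def algebra_simps simp flip: exp_add)
  finally show ?thesis .
qed

context
  fixes f :: "real \<Rightarrow> complex"
  assumes f: "L2pos f"
begin

text \<open>Extension by zero: \<open>L2pos\<close> says nothing about f on the left half-line,
  while the kernel estimates integrate over the whole line. Not related to
  \<open>F_fun\<close>.\<close>

definition F where "F t = indicator {0<..} t *\<^sub>R f t"

lemma F_measurable [measurable]: "F \<in> borel_measurable borel"
  using f unfolding L2pos_def set_borel_measurable_def F_def[abs_def] by simp

lemma F_L2: "(\<integral>\<^sup>+t. ennreal ((norm (F t))\<^sup>2) \<partial>lborel) < \<infinity>"
proof -
  have "integrable lborel (\<lambda>t. indicator {0<..} t *\<^sub>R (norm (f t))\<^sup>2)"
    using f unfolding L2pos_def set_integrable_def by simp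
  also have "(\<lambda>t. indicator {0<..} t *\<^sub>R (norm (f t))\<^sup>2) = (\<lambda>t. (norm (F t))\<^sup>2)"
    by (auto simp: F_def indicator_def)
  finally show ?thesis unfolding integrable_iff_bounded by simp
qed

definition J where "J r = (\<integral>\<^sup>+t. ennreal (exp (- \<eta> * \<bar>r - t\<bar>) * w t * norm (F t)) \<partial>lborel)"

lemma J_finite: "J r < \<infinity>" and J_L2: "(\<integral>\<^sup>+r. (ennreal (w r) * J r)\<^sup>2 \<partial>lborel) < \<infinity>"
proof -
  note S = exponential_kernel_L2_bound[OF \<eta> w_measurable _ w_nonneg norm_ge_zero w_bound F_L2]
  show "J r < \<infinity>" unfolding J_def by (rule S(1)) measurable
  show "(\<integral>\<^sup>+r. (ennreal (w r) * J r)\<^sup>2 \<partial>lborel) < \<infinity>" unfolding J_def by (rule S(2)) measurable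
qed

lemma J_integrable: "integrable lborel (\<lambda>t. exp (- \<eta> * \<bar>r - t\<bar>) * w t * norm (F t))"
  using J_finite[of r] unfolding J_def
  by (intro integrableI_nonneg) (auto simp: w_nonneg)

lemma measurable_mult_F:
  assumes "continuous_on {0<..} (g :: real \<Rightarrow> complex)"
  shows "(\<lambda>t. g t * F t) \<in> borel_measurable borel"
proof -
  have [measurable]: "(\<lambda>t. indicator {0<..} t *\<^sub>R g t) \<in> borel_measurable borel"
    using borel_measurable_continuous_on_indicator[OF _ assms] by simp
  have "(\<lambda>t. g t * F t) = (\<lambda>t. (indicator {0<..} t *\<^sub>R g t) * F t)"
    by (auto simp: F_def indicator_def)
  also have "\<dots> \<in> borel_measurable borel" by measurable
  finally show ?thesis .
qed

lemma \<xi>_integrable: "integrable lborel (\<lambda>t. \<xi> t * F t)"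
\<comment> \<open>On t > 0 the exponential kernel centred at 0 is exp(-eta t), exactly the rate in
  \<open>\<xi>_bound\<close>.\<close>
proof (rule Bochner_Integration.integrable_bound[OF J_integrable[of 0]])
  show "(\<lambda>t. \<xi> t * F t) \<in> borel_measurable lborel" by (simp add: measurable_mult_F cont_fns)
  show "AE t in lborel. norm (\<xi> t * F t) \<le> norm (exp (- \<eta> * \<bar>0 - t\<bar>) * w t * norm (F t))"
  proof (rule AE_I2)
    fix t :: real
    show "norm (\<xi> t * F t) \<le> norm (exp (- \<eta> * \<bar>0 - t\<bar>) * w t * norm (F t))"
      using mult_right_mono[OF \<xi>_bound[of t] norm_ge_zero[of "F t"]]
      by (cases "t > 0") (auto simp: norm_mult w_nonneg F_def mult_ac)
  qed
qed

lemma \<phi>_integrable: "set_integrable lborel {0..b} (\<lambda>t. \<phi> t * F t)"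
  unfolding set_integrable_def
\<comment> \<open>For t <= b the growth exp(eta t) equals exp(eta b) times the kernel centred at
  b.\<close>
proof (rule Bochner_Integration.integrable_bound[OF integrable_mult_right[OF J_integrable[of b], of "exp (\<eta> * b)"]])
  show "(\<lambda>t. indicator {0..b} t *\<^sub>R (\<phi> t * F t)) \<in> borel_measurable lborel"
    by (simp add: measurable_mult_F cont_fns borel_measurable_scaleR)
  show "AE t in lborel. norm (indicator {0..b} t *\<^sub>R (\<phi> t * F t))
      \<le> norm (exp (\<eta> * b) * (exp (- \<eta> * \<bar>b - t\<bar>) * w t * norm (F t)))"
  proof (rule AE_I2)
    fix t :: real
    show "norm (indicator {0..b} t *\<^sub>R (\<phi> t * F t)) \<le> norm (exp (\<eta> * b) * (exp (- \<eta> * \<bar>b - t\<bar>) * w t * norm (F t)))"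
    proof (cases "t > 0 \<and> t \<le> b")
      case True
      have "exp (\<eta> * t) = exp (\<eta> * b) * exp (- \<eta> * \<bar>b - t\<bar>)"
        using True by (simp add: algebra_simps flip: exp_add)
      thus ?thesis using True mult_right_mono[OF \<phi>_bound[of t] norm_ge_zero[of "F t"]]
        by (simp add: norm_mult w_nonneg mult_ac)
    next
      case False
      thus ?thesis by (cases "t \<le> 0") (auto simp: F_def indicator_def)
    qed
  qed
qed

lemma \<xi>_set_integrable: "set_integrable lborel {0..b} (\<lambda>t. \<xi> t * F t)"
  using integrable_mult_indicator[OF _ \<xi>_integrable, of "{0..b}"] by (simp add: set_integrable_def)

definition gA where "gA r = (LINT t:{0..r}|lborel. \<phi> t * F t)"
text \<open>The integral from r to infinity, written as total minus head so that, like
  \<open>gA\<close>, it is an indefinite integral starting at 0 up to a constant.\<close>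

definition gB where "gB r = (LINT t|lborel. \<xi> t * F t) - (LINT t:{0..r}|lborel. \<xi> t * F t)"

lemma green_decomp:
  assumes "r > 0"
  shows "indicator {0<..} t *\<^sub>R (green r t * f t) =
    \<xi> r * (indicator {0..r} t *\<^sub>R (\<phi> t * F t)) + \<phi> r * (\<xi> t * F t - indicator {0..r} t *\<^sub>R (\<xi> t * F t))"
  using assms by (auto simp: green_def F_def indicator_def min_def max_def)

lemma green_integrable:
  assumes "r > 0"
  shows "set_integrable lborel {0<..} (\<lambda>t. green r t * f t)"
  unfolding set_integrable_def green_decomp[OF assms]
  using \<phi>_integrable[of r] \<xi>_set_integrable[of r] \<xi>_integrable unfolding set_integrable_def
  by (intro Bochner_Integration.integrable_add integrable_mult_right Bochner_Integration.integrable_diff)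

lemma green_integral:
  assumes "r > 0"
  shows "(LINT t:{0<..}|lborel. green r t * f t) = \<xi> r * gA r + \<phi> r * gB r"
proof -
  note i = \<phi>_integrable[of r, unfolded set_integrable_def] \<xi>_set_integrable[of r, unfolded set_integrable_def] \<xi>_integrable
  show ?thesis
    unfolding set_lebesgue_integral_def green_decomp[OF assms] gA_def gB_def
    by (subst Bochner_Integration.integral_add, (intro integrable_mult_right Bochner_Integration.integrable_diff i)+,
        subst (1 2) integral_mult_right_zero, subst Bochner_Integration.integral_diff) (rule i refl)+
qed

lemma norm_green_integral_le:
  assumes "r > 0"
  shows "ennreal (norm (\<xi> r * gA r + \<phi> r * gB r)) \<le> ennreal (w r) * J r"
proof -
  have "ennreal (norm (LINT t:{0<..}|lborel. green r t * f t))
      \<le> (\<integral>\<^sup>+t. ennreal (norm (indicator {0<..} t *\<^sub>R (green r t * f t))) \<partial>lborel)"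
    unfolding set_lebesgue_integral_def
    by (rule integral_norm_bound_ennreal) (use green_integrable[OF assms] in \<open>simp add: set_integrable_def\<close>)
  also have "\<dots> \<le> (\<integral>\<^sup>+t. ennreal (w r) * ennreal (exp (- \<eta> * \<bar>r - t\<bar>) * w t * norm (F t)) \<partial>lborel)"
  proof (intro nn_integral_mono)
    fix t
    have "norm (indicator {0<..} t *\<^sub>R (green r t * f t)) \<le> w r * (exp (- \<eta> * \<bar>r - t\<bar>) * w t * norm (F t))"
      using mult_right_mono[OF green_bound[OF assms, of t] norm_ge_zero[of "f t"]]
      by (cases "t > 0") (auto simp: norm_mult F_def mult_ac)
    thus "ennreal (norm (indicator {0<..} t *\<^sub>R (green r t * f t)))
        \<le> ennreal (w r) * ennreal (exp (- \<eta> * \<bar>r - t\<bar>) * w t * norm (F t))"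
      by (subst ennreal_mult[symmetric]) (auto simp: w_nonneg intro!: ennreal_leI)
  qed
  also have "\<dots> = ennreal (w r) * J r" unfolding J_def by (rule nn_integral_cmult) measurable
  finally show ?thesis using green_integral[OF assms] by simp
qed

lemma gA_diff:
  assumes "0 \<le> a" "a \<le> x"
  shows "gA x = gA a + (LINT t:{a..x}|lborel. \<phi> t * F t)"
  unfolding gA_def by (rule lebesgue_integral_Icc_combine[OF \<phi>_integrable assms])

lemma gB_diff:
  assumes "0 \<le> a" "a \<le> x"
  shows "gB x = gB a + (LINT t:{a..x}|lborel. - (\<xi> t * F t))"
  using lebesgue_integral_Icc_combine[OF \<xi>_set_integrable assms] unfolding gB_def
  by (simp add: set_lebesgue_integral_def)

lemma continuous_gA: "continuous_on {0..b} gA" and continuous_gB: "continuous_on {0..b} gB"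
  unfolding gA_def gB_def
  by (intro continuous_intros continuous_on_indefinite_lebesgue_integral \<phi>_integrable \<xi>_set_integrable)+

text \<open>For the boundary condition: near 0 the coefficient of xi dies out while that of phi
  stays finite, so u inherits the boundary behaviour of phi.\<close>

lemma gA_at_0: "(gA \<longlongrightarrow> 0) (at_right 0)" and gB_at_0: "(gB \<longlongrightarrow> gB 0) (at_right 0)"
proof -
  have at0: "at (0::real) within {0..1} = at_right 0" by (rule at_within_Icc_at_right) simp
  have "gA 0 = 0"
    unfolding gA_def set_lebesgue_integral_def
    by (subst Bochner_Integration.integral_cong[OF refl, of _ _ "\<lambda>_. 0"]) (auto simp: F_def indicator_def)
  moreover have "continuous (at 0 within {0..1}) gA" "continuous (at 0 within {0..1}) gB"
    using continuous_gA[of 1] continuous_gB[of 1] by (auto simp: continuous_on_eq_continuous_within)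
  ultimately show "(gA \<longlongrightarrow> 0) (at_right 0)" "(gB \<longlongrightarrow> gB 0) (at_right 0)"
    unfolding continuous_within at0 by simp_all
qed

definition gu where "gu r = \<xi> r * gA r + \<phi> r * gB r"
text \<open>The contributions of the derivatives of \<open>gA\<close> and \<open>gB\<close>, namely
  xi phi F and -phi xi F, cancel; hence none appears.\<close>

definition gu' where "gu' r = \<xi>' r * gA r + \<phi>' r * gB r"

text \<open>Used twice. With g = xi, k = phi the term in \<open>F\<close> vanishes, giving the first
  derivative; with g = xi', k = phi' its coefficient is the Wronskian -1, giving the second.\<close>

lemma green_parts:
  assumes ab: "0 < a" "a \<le> b"
    and g: "\<And>r. r > 0 \<Longrightarrow> (g has_vector_derivative g' r) (at r)" and g': "continuous_on {0<..} g'"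
    and k: "\<And>r. r > 0 \<Longrightarrow> (k has_vector_derivative k' r) (at r)" and k': "continuous_on {0<..} k'"
  shows "set_integrable lborel {a..b} (\<lambda>x. (g' x * gA x + k' x * gB x) + (g x * \<phi> x - k x * \<xi> x) * F x)" (is ?I)
    and "(LINT x:{a..b}|lborel. (g' x * gA x + k' x * gB x) + (g x * \<phi> x - k x * \<xi> x) * F x)
       = (g b * gA b + k b * gB b) - (g a * gA a + k a * gB a)" (is ?E)
proof -
  have sub: "{a..b} \<subseteq> {0<..}" using ab by auto
  have i: "set_integrable lborel {a..b} (\<lambda>t. \<phi> t * F t)" "set_integrable lborel {a..b} (\<lambda>t. - (\<xi> t * F t))"
    using set_integrable_subset[OF \<phi>_integrable[of b], of "{a..b}"] set_integrable_subset[OF \<xi>_set_integrable[of b], of "{a..b}"] ab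
    by (auto simp: set_integrable_def)
  have within: "\<And>x. x \<in> {a..b} \<Longrightarrow> (g has_vector_derivative g' x) (at x within {a..b})"
    "\<And>x. x \<in> {a..b} \<Longrightarrow> (k has_vector_derivative k' x) (at x within {a..b})"
    by (rule has_vector_derivative_at_within, rule g, use ab in simp)
       (rule has_vector_derivative_at_within, rule k, use ab in simp)
  have A: "\<And>x. x \<in> {a..b} \<Longrightarrow> gA x = gA a + (LINT t:{a..x}|lborel. \<phi> t * F t)"
    using ab by (intro gA_diff) auto
  have B: "\<And>x. x \<in> {a..b} \<Longrightarrow> gB x = gB a + (LINT t:{a..x}|lborel. - (\<xi> t * F t))"
    using ab by (intro gB_diff) auto
  have 1: "set_integrable lborel {a..b} (\<lambda>x. g' x * gA x + g x * (\<phi> x * F x))"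
    "(LINT x:{a..b}|lborel. g' x * gA x + g x * (\<phi> x * F x)) = g b * gA b - g a * gA a"
    by (rule integral_by_parts_indefinite[OF ab(2) _ continuous_on_subset[OF g' sub] i(1)], erule within(1), erule A)+
  have 2: "set_integrable lborel {a..b} (\<lambda>x. k' x * gB x + k x * (- (\<xi> x * F x)))"
    "(LINT x:{a..b}|lborel. k' x * gB x + k x * (- (\<xi> x * F x))) = k b * gB b - k a * gB a"
    by (rule integral_by_parts_indefinite[OF ab(2) _ continuous_on_subset[OF k' sub] i(2)], erule within(2), erule B)+
  have eq: "(\<lambda>x. (g' x * gA x + k' x * gB x) + (g x * \<phi> x - k x * \<xi> x) * F x)
     = (\<lambda>x. (g' x * gA x + g x * (\<phi> x * F x)) + (k' x * gB x + k x * (- (\<xi> x * F x))))"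
    by (auto simp: algebra_simps)
  show ?I unfolding eq by (rule set_integral_add(1)[OF 1(1) 2(1)])
  show ?E unfolding eq by (subst set_integral_add(2)[OF 1(1) 2(1)]) (simp only: 1(2) 2(2), simp)
qed

lemma continuous_gu': "continuous_on {a..b} gu'" if "a > 0"
  unfolding gu'_def
  by (intro continuous_intros continuous_on_subset[OF continuous_gA[of b]] continuous_on_subset[OF continuous_gB[of b]]
       continuous_on_subset[OF cont_fns(2)] continuous_on_subset[OF cont_fns(4)]) (use that in auto)

text \<open>\<open>gu\<close> is an indefinite integral of the continuous function
  \<open>gu'\<close>, so it is differentiable at every point although \<open>gA\<close> and
  \<open>gB\<close> need not be.\<close>

lemma gu_deriv:
  assumes r: "r > 0"
  shows "(gu has_vector_derivative gu' r) (at r)"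
proof -
  define a b where "a = r / 2" and "b = 2 * r"
  have ab: "0 < a" "a < r" "r < b" using r by (auto simp: a_def b_def)
  have "\<And>x. x \<in> {a..b} \<Longrightarrow> gu x = gu a + integral {a..x} gu'"
  proof -
    fix x assume x: "x \<in> {a..b}"
    have "(\<lambda>x. (\<xi>' x * gA x + \<phi>' x * gB x) + (\<xi> x * \<phi> x - \<phi> x * \<xi> x) * F x) = gu'"
      by (auto simp: gu'_def)
    moreover have "a \<le> x" using x by auto
    ultimately have "(LINT x:{a..x}|lborel. gu' x) = gu x - gu a" "set_integrable lborel {a..x} gu'"
      using green_parts[OF ab(1), of x \<xi> \<xi>' \<phi> \<phi>'] \<phi>_deriv \<xi>_deriv cont_fns by (simp_all add: gu_def)
    thus "gu x = gu a + integral {a..x} gu'" by (simp add: set_borel_integral_eq_integral)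
  qed
  moreover have "((\<lambda>x. gu a + integral {a..x} gu') has_vector_derivative gu' r) (at r within {a..b})"
    by (rule has_vector_derivative_eq_rhs, rule has_vector_derivative_add[OF has_vector_derivative_const
         integral_has_vector_derivative[OF continuous_gu']]) (use ab in auto)
  moreover have "r \<in> {a..b}" using ab by simp
  ultimately have "(gu has_vector_derivative gu' r) (at r within {a..b})"
    by (intro has_vector_derivative_transform[of r "{a..b}" gu "\<lambda>x. gu a + integral {a..x} gu'"])
  thus ?thesis by (simp only: at_within_Icc_at[OF ab(2,3)])
qed

text \<open>The equation xi'' = q xi, and the same for phi, produces q u; the Wronskian -1 produces
  the source term -f.\<close>

lemma gu''_integral:
  assumes ab: "0 < a" "a \<le> b"
  shows "set_integrable lborel {a..b} (\<lambda>x. q x * gu x - f x)"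
    and "gu' b - gu' a = (LINT x:{a..b}|lborel. q x * gu x - f x)"
proof -
  have eq: "(q x * \<xi> x * gA x + q x * \<phi> x * gB x) + (\<xi>' x * \<phi> x - \<phi>' x * \<xi> x) * F x = q x * gu x - f x"
    if "x \<in> {a..b}" for x
  proof -
    have "\<xi>' x * \<phi> x - \<phi>' x * \<xi> x = -1" using wronskian[of x] that ab by (simp add: mult.commute)
    moreover have "F x = f x" using that ab by (simp add: F_def)
    ultimately show ?thesis by (simp only:) (simp add: gu_def algebra_simps)
  qed
  note P = green_parts[OF ab \<xi>'_deriv _ \<phi>'_deriv]
  have c: "continuous_on {0<..} (\<lambda>x. q x * \<xi> x)" "continuous_on {0<..} (\<lambda>x. q x * \<phi> x)"
    using continuous_on_mult[OF q_cont cont_fns(3)] continuous_on_mult[OF q_cont cont_fns(1)] by auto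
  show "set_integrable lborel {a..b} (\<lambda>x. q x * gu x - f x)"
    using P(1)[OF _ c(1) _ c(2)] by (subst set_integrable_cong[OF refl refl eq[symmetric]]) auto
  have "(LINT x:{a..b}|lborel. q x * gu x - f x) =
      (LINT x:{a..b}|lborel. (q x * \<xi> x * gA x + q x * \<phi> x * gB x) + (\<xi>' x * \<phi> x - \<phi>' x * \<xi> x) * F x)"
    by (rule set_lebesgue_integral_cong) (simp, intro allI impI eq[symmetric])
  also have "\<dots> = gu' b - gu' a"
    using P(2)[OF _ c(1) _ c(2)] by (simp add: gu'_def)
  finally show "gu' b - gu' a = (LINT x:{a..b}|lborel. q x * gu x - f x)" by simp
qed

lemma gu_L2: "L2pos gu"
proof -
  have cont: "continuous_on {0<..} gu" by (rule continuous_on_deriv[OF gu_deriv])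
  have m: "(\<lambda>r. indicator {0<..} r *\<^sub>R gu r) \<in> borel_measurable borel"
    using borel_measurable_continuous_on_indicator[OF _ cont] by simp
  have eq: "(\<lambda>r. indicator {0<..} r *\<^sub>R (norm (gu r))\<^sup>2) = (\<lambda>r. (norm (indicator {0<..} r *\<^sub>R gu r))\<^sup>2)"
    by (auto simp: indicator_def)
  have "integrable lborel (\<lambda>r. (norm (indicator {0<..} r *\<^sub>R gu r))\<^sup>2)"
  proof (rule integrableI_nonneg)
    show "(\<lambda>r. (norm (indicator {0<..} r *\<^sub>R gu r))\<^sup>2) \<in> borel_measurable lborel"
      by (intro borel_measurable_power borel_measurable_norm[THEN measurable_compose[rotated]]) (use m in simp)
    have "(\<integral>\<^sup>+r. ennreal ((norm (indicator {0<..} r *\<^sub>R gu r))\<^sup>2) \<partial>lborel) \<le> (\<integral>\<^sup>+r. (ennreal (w r) * J r)\<^sup>2 \<partial>lborel)"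
    proof (intro nn_integral_mono)
      fix r :: real
      show "ennreal ((norm (indicator {0<..} r *\<^sub>R gu r))\<^sup>2) \<le> (ennreal (w r) * J r)\<^sup>2"
        using power_mono[OF norm_green_integral_le[of r], of 2]
        by (cases "r > 0") (auto simp: gu_def ennreal_power)
    qed
    thus "(\<integral>\<^sup>+r. ennreal ((norm (indicator {0<..} r *\<^sub>R gu r))\<^sup>2) \<partial>lborel) < \<infinity>"
      using J_L2 by (rule le_less_trans)
  qed auto
  thus ?thesis unfolding L2pos_def set_borel_measurable_def set_integrable_def eq using m by simp
qed

end

end

section \<open>Bessel solutions of the radial equation\<close>

text \<open>Up to a power of k/2 this is sqrt r times J of order nu at k r when q = -k^2/4, and
  times I when q = k^2/4. Only a real power of r > 0 occurs, so no branch of k enters.\<close>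

definition bessel_sol :: "complex \<Rightarrow> real \<Rightarrow> real \<Rightarrow> complex" where
  "bessel_sol q \<nu> r = of_real (r powr (1/2 + \<nu>)) * bessel_entire \<nu> (q * of_real (r\<^sup>2))"

definition bessel_sol' :: "complex \<Rightarrow> real \<Rightarrow> real \<Rightarrow> complex" where
  "bessel_sol' q \<nu> r = of_real ((1/2 + \<nu>) / r) * bessel_sol q \<nu> r + 2 * q * bessel_sol q (\<nu> + 1) r"

lemma powr_half_Suc: "r > 0 \<Longrightarrow> r powr (1/2 + (\<nu> + 1)) = r powr (1/2 + \<nu>) * (r::real)"
  using powr_add[of r "1/2 + \<nu>" 1] by (simp add: add.assoc)

lemma powr_half_minus_1: "r > 0 \<Longrightarrow> r powr (1/2 + \<nu> - 1) = r powr (1/2 + \<nu>) / (r::real)"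
  using powr_diff[of r "1/2 + \<nu>" 1] by simp

lemma bessel_sol_Suc:
  "r > 0 \<Longrightarrow> bessel_sol q (\<nu> + 1) r = of_real (r powr (1/2 + \<nu>)) * of_real r * bessel_entire (\<nu> + 1) (q * of_real (r\<^sup>2))"
  by (simp only: bessel_sol_def powr_half_Suc of_real_mult)

lemma bessel_sol_deriv:
  assumes r: "r > 0"
  shows "(bessel_sol q \<nu> has_vector_derivative bessel_sol' q \<nu> r) (at r)"
proof -
  have 1: "((\<lambda>r. complex_of_real (r powr (1/2 + \<nu>))) has_vector_derivative of_real ((1/2 + \<nu>) / r * r powr (1/2 + \<nu>))) (at r)"
    using has_vector_derivative_of_real[where ?'a = complex, OF has_real_derivative_powr[OF r, of "1/2 + \<nu>"]]
    unfolding powr_half_minus_1[OF r] by simp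
  have "((\<lambda>r. q * complex_of_real (r\<^sup>2)) has_vector_derivative q * of_real (2 * r)) (at r)"
    by (intro has_vector_derivative_mult_right has_vector_derivative_of_real) (auto intro!: derivative_eq_intros)
  from field_vector_diff_chain_at[OF this, of "bessel_entire \<nu>" "bessel_entire (\<nu> + 1) (q * of_real (r\<^sup>2))"]
  have 2: "((\<lambda>r. bessel_entire \<nu> (q * of_real (r\<^sup>2))) has_vector_derivative
      (q * of_real (2 * r)) * bessel_entire (\<nu> + 1) (q * of_real (r\<^sup>2))) (at r)"
    using has_field_derivative_bessel_entire[OF DERIV_ident, of \<nu> "q * of_real (r\<^sup>2)" UNIV] by (simp add: o_def)
  have "(bessel_sol q \<nu> has_vector_derivative
     of_real (r powr (1/2 + \<nu>)) * ((q * of_real (2 * r)) * bessel_entire (\<nu> + 1) (q * of_real (r\<^sup>2)))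
     + of_real ((1/2 + \<nu>) / r * r powr (1/2 + \<nu>)) * bessel_entire \<nu> (q * of_real (r\<^sup>2))) (at r)"
    unfolding bessel_sol_def[abs_def] by (rule has_vector_derivative_mult[OF 1 2])
  moreover have "of_real (r powr (1/2 + \<nu>)) * ((q * of_real (2 * r)) * bessel_entire (\<nu> + 1) (q * of_real (r\<^sup>2)))
     + of_real ((1/2 + \<nu>) / r * r powr (1/2 + \<nu>)) * bessel_entire \<nu> (q * of_real (r\<^sup>2)) = bessel_sol' q \<nu> r"
    unfolding bessel_sol'_def bessel_sol_Suc[OF r] unfolding bessel_sol_def of_real_mult by (simp add: algebra_simps)
  ultimately show ?thesis by (simp only:)
qed

lemma bessel_sol_recurrence:
  assumes r: "r > 0"
  shows "bessel_sol q \<nu> r = of_real ((\<nu> + 1) / r) * bessel_sol q (\<nu> + 1) r + q * bessel_sol q (\<nu> + 1 + 1) r"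
proof -
  have p: "r powr (1/2 + (\<nu> + 1)) = r powr (1/2 + \<nu>) * r" "r powr (1/2 + (\<nu> + 1 + 1)) = r powr (1/2 + \<nu>) * r * r"
    using r by (simp_all only: powr_half_Suc)
  have "bessel_entire \<nu> w = of_real (\<nu> + 1) * bessel_entire (\<nu> + 1) w + w * bessel_entire (\<nu> + 1 + 1) w" for w
    using bessel_entire_recurrence[of "\<nu> + 1" w] by simp
  thus ?thesis unfolding bessel_sol_def p using r
    by (simp only:) (simp add: field_simps power2_eq_square)
qed

text \<open>Two differentiations bring in the orders nu + 1 and nu + 2, which
  \<open>bessel_sol_recurrence\<close> folds back into order nu. For q = -k^2/4 this is the radial
  equation at energy k^2.\<close>

lemma bessel_sol'_deriv:
  assumes r: "r > 0"
  shows "(bessel_sol' q \<nu> has_vector_derivative (of_real ((\<nu>\<^sup>2 - 1/4) / r\<^sup>2) + 4 * q) * bessel_sol q \<nu> r) (at r)"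
proof -
  let ?s = "bessel_sol q" and ?s' = "bessel_sol' q"
  have 1: "((\<lambda>r. complex_of_real ((1/2 + \<nu>) / r)) has_vector_derivative of_real (- (1/2 + \<nu>) / r\<^sup>2)) (at r)"
    by (rule has_vector_derivative_of_real)
       (use r in \<open>auto intro!: derivative_eq_intros simp: power2_eq_square\<close>)
  have "(?s' \<nu> has_vector_derivative
      (of_real ((1/2 + \<nu>) / r) * ?s' \<nu> r + of_real (- (1/2 + \<nu>) / r\<^sup>2) * ?s \<nu> r) + 2 * q * ?s' (\<nu> + 1) r) (at r)"
    unfolding bessel_sol'_def[abs_def]
    by (intro has_vector_derivative_add has_vector_derivative_mult[OF 1] has_vector_derivative_mult_right
         bessel_sol_deriv[OF r, unfolded bessel_sol'_def])
  moreover have "(of_real ((1/2 + \<nu>) / r) * ?s' \<nu> r + of_real (- (1/2 + \<nu>) / r\<^sup>2) * ?s \<nu> r) + 2 * q * ?s' (\<nu> + 1) r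
     = (of_real ((\<nu>\<^sup>2 - 1/4) / r\<^sup>2) + 4 * q) * ?s \<nu> r"
  proof -
    have "(of_real ((1/2 + \<nu>) / r) * ?s' \<nu> r + of_real (- (1/2 + \<nu>) / r\<^sup>2) * ?s \<nu> r) + 2 * q * ?s' (\<nu> + 1) r
      = (of_real ((1/2 + \<nu>) / r * ((1/2 + \<nu>) / r)) + of_real (- (1/2 + \<nu>) / r\<^sup>2)) * ?s \<nu> r
        + 4 * q * (of_real ((\<nu> + 1) / r) * ?s (\<nu> + 1) r + q * ?s (\<nu> + 1 + 1) r)"
      unfolding bessel_sol'_def by (simp add: algebra_simps add_divide_distrib)
    also have "(of_real ((1/2 + \<nu>) / r * ((1/2 + \<nu>) / r)) + of_real (- (1/2 + \<nu>) / r\<^sup>2)) = complex_of_real ((\<nu>\<^sup>2 - 1/4) / r\<^sup>2)"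
      unfolding of_real_add[symmetric] using r by (intro arg_cong[of _ _ of_real]) (simp add: field_simps power2_eq_square)
    finally show ?thesis unfolding bessel_sol_recurrence[OF r, symmetric] by (simp add: algebra_simps)
  qed
  ultimately show ?thesis by (simp only:)
qed

lemma bessel_sol_wronskian:
  assumes r: "r > 0"
  shows "bessel_sol q \<alpha> r * bessel_sol' q (- \<alpha>) r - bessel_sol' q \<alpha> r * bessel_sol q (- \<alpha>) r
     = of_real (- 2 * sin (pi * \<alpha>) / pi)"
proof -
  let ?E = "\<lambda>\<nu>. bessel_entire \<nu> (q * of_real (r\<^sup>2))"
  have p: "complex_of_real (r powr (1/2 + \<alpha>)) * of_real (r powr (1/2 + - \<alpha>)) = of_real r"
    using r by (simp flip: of_real_mult powr_add)
  have rec: "?E (- \<alpha> - 1) = - of_real \<alpha> * ?E (- \<alpha>) + q * of_real (r\<^sup>2) * ?E (- \<alpha> + 1)"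
    using bessel_entire_recurrence[of "- \<alpha>" "q * of_real (r\<^sup>2)"] by simp
  have "bessel_sol q \<alpha> r * bessel_sol' q (- \<alpha>) r - bessel_sol' q \<alpha> r * bessel_sol q (- \<alpha>) r
     = (of_real (r powr (1/2 + \<alpha>)) * of_real (r powr (1/2 + - \<alpha>))) * (of_real (- 2 * \<alpha> / r) * ?E \<alpha> * ?E (- \<alpha>)
       + 2 * q * of_real r * (?E \<alpha> * ?E (- \<alpha> + 1) - ?E (\<alpha> + 1) * ?E (- \<alpha>)))"
    unfolding bessel_sol'_def bessel_sol_Suc[OF r] unfolding bessel_sol_def
    by (simp add: algebra_simps add_divide_distrib diff_divide_distrib)
  also have "\<dots> = 2 * (?E \<alpha> * ?E (- \<alpha> - 1) - q * of_real (r\<^sup>2) * ?E (\<alpha> + 1) * ?E (- \<alpha>))"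
    unfolding p rec using r by (simp add: algebra_simps power2_eq_square)
  also have "\<dots> = of_real (- 2 * sin (pi * \<alpha>) / pi)"
    unfolding bessel_entire_wronskian by simp
  finally show ?thesis .
qed

text \<open>The most singular power is r^(1/2 - alpha), and 1/2 - alpha >= -alpha/2 because alpha <
  1. The exponent -alpha/2 is chosen so that its double, -alpha, is integrable at 0.\<close>

lemma bessel_sol_bound_at_0:
  assumes "0 < \<alpha>" "\<alpha> < 1" "\<bar>\<nu>\<bar> = \<alpha>"
  obtains C where "C \<ge> 0" "\<And>r. 0 < r \<Longrightarrow> r \<le> 1 \<Longrightarrow> norm (bessel_sol q \<nu> r) \<le> C * r powr (- \<alpha> / 2)"
proof -
  have "continuous_on {0..1} (\<lambda>r. bessel_entire \<nu> (q * of_real (r\<^sup>2)))" by (intro continuous_intros)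
  from compact_imp_bounded[OF compact_continuous_image[OF this compact_Icc]]
  obtain C where C: "\<And>r. r \<in> {0..1} \<Longrightarrow> norm (bessel_entire \<nu> (q * of_real (r\<^sup>2))) \<le> C"
    unfolding bounded_iff by (meson imageI)
  have "C \<ge> 0" using C[of 0] norm_ge_zero order_trans by fastforce
  moreover have "norm (bessel_sol q \<nu> r) \<le> C * r powr (- \<alpha> / 2)" if r: "0 < r" "r \<le> 1" for r
  proof -
    have "norm (bessel_sol q \<nu> r) = r powr (1/2 + \<nu>) * norm (bessel_entire \<nu> (q * of_real (r\<^sup>2)))"
      by (simp add: bessel_sol_def norm_mult)
    also have "\<dots> \<le> r powr (- \<alpha> / 2) * C"
      using C[of r] r assms \<open>C \<ge> 0\<close> by (intro mult_mono powr_mono') auto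
    finally show ?thesis by (simp add: mult.commute)
  qed
  ultimately show ?thesis using that by blast
qed

text \<open>Prepares the boundary form, as \<open>psi_fun\<close> is a combination of the powers
  with mu = alpha and mu = -alpha. The factor nu - mu removes the possibly singular term when the
  exponents agree.\<close>

lemma bessel_sol_wronskian_power:
  assumes r: "r > 0"
  shows "of_real (r powr (1/2 + \<mu>)) * bessel_sol' q \<nu> r - bessel_sol q \<nu> r * of_real ((1/2 + \<mu>) * r powr (1/2 + \<mu> - 1))
    = of_real ((\<nu> - \<mu>) * r powr (\<mu> + \<nu>)) * bessel_entire \<nu> (q * of_real (r\<^sup>2))
      + 2 * q * of_real (r powr (\<mu> + \<nu> + 2)) * bessel_entire (\<nu> + 1) (q * of_real (r\<^sup>2))"
proof -
  let ?E = "\<lambda>\<nu>. bessel_entire \<nu> (q * of_real (r\<^sup>2))"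
  have p: "r powr (1/2 + \<mu> - 1) = r powr (1/2 + \<mu>) / r" by (rule powr_half_minus_1[OF r])
  have p1: "r powr (1/2 + \<mu>) * r powr (1/2 + \<nu>) / r = r powr (\<mu> + \<nu>)"
    using r powr_diff[of r "1/2 + \<mu> + (1/2 + \<nu>)" 1] by (simp add: powr_add[symmetric])
  have p2: "r powr (1/2 + \<mu>) * r powr (1/2 + \<nu>) * r = r powr (\<mu> + \<nu> + 2)"
    using r powr_add[of r "1/2 + \<mu> + (1/2 + \<nu>)" 1] by (simp add: powr_add[symmetric] add_ac)
  have "of_real (r powr (1/2 + \<mu>)) * bessel_sol' q \<nu> r - bessel_sol q \<nu> r * of_real ((1/2 + \<mu>) * r powr (1/2 + \<mu> - 1))
    = of_real ((\<nu> - \<mu>) * (r powr (1/2 + \<mu>) * r powr (1/2 + \<nu>) / r)) * ?E \<nu>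
      + 2 * q * of_real (r powr (1/2 + \<mu>) * r powr (1/2 + \<nu>) * r) * ?E (\<nu> + 1)"
    unfolding bessel_sol'_def bessel_sol_Suc[OF r] p unfolding bessel_sol_def
    by (simp add: algebra_simps add_divide_distrib diff_divide_distrib)
  thus ?thesis unfolding p1 p2 .
qed

text \<open>The combinations y' + kappa y and y' - kappa y diagonalise the equation without its
  c/r^2 term. That term perturbs their energy \<open>N\<close> at relative rate D/r^2, which is
  integrable at infinity, so Gronwall's inequality keeps the rate |Re kappa| with no loss.\<close>

lemma exponential_growth_bound:
  fixes y y' :: "real \<Rightarrow> complex" and \<kappa> :: complex and c :: real
  assumes \<kappa>: "\<kappa> \<noteq> 0"
    and y: "\<And>r. r > 0 \<Longrightarrow> (y has_vector_derivative y' r) (at r)"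
    and y': "\<And>r. r > 0 \<Longrightarrow> (y' has_vector_derivative (\<kappa>\<^sup>2 + of_real (c / r\<^sup>2)) * y r) (at r)"
  obtains C where "C \<ge> 0" "\<And>r. r \<ge> 1 \<Longrightarrow> norm (y r) \<le> C * exp (\<bar>Re \<kappa>\<bar> * r)"
proof -
  define \<eta> where "\<eta> = \<bar>Re \<kappa>\<bar>"
  define a where "a = (\<lambda>r. y' r + \<kappa> * y r)"
  define b where "b = (\<lambda>r. y' r - \<kappa> * y r)"
  \<comment> \<open>From |y| <= (|a| + |b|) / (2 |kappa|) and (|a| + |b|)^2 <= 2 N.\<close>
  define D where "D = 2 * \<bar>c\<bar> / norm \<kappa>"
  define N where "N = (\<lambda>r. a r \<bullet> a r + b r \<bullet> b r)"
  define N' where "N' = (\<lambda>r. 2 * (a r \<bullet> (\<kappa> * a r + of_real (c / r\<^sup>2) * y r)) + 2 * (b r \<bullet> (- \<kappa> * b r + of_real (c / r\<^sup>2) * y r)))"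
  have N0: "N r \<ge> 0" for r by (simp add: N_def)
  have ynorm: "norm (y r) \<le> (norm (a r) + norm (b r)) / (2 * norm \<kappa>)" for r
  proof -
    have "y r = (a r - b r) / (2 * \<kappa>)" using \<kappa> by (simp add: a_def b_def)
    also have "norm \<dots> \<le> (norm (a r) + norm (b r)) / (2 * norm \<kappa>)"
      unfolding norm_divide norm_mult by (simp add: divide_right_mono norm_triangle_ineq4)
    finally show ?thesis .
  qed
  have sq: "(norm (a r) + norm (b r))\<^sup>2 \<le> 2 * N r" for r
    using sum_squares_bound[of "norm (a r)" "norm (b r)"]
    unfolding N_def power2_norm_eq_inner[symmetric] by (simp add: power2_sum)
  have Nd: "(N has_real_derivative N' r) (at r)" if r: "r > 0" for r
  proof -
    have "(a has_vector_derivative (\<kappa> * a r + of_real (c / r\<^sup>2) * y r)) (at r)"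
      unfolding a_def
      by (rule has_vector_derivative_eq_rhs, rule has_vector_derivative_add[OF y'[OF r] has_vector_derivative_mult_right[OF y[OF r]]])
         (simp add: algebra_simps power2_eq_square)
    moreover have "(b has_vector_derivative (- \<kappa> * b r + of_real (c / r\<^sup>2) * y r)) (at r)"
      unfolding b_def
      by (rule has_vector_derivative_eq_rhs, rule has_vector_derivative_diff[OF y'[OF r] has_vector_derivative_mult_right[OF y[OF r]]])
         (simp add: algebra_simps power2_eq_square)
    ultimately show ?thesis
      unfolding N_def N'_def has_real_derivative_iff_has_vector_derivative
      by (intro has_vector_derivative_eq_rhs[OF has_vector_derivative_add[OF
            bounded_bilinear.has_vector_derivative[OF bounded_bilinear_inner]
            bounded_bilinear.has_vector_derivative[OF bounded_bilinear_inner]]])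
         (auto simp: inner_commute)
  qed
  have inner_self: "z \<bullet> (\<kappa> * z) = Re \<kappa> * (norm z)\<^sup>2" for z :: complex
    unfolding inner_complex_def cmod_power2 by (simp add: algebra_simps power2_eq_square)
  have Nle: "N' r \<le> (2 * \<eta> + D / r\<^sup>2) * N r" if r: "r > 0" for r
  proof -
    have 1: "z \<bullet> (\<sigma> * z + of_real (c / r\<^sup>2) * y r) \<le> \<eta> * (norm z)\<^sup>2 + norm z * (\<bar>c\<bar> / r\<^sup>2 * norm (y r))"
      if "\<sigma> = \<kappa> \<or> \<sigma> = - \<kappa>" for z \<sigma>
    proof -
      have "z \<bullet> (\<sigma> * z) \<le> \<eta> * (norm z)\<^sup>2"
      proof -
        have "Re \<kappa> * (norm z)\<^sup>2 \<le> \<eta> * (norm z)\<^sup>2" "- Re \<kappa> * (norm z)\<^sup>2 \<le> \<eta> * (norm z)\<^sup>2"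
          unfolding \<eta>_def by (rule mult_right_mono; simp)+
        moreover have "z \<bullet> (- \<kappa> * z) = - Re \<kappa> * (norm z)\<^sup>2"
          by (simp only: mult_minus_left inner_minus_right inner_self)
        ultimately show ?thesis using that inner_self[of z] by metis
      qed
      moreover have "z \<bullet> (of_real (c / r\<^sup>2) * y r) \<le> norm z * (\<bar>c\<bar> / r\<^sup>2 * norm (y r))"
        by (rule order_trans[OF norm_cauchy_schwarz]) (simp add: norm_mult norm_divide norm_power)
      ultimately show ?thesis by (simp add: inner_add_right)
    qed
    have "N' r \<le> 2 * \<eta> * N r + (norm (a r) + norm (b r)) * (2 * \<bar>c\<bar> / r\<^sup>2 * norm (y r))"
    proof -
      have eq: "2 * \<eta> * N r + (norm (a r) + norm (b r)) * (2 * \<bar>c\<bar> / r\<^sup>2 * norm (y r))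
         = 2 * (\<eta> * (norm (a r))\<^sup>2 + norm (a r) * (\<bar>c\<bar> / r\<^sup>2 * norm (y r)))
         + 2 * (\<eta> * (norm (b r))\<^sup>2 + norm (b r) * (\<bar>c\<bar> / r\<^sup>2 * norm (y r)))"
        unfolding N_def power2_norm_eq_inner[symmetric] by (simp add: algebra_simps add_divide_distrib)
      show ?thesis
        unfolding N'_def eq by (intro add_mono mult_left_mono 1[OF disjI1[OF refl]] 1[OF disjI2[OF refl]]) simp_all
    qed
    also have "(norm (a r) + norm (b r)) * (2 * \<bar>c\<bar> / r\<^sup>2 * norm (y r))
       \<le> (norm (a r) + norm (b r)) * (2 * \<bar>c\<bar> / r\<^sup>2 * ((norm (a r) + norm (b r)) / (2 * norm \<kappa>)))"
      using ynorm by (intro mult_left_mono) auto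
    also have "\<dots> = (\<bar>c\<bar> / (norm \<kappa> * r\<^sup>2)) * (norm (a r) + norm (b r))\<^sup>2"
    proof -
      have "x * (2 * \<bar>c\<bar> / r\<^sup>2 * (x / (2 * norm \<kappa>))) = (\<bar>c\<bar> / (norm \<kappa> * r\<^sup>2)) * x\<^sup>2" for x :: real
        by (simp add: power2_eq_square mult_ac)
      thus ?thesis .
    qed
    also have "\<dots> \<le> (\<bar>c\<bar> / (norm \<kappa> * r\<^sup>2)) * (2 * N r)"
      using sq by (intro mult_left_mono) auto
    also have "\<dots> = D / r\<^sup>2 * N r" by (simp add: D_def)
    finally show ?thesis by (simp add: algebra_simps)
  qed
  \<comment> \<open>Integrating factor: -2 eta r + D/r has derivative -(2 eta + D/r^2), which makes
    \<open>m\<close> nonincreasing; dropping D/r >= 0 then bounds \<open>N\<close>.\<close>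
  define m where "m = (\<lambda>r. N r * exp (- 2 * \<eta> * r + D / r))"
  have mmono: "m r \<le> m 1" if "r \<ge> 1" for r
  proof (rule DERIV_nonpos_imp_nonincreasing[OF that])
    fix x :: real assume "1 \<le> x" "x \<le> r"
    hence x: "x > 0" by simp
    have "(m has_real_derivative (N' x - (2 * \<eta> + D / x\<^sup>2) * N x) * exp (- 2 * \<eta> * x + D / x)) (at x)"
      unfolding m_def using x
      by (auto intro!: derivative_eq_intros Nd simp: algebra_simps power2_eq_square)
    moreover have "(N' x - (2 * \<eta> + D / x\<^sup>2) * N x) * exp (- 2 * \<eta> * x + D / x) \<le> 0"
      using Nle[OF x] by (intro mult_nonpos_nonneg) auto
    ultimately show "\<exists>d. (m has_real_derivative d) (at x) \<and> d \<le> 0" by blast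
  qed
  have D0: "D \<ge> 0" by (simp add: D_def)
  have m1: "m 1 \<ge> 0" using N0[of 1] by (simp add: m_def)
  define C where "C = sqrt (2 * m 1) / (2 * norm \<kappa>)"
  have "norm (y r) \<le> C * exp (\<bar>Re \<kappa>\<bar> * r)" if r: "r \<ge> 1" for r
  proof -
    have "N r * exp (- 2 * \<eta> * r) \<le> m r"
      unfolding m_def using N0 D0 r by (intro mult_left_mono) auto
    also have "\<dots> \<le> m 1" by (rule mmono[OF r])
    finally have "N r \<le> m 1 * exp (2 * \<eta> * r)"
      by (simp add: exp_minus field_simps)
    hence "(norm (a r) + norm (b r))\<^sup>2 \<le> 2 * m 1 * exp (2 * \<eta> * r)" using sq[of r] by simp
    also have "\<dots> = (sqrt (2 * m 1) * exp (\<eta> * r))\<^sup>2"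
      using m1 by (simp add: power_mult_distrib flip: exp_double)
    finally have "norm (a r) + norm (b r) \<le> sqrt (2 * m 1) * exp (\<eta> * r)"
      by (rule power2_le_imp_le) (use m1 in simp)
    hence "(norm (a r) + norm (b r)) / (2 * norm \<kappa>) \<le> C * exp (\<eta> * r)"
      unfolding C_def times_divide_eq_left by (intro divide_right_mono) auto
    with ynorm[of r] show ?thesis by (simp add: \<eta>_def)
  qed
  moreover have "C \<ge> 0" using m1 by (simp add: C_def)
  ultimately show ?thesis using that by blast
qed

section \<open>Boundary values at the origin\<close>

lemma tendsto_powr_mult_bessel_entire:
  assumes "\<mu> > 0"
  shows "((\<lambda>r. of_real (r powr \<mu>) * bessel_entire \<nu> (q * of_real (r\<^sup>2))) \<longlongrightarrow> 0) (at_right 0)"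
    and "((\<lambda>r. bessel_entire \<nu> (q * of_real (r\<^sup>2))) \<longlongrightarrow> of_real (rGamma (1 + \<nu>))) (at_right 0)"
proof -
  have "isCont (\<lambda>r. bessel_entire \<nu> (q * of_real (r\<^sup>2))) (0::real)"
    by (intro continuous_on_interior[of UNIV] continuous_intros) auto
  hence "((\<lambda>r. bessel_entire \<nu> (q * of_real (r\<^sup>2))) \<longlongrightarrow> bessel_entire \<nu> (q * of_real (0\<^sup>2))) (at (0::real))"
    unfolding isCont_def .
  thus 1: "((\<lambda>r. bessel_entire \<nu> (q * of_real (r\<^sup>2))) \<longlongrightarrow> of_real (rGamma (1 + \<nu>))) (at_right 0)"
    using tendsto_within_subset[of _ _ 0 UNIV "{0<..}"] by simp
  have "((\<lambda>r::real. r powr \<mu>) \<longlongrightarrow> 0 powr \<mu>) (at_right 0)"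
    by (rule tendsto_powr'[OF tendsto_ident_at tendsto_const]) (use assms in \<open>auto simp: eventually_at_filter\<close>)
  from tendsto_mult[OF tendsto_of_real[OF this] 1]
  show "((\<lambda>r. of_real (r powr \<mu>) * bessel_entire \<nu> (q * of_real (r\<^sup>2))) \<longlongrightarrow> 0) (at_right 0)" by simp
qed

text \<open>Expands into four Wronskians of a power with a Bessel solution. Equal exponents
  contribute 0 in the limit and opposite ones 2 nu rGamma(1 + nu), so the boundary value is a linear
  form in (a, b).\<close>

lemma Wr_bessel_sol_limit:
  assumes \<alpha>: "0 < \<alpha>" "\<alpha> < 1"
  shows "((Wr \<alpha> s (\<lambda>r. a * bessel_sol q (- \<alpha>) r + b * bessel_sol q \<alpha> r) (\<lambda>r. a * bessel_sol' q (- \<alpha>) r + b * bessel_sol' q \<alpha> r))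
     \<longlongrightarrow> b * of_real (rGamma (1 + \<alpha>)) - a * of_real ((2 * \<alpha> * s - 1) * rGamma (1 - \<alpha>))) (at_right 0)"
proof -
  \<comment> \<open>The coefficients of r^(1/2 - alpha) and r^(1/2 + alpha) in G + s F.\<close>
  define c1 c2 where "c1 = 1 / (2 * \<alpha>)" and "c2 = s - 1 / (2 * \<alpha>)"
  have psi: "psi_fun \<alpha> s = (\<lambda>r. c1 * r powr (1/2 + - \<alpha>) + c2 * r powr (1/2 + \<alpha>))"
    by (rule ext) (simp add: psi_fun_def G_fun_def F_fun_def c1_def c2_def algebra_simps)
  have dpsi: "deriv (psi_fun \<alpha> s) r = c1 * ((1/2 + - \<alpha>) * r powr (1/2 + - \<alpha> - 1)) + c2 * ((1/2 + \<alpha>) * r powr (1/2 + \<alpha> - 1))"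
    if r: "r > 0" for r
    unfolding psi by (intro DERIV_imp_deriv DERIV_add DERIV_cmult has_real_derivative_powr r)
  let ?E = "\<lambda>\<nu> r. bessel_entire \<nu> (q * of_real (r\<^sup>2))"
  let ?V = "\<lambda>\<mu> \<nu> r. of_real ((\<nu> - \<mu>) * r powr (\<mu> + \<nu>)) * ?E \<nu> r + 2 * q * of_real (r powr (\<mu> + \<nu> + 2)) * ?E (\<nu> + 1) r"
  have lim_eq: "(?V \<mu> \<mu> \<longlongrightarrow> 0) (at_right 0)" if "\<bar>\<mu>\<bar> = \<alpha>" for \<mu>
    using tendsto_mult_left[OF tendsto_powr_mult_bessel_entire(1)[of "\<mu> + \<mu> + 2" "\<mu> + 1" q], of "2 * q"] that \<alpha>
    by (simp add: mult.assoc)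
  have lim_ne: "(?V (- \<nu>) \<nu> \<longlongrightarrow> of_real (2 * \<nu> * rGamma (1 + \<nu>))) (at_right 0)" for \<nu>
  proof -
    have "((\<lambda>r. of_real (2 * \<nu>) * ?E \<nu> r + 2 * q * (of_real (r powr 2) * ?E (\<nu> + 1) r))
       \<longlongrightarrow> of_real (2 * \<nu>) * of_real (rGamma (1 + \<nu>)) + 2 * q * 0) (at_right 0)"
      by (intro tendsto_add tendsto_mult_left tendsto_powr_mult_bessel_entire(1) tendsto_powr_mult_bessel_entire(2)[of 1]) auto
    hence "((\<lambda>r. of_real (2 * \<nu>) * ?E \<nu> r + 2 * q * (of_real (r powr 2) * ?E (\<nu> + 1) r))
       \<longlongrightarrow> of_real (2 * \<nu> * rGamma (1 + \<nu>))) (at_right 0)" by simp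
    moreover have "\<forall>\<^sub>F r in at_right 0. of_real (2 * \<nu>) * ?E \<nu> r + 2 * q * (of_real (r powr 2) * ?E (\<nu> + 1) r) = ?V (- \<nu>) \<nu> r"
      by (rule eventually_at_right_less[THEN eventually_mono]) (simp add: mult.assoc)
    ultimately show ?thesis by (rule Lim_transform_eventually)
  qed
  have "((\<lambda>r. a * (of_real c1 * ?V (- \<alpha>) (- \<alpha>) r + of_real c2 * ?V (- (- \<alpha>)) (- \<alpha>) r)
       + b * (of_real c1 * ?V (- \<alpha>) \<alpha> r + of_real c2 * ?V \<alpha> \<alpha> r))
     \<longlongrightarrow> a * (of_real c1 * 0 + of_real c2 * of_real (2 * (- \<alpha>) * rGamma (1 + - \<alpha>)))
       + b * (of_real c1 * of_real (2 * \<alpha> * rGamma (1 + \<alpha>)) + of_real c2 * 0)) (at_right 0)"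
    by (intro tendsto_add tendsto_mult_left lim_eq lim_ne) (use \<alpha> in auto)
  moreover have "a * (of_real c1 * 0 + of_real c2 * of_real (2 * (- \<alpha>) * rGamma (1 + - \<alpha>)))
       + b * (of_real c1 * of_real (2 * \<alpha> * rGamma (1 + \<alpha>)) + of_real c2 * 0)
     = b * of_real (rGamma (1 + \<alpha>)) - a * of_real ((2 * \<alpha> * s - 1) * rGamma (1 - \<alpha>))"
  proof -
    have "c2 * (2 * (- \<alpha>) * rGamma (1 + - \<alpha>)) = - ((2 * \<alpha> * s - 1) * rGamma (1 - \<alpha>))"
      "c1 * (2 * \<alpha> * rGamma (1 + \<alpha>)) = rGamma (1 + \<alpha>)"
      using \<alpha> by (simp_all add: c1_def c2_def field_simps)
    thus ?thesis by (simp only: of_real_mult[symmetric] mult_zero_right add_0_left add_0_right) simp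
  qed
  moreover have "\<forall>\<^sub>F r in at_right 0. a * (of_real c1 * ?V (- \<alpha>) (- \<alpha>) r + of_real c2 * ?V (- (- \<alpha>)) (- \<alpha>) r)
       + b * (of_real c1 * ?V (- \<alpha>) \<alpha> r + of_real c2 * ?V \<alpha> \<alpha> r)
     = Wr \<alpha> s (\<lambda>r. a * bessel_sol q (- \<alpha>) r + b * bessel_sol q \<alpha> r) (\<lambda>r. a * bessel_sol' q (- \<alpha>) r + b * bessel_sol' q \<alpha> r) r"
  proof (rule eventually_at_right_less[THEN eventually_mono])
    fix r :: real assume r: "0 < r"
    show "a * (of_real c1 * ?V (- \<alpha>) (- \<alpha>) r + of_real c2 * ?V (- (- \<alpha>)) (- \<alpha>) r)
       + b * (of_real c1 * ?V (- \<alpha>) \<alpha> r + of_real c2 * ?V \<alpha> \<alpha> r)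
     = Wr \<alpha> s (\<lambda>r. a * bessel_sol q (- \<alpha>) r + b * bessel_sol q \<alpha> r) (\<lambda>r. a * bessel_sol' q (- \<alpha>) r + b * bessel_sol' q \<alpha> r) r"
      unfolding bessel_sol_wronskian_power[OF r, symmetric] Wr_def dpsi[OF r]
      unfolding psi by (simp add: algebra_simps add_divide_distrib)
  qed
  ultimately show ?thesis by (simp only: Lim_transform_eventually)
qed

section \<open>Bessel and Hankel functions in terms of the radial solutions\<close>

lemma powr_mult_of_real:
  fixes z :: complex and r \<nu> :: real
  assumes "r > 0" "z \<noteq> 0"
  shows "(z * of_real r) powr of_real \<nu> = z powr of_real \<nu> * of_real (r powr \<nu>)"
proof -
  have "Ln (z * of_real r) = of_real (ln r) + Ln z"
    using Ln_times_of_real[OF assms] assms by (simp add: mult.commute Ln_of_real)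
  thus ?thesis using assms by (simp add: powr_def exp_add ring_distribs mult.commute flip: exp_of_real)
qed

lemma BesselJ_eq_bessel_entire:
  assumes z: "z \<noteq> 0"
  shows "BesselJ \<nu> z = (z / 2) powr of_real \<nu> * bessel_entire \<nu> (- z\<^sup>2 / 4)"
proof -
  have "(-1) ^ m / of_real (fact m * Gamma (real m + \<nu> + 1)) * (z / 2) powr (of_real (2 * real m + \<nu>))
     = (z / 2) powr of_real \<nu> * (of_real (rGamma (real m + 1 + \<nu>) / fact m) * (- z\<^sup>2 / 4) ^ m)" for m
  proof -
    have "(z / 2) powr (of_real (2 * real m + \<nu>)) = (z / 2) powr (of_nat (2 * m)) * (z / 2) powr of_real \<nu>"
      by (simp add: powr_add)
    also have "(z / 2) powr (of_nat (2 * m)) = (z / 2) ^ (2 * m)" using z by (subst powr_nat') auto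
    also have "\<dots> = (z\<^sup>2 / 4) ^ m" by (simp add: power_mult power_divide)
    finally have 1: "(z / 2) powr (of_real (2 * real m + \<nu>)) = (z\<^sup>2 / 4) ^ m * (z / 2) powr of_real \<nu>" .
    have 2: "(- z\<^sup>2 / 4) ^ m = (-1) ^ m * (z\<^sup>2 / 4) ^ m"
      by (simp add: power_mult_distrib[symmetric])
    \<comment> \<open>Also true at a pole: there \<open>Gamma\<close> is 0 by convention, and
      division by 0 gives 0, the value of \<open>rGamma\<close>.\<close>
    have 3: "rGamma (real m + 1 + \<nu>) = 1 / Gamma (real m + \<nu> + 1)"
      by (simp add: rGamma_inverse_Gamma field_simps add_ac)
    show ?thesis unfolding 1 2 3 by (simp add: field_simps)
  qed
  thus ?thesis unfolding BesselJ_def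
    by (simp only:) (subst suminf_mult[OF summable_bessel_entire], simp only: bessel_entire_def)
qed

lemma sqrt_mult_powr_bessel_entire:
  assumes "r > 0" "z \<noteq> 0"
  shows "of_real (sqrt r) * (((z * of_real r) / 2) powr of_real \<nu> * bessel_entire \<nu> (q * of_real (r\<^sup>2)))
     = (z / 2) powr of_real \<nu> * bessel_sol q \<nu> r"
proof -
  have "((z * of_real r) / 2) powr of_real \<nu> = (z / 2) powr of_real \<nu> * of_real (r powr \<nu>)"
    using powr_mult_of_real[of r "z / 2" \<nu>] assms by simp
  moreover have "r powr (1/2 + \<nu>) = sqrt r * r powr \<nu>" using assms by (simp add: powr_add powr_half_sqrt)
  ultimately show ?thesis by (simp add: bessel_sol_def mult_ac)
qed

lemma sqrt_BesselJ:
  assumes "r > 0" "k \<noteq> 0"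
  shows "of_real (sqrt r) * BesselJ \<nu> (k * of_real r) = (k / 2) powr of_real \<nu> * bessel_sol (- k\<^sup>2 / 4) \<nu> r"
proof -
  have "k * of_real r \<noteq> 0" using assms by simp
  note J = BesselJ_eq_bessel_entire[OF this]
  have "- (k * of_real r)\<^sup>2 / 4 = - k\<^sup>2 / 4 * of_real (r\<^sup>2)" by (simp add: power_mult_distrib)
  thus ?thesis
    by (simp only: J sqrt_mult_powr_bessel_entire[OF assms])
qed

lemma sqrt_bessel_I:
  assumes "r > 0" "k \<noteq> 0"
  shows "of_real (sqrt r) * bessel_I \<nu> (k * of_real r) = (k / 2) powr of_real \<nu> * bessel_sol (k\<^sup>2 / 4) \<nu> r"
proof -
  have "(k * of_real r)\<^sup>2 / 4 = k\<^sup>2 / 4 * of_real (r\<^sup>2)" by (simp add: power_mult_distrib)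
  thus ?thesis by (simp only: bessel_I_def sqrt_mult_powr_bessel_entire[OF assms])
qed

text \<open>For Im k > 0 the point -i k lies in the right half-plane, so multiplying it by i adds
  pi/2 to the argument without crossing the cut. This carries k to where the Macdonald integral
  converges.\<close>

lemma powr_rotate:
  assumes "Im k > 0"
  shows "(k / 2) powr of_real \<nu> = exp (\<i> * of_real (pi * \<nu> / 2)) * ((- \<i> * k) / 2) powr of_real \<nu>"
proof -
  have k: "k \<noteq> 0" using assms by auto
  have "Ln (\<i> * ((- \<i> * k) / 2)) = Ln ((- \<i> * k) / 2) + \<i> * of_real pi / 2"
    using assms k by (subst Ln_times_ii) auto
  moreover have "\<i> * ((- \<i> * k) / 2) = k / 2" by (simp add: field_simps)
  ultimately have "Ln (k / 2) = Ln ((- \<i> * k) / 2) + \<i> * of_real pi / 2" by (simp only:)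
  thus ?thesis using k by (simp add: powr_def exp_add ring_distribs mult_ac)
qed

text \<open>This and \<open>hankel_plus\<close> are the coordinates of sqrt r times
  \<open>Hankel1\<close> at k r with respect to the radial solutions of order -alpha and
  alpha.\<close>

definition hankel_minus :: "complex \<Rightarrow> real \<Rightarrow> complex" where
  "hankel_minus k \<alpha> = (k / 2) powr of_real (- \<alpha>) / (\<i> * of_real (sin (pi * \<alpha>)))"

definition hankel_plus :: "complex \<Rightarrow> real \<Rightarrow> complex" where
  "hankel_plus k \<alpha> = - exp (- \<i> * of_real (pi * \<alpha>)) * (k / 2) powr of_real \<alpha> / (\<i> * of_real (sin (pi * \<alpha>)))"

lemma sqrt_Hankel1:
  assumes "r > 0" "k \<noteq> 0"
  shows "of_real (sqrt r) * Hankel1 \<alpha> (k * of_real r) =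
    hankel_minus k \<alpha> * bessel_sol (- k\<^sup>2 / 4) (- \<alpha>) r + hankel_plus k \<alpha> * bessel_sol (- k\<^sup>2 / 4) \<alpha> r"
proof -
  have "of_real (sqrt r) * Hankel1 \<alpha> (k * of_real r) =
     (of_real (sqrt r) * BesselJ (- \<alpha>) (k * of_real r) - exp (- \<i> * of_real (pi * \<alpha>)) * (of_real (sqrt r) * BesselJ \<alpha> (k * of_real r)))
       / (\<i> * of_real (sin (pi * \<alpha>)))"
    by (simp add: Hankel1_def algebra_simps)
  thus ?thesis unfolding sqrt_BesselJ[OF assms] hankel_minus_def hankel_plus_def
    by (simp add: diff_divide_distrib)
qed

text \<open>After rotation by -i both Hankel coefficients carry the same phase exp(-i pi alpha / 2)
  and opposite signs, leaving the difference of modified Bessel functions that the connection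
  formula identifies. The phase has modulus 1 and drops out of the norm.\<close>

lemma hankel_sol_eq_macdonald:
  assumes \<alpha>: "0 < \<alpha>" "\<alpha> < 1" and k: "Im k > 0" and r: "r > 0"
  shows "norm (hankel_minus k \<alpha> * bessel_sol (- k\<^sup>2 / 4) (- \<alpha>) r + hankel_plus k \<alpha> * bessel_sol (- k\<^sup>2 / 4) \<alpha> r)
    = sqrt r * norm (macdonald \<alpha> (- \<i> * k * of_real r)) / pi"
proof -
  define \<kappa> where "\<kappa> = - \<i> * k"
  have \<kappa>: "\<kappa> \<noteq> 0" "Re (\<kappa> * of_real r) > 0" using k r by (auto simp: \<kappa>_def)
  have q: "- k\<^sup>2 / 4 = \<kappa>\<^sup>2 / 4" by (simp add: \<kappa>_def power_mult_distrib)
  have s0: "sin (pi * \<alpha>) > 0" using \<alpha> by (intro sin_gt_zero) auto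
  let ?e = "exp (- \<i> * of_real (pi * \<alpha> / 2))"
  let ?s = "\<lambda>\<nu>. bessel_sol (\<kappa>\<^sup>2 / 4) \<nu> r"
  have m: "hankel_minus k \<alpha> = ?e * (\<kappa> / 2) powr of_real (- \<alpha>) / (\<i> * of_real (sin (pi * \<alpha>)))"
    unfolding hankel_minus_def powr_rotate[OF k] \<kappa>_def by simp
  have "exp (- \<i> * of_real (pi * \<alpha>)) * exp (\<i> * of_real (pi * \<alpha> / 2)) = ?e"
    unfolding exp_add[symmetric] by (intro arg_cong[of _ _ exp]) (simp add: field_simps)
  hence "- exp (- \<i> * of_real (pi * \<alpha>)) * (exp (\<i> * of_real (pi * \<alpha> / 2)) * (\<kappa> / 2) powr of_real \<alpha>)
      = - ?e * (\<kappa> / 2) powr of_real \<alpha>"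
    by (simp only: mult.assoc[symmetric] mult_minus_left)
  hence p: "hankel_plus k \<alpha> = - ?e * (\<kappa> / 2) powr of_real \<alpha> / (\<i> * of_real (sin (pi * \<alpha>)))"
    unfolding hankel_plus_def powr_rotate[OF k] \<kappa>_def by (simp only:)
  have "hankel_minus k \<alpha> * ?s (- \<alpha>) + hankel_plus k \<alpha> * ?s \<alpha> =
     ?e / (\<i> * of_real (sin (pi * \<alpha>))) * ((\<kappa> / 2) powr of_real (- \<alpha>) * ?s (- \<alpha>) - (\<kappa> / 2) powr of_real \<alpha> * ?s \<alpha>)"
    unfolding m p by (simp add: right_diff_distrib diff_divide_distrib mult.assoc)
  also have "\<dots> = ?e / (\<i> * of_real (sin (pi * \<alpha>))) *
      (of_real (sqrt r) * (bessel_I (- \<alpha>) (\<kappa> * of_real r) - bessel_I \<alpha> (\<kappa> * of_real r)))"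
    unfolding sqrt_bessel_I[OF r \<kappa>(1), symmetric] by (simp add: right_diff_distrib)
  also have "\<dots> = ?e / (\<i> * of_real (sin (pi * \<alpha>))) *
      (of_real (sqrt r) * (of_real (sin (pi * \<alpha>) / pi) * macdonald \<alpha> (\<kappa> * of_real r)))"
    unfolding macdonald_eq_bessel_I[OF \<alpha> \<kappa>(2)] ..
  finally have eq: "hankel_minus k \<alpha> * ?s (- \<alpha>) + hankel_plus k \<alpha> * ?s \<alpha> = \<dots>" .
  have "norm ?e = 1" by simp
  thus ?thesis unfolding q eq \<kappa>_def[symmetric] norm_mult norm_divide using s0 r by (simp add: norm_divide)
qed

lemma hankel_sol_decay:
  assumes \<alpha>: "0 < \<alpha>" "\<alpha> < 1" and k: "Im k > 0"
  obtains C where "C \<ge> 0" "\<And>r. r \<ge> 1 \<Longrightarrow>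
     norm (hankel_minus k \<alpha> * bessel_sol (- k\<^sup>2 / 4) (- \<alpha>) r + hankel_plus k \<alpha> * bessel_sol (- k\<^sup>2 / 4) \<alpha> r)
       \<le> C * exp (- Im k * r)"
proof -
  obtain B where B: "\<And>z. Re z \<ge> Im k \<Longrightarrow> norm (macdonald \<alpha> z) \<le> B * exp (- Re z) / sqrt (Re z)"
    using macdonald_decay[OF k] by blast
  define C where "C = B / (sqrt (Im k) * pi)"
  have main: "norm (hankel_minus k \<alpha> * bessel_sol (- k\<^sup>2 / 4) (- \<alpha>) r + hankel_plus k \<alpha> * bessel_sol (- k\<^sup>2 / 4) \<alpha> r)
       \<le> C * exp (- Im k * r)" if r: "r \<ge> 1" for r
  proof -
    have "norm (macdonald \<alpha> (- \<i> * k * of_real r)) \<le> B * exp (- (Im k * r)) / sqrt (Im k * r)"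
      using B[of "- \<i> * k * of_real r"] r k by simp
    hence "sqrt r * norm (macdonald \<alpha> (- \<i> * k * of_real r)) / pi \<le> sqrt r * (B * exp (- (Im k * r)) / sqrt (Im k * r)) / pi"
      using r by (intro divide_right_mono mult_left_mono) auto
    also have "\<dots> = C * exp (- Im k * r)"
      using r by (simp add: C_def real_sqrt_mult)
    finally show ?thesis using hankel_sol_eq_macdonald[OF \<alpha> k, of r] r by simp
  qed
  \<comment> \<open>The sign of \<open>B\<close> is not known; that of \<open>C\<close> follows from
    the bound itself at r = 1.\<close>
  have "0 \<le> C * exp (- Im k * 1)" using main[of 1] by (rule order_trans[OF norm_ge_zero]) simp
  hence "C \<ge> 0" by (simp add: zero_le_mult_iff)
  with main that show ?thesis by blast
qed

definition A_coef_denom :: "complex \<Rightarrow> real \<Rightarrow> real \<Rightarrow> complex" where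
  "A_coef_denom k \<alpha> s = (k/2) powr (of_real (-2*\<alpha>)) * of_real (2 * s * \<alpha> - 1) * of_real (1 / sin (pi*\<alpha>))
        * of_real (Gamma (1+\<alpha>) / Gamma (1-\<alpha>)) + of_real (cot (pi*\<alpha>)) - \<i>"

text \<open>This is where A comes from: the boundary value of xi is i P rGamma(1 + alpha) times the
  bracket, with P = (k/2)^alpha, and that of the J part of phi is i pi/2 times the same P rGamma(1 +
  alpha). They cancel in phi exactly when A is pi/2 over the bracket.\<close>

lemma hankel_boundary_value:
  assumes \<alpha>: "0 < \<alpha>" "\<alpha> < 1" and k: "k \<noteq> 0"
  shows "hankel_plus k \<alpha> * of_real (rGamma (1 + \<alpha>)) - hankel_minus k \<alpha> * of_real ((2 * \<alpha> * s - 1) * rGamma (1 - \<alpha>))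
     = \<i> * A_coef_denom k \<alpha> s * ((k / 2) powr of_real \<alpha> * of_real (rGamma (1 + \<alpha>)))"
proof -
  have s0: "sin (pi * \<alpha>) > 0" using \<alpha> by (intro sin_gt_zero) auto
  define S P G1 G2 t where "S = complex_of_real (sin (pi * \<alpha>))" and "P = (k / 2) powr of_real \<alpha>"
    and "G1 = complex_of_real (rGamma (1 + \<alpha>))" and "G2 = complex_of_real (rGamma (1 - \<alpha>))"
    and "t = complex_of_real (2 * \<alpha> * s - 1)"
  have "Gamma (1 + \<alpha>) > 0" "Gamma (1 - \<alpha>) > 0" using \<alpha> by (auto intro!: Gamma_real_pos)
  hence nz: "S \<noteq> 0" "P \<noteq> 0" "G1 \<noteq> 0" "G2 \<noteq> 0"
    using s0 k by (auto simp: S_def P_def G1_def G2_def rGamma_inverse_Gamma)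
  have "Gamma (1 + \<alpha>) / Gamma (1 - \<alpha>) = rGamma (1 - \<alpha>) / rGamma (1 + \<alpha>)"
    by (simp add: rGamma_inverse_Gamma divide_inverse)
  hence g: "complex_of_real (Gamma (1 + \<alpha>) / Gamma (1 - \<alpha>)) = G2 / G1" by (simp only: G1_def G2_def of_real_divide)
  have pm: "(k / 2) powr of_real (- \<alpha>) = 1 / P" by (simp only: P_def powr_minus of_real_minus inverse_eq_divide)
  have "complex_of_real (- 2 * \<alpha>) = of_real (- \<alpha>) + of_real (- \<alpha>)" by (simp flip: of_real_add)
  hence "(k / 2) powr of_real (- 2 * \<alpha>) = (k / 2) powr (of_real (- \<alpha>) + of_real (- \<alpha>))" by (simp only:)
  also have "\<dots> = 1 / P * (1 / P)" unfolding powr_add pm ..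
  finally have pm2: "(k / 2) powr of_real (- 2 * \<alpha>) = 1 / P * (1 / P)" .
  have e: "exp (- \<i> * of_real (pi * \<alpha>)) = of_real (cos (pi * \<alpha>)) - \<i> * S"
    using cis_conv_exp[of "- (pi * \<alpha>)"] by (simp add: complex_eq_iff S_def)
  have br: "A_coef_denom k \<alpha> s = 1 / P * (1 / P) * t * (1 / S) * (G2 / G1) + of_real (cos (pi * \<alpha>)) / S - \<i>"
  proof -
    have "complex_of_real (2 * s * \<alpha> - 1) = t" by (simp add: t_def mult_ac)
    moreover have "complex_of_real (1 / sin (pi * \<alpha>)) = 1 / S" "complex_of_real (cot (pi * \<alpha>)) = of_real (cos (pi * \<alpha>)) / S"
      by (simp_all add: S_def cot_def)
    ultimately show ?thesis unfolding A_coef_denom_def pm2 g by (simp only:)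
  qed
  have tG: "complex_of_real ((2 * \<alpha> * s - 1) * rGamma (1 - \<alpha>)) = t * G2"
    by (simp only: t_def G2_def of_real_mult)
  show ?thesis
    unfolding hankel_plus_def hankel_minus_def e br pm tG
    unfolding S_def[symmetric] P_def[symmetric] G1_def[symmetric]
    using nz by (simp add: field_simps)
qed

section \<open>Linear operations on square integrable functions\<close>

lemma L2pos_cong:
  assumes "L2pos f" "\<And>r. r > 0 \<Longrightarrow> g r = f r"
  shows "L2pos g"
proof -
  have "(\<lambda>r. indicator {0<..} r *\<^sub>R g r) = (\<lambda>r. indicator {0<..} r *\<^sub>R f r)"
    "(\<lambda>r. indicator {0<..} r *\<^sub>R (norm (g r))\<^sup>2) = (\<lambda>r. indicator {0<..} r *\<^sub>R (norm (f r))\<^sup>2)"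
    by (auto simp: fun_eq_iff indicator_def assms(2))
  thus ?thesis using assms(1) unfolding L2pos_def set_borel_measurable_def set_integrable_def by simp
qed

lemma L2pos_add_cmult:
  assumes f: "L2pos f" and g: "L2pos g"
  shows "L2pos (\<lambda>r. f r + c * g r)"
proof -
  let ?F = "\<lambda>r. indicator {0<..} r *\<^sub>R f r" and ?G = "\<lambda>r. indicator {0<..} r *\<^sub>R g r"
  have [measurable]: "?F \<in> borel_measurable borel" "?G \<in> borel_measurable borel"
    using f g unfolding L2pos_def set_borel_measurable_def by simp_all
  have eq: "(\<lambda>r. indicator {0<..} r *\<^sub>R (f r + c * g r)) = (\<lambda>r. ?F r + c * ?G r)"
    "(\<lambda>r. indicator {0<..} r *\<^sub>R (norm (f r + c * g r))\<^sup>2) = (\<lambda>r. (norm (?F r + c * ?G r))\<^sup>2)"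
    by (auto simp: indicator_def)
  have m: "(\<lambda>r. ?F r + c * ?G r) \<in> borel_measurable borel" by measurable
  have i: "integrable lborel (\<lambda>r. indicator {0<..} r *\<^sub>R (norm (f r))\<^sup>2)" "integrable lborel (\<lambda>r. indicator {0<..} r *\<^sub>R (norm (g r))\<^sup>2)"
    using f g unfolding L2pos_def set_integrable_def by simp_all
  have "integrable lborel (\<lambda>r. (norm (?F r + c * ?G r))\<^sup>2)"
  proof (rule Bochner_Integration.integrable_bound)
    show "integrable lborel (\<lambda>r. 2 * (indicator {0<..} r *\<^sub>R (norm (f r))\<^sup>2) + 2 * (norm c)\<^sup>2 * (indicator {0<..} r *\<^sub>R (norm (g r))\<^sup>2))"
      using i by (intro Bochner_Integration.integrable_add integrable_mult_right)
    show "(\<lambda>r. (norm (?F r + c * ?G r))\<^sup>2) \<in> borel_measurable lborel" by measurable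
    have "(norm (x + c * y))\<^sup>2 \<le> 2 * (norm x)\<^sup>2 + 2 * (norm c)\<^sup>2 * (norm y)\<^sup>2" for x y :: complex
    proof -
      have "(norm (x + c * y))\<^sup>2 \<le> (norm x + norm c * norm y)\<^sup>2"
        by (intro power_mono norm_triangle_le) (auto simp: norm_mult)
      also have "\<dots> \<le> 2 * (norm x)\<^sup>2 + 2 * (norm c * norm y)\<^sup>2"
        using sum_squares_bound[of "norm x" "norm c * norm y"] by (simp add: power2_sum)
      finally show ?thesis by (simp add: power_mult_distrib)
    qed
    thus "AE r in lborel. norm ((norm (?F r + c * ?G r))\<^sup>2)
        \<le> norm (2 * (indicator {0<..} r *\<^sub>R (norm (f r))\<^sup>2) + 2 * (norm c)\<^sup>2 * (indicator {0<..} r *\<^sub>R (norm (g r))\<^sup>2))"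
      by (intro AE_I2) (auto simp: indicator_def)
  qed
  thus ?thesis unfolding L2pos_def set_borel_measurable_def set_integrable_def eq using m by simp
qed

lemma L2pos_0: "L2pos (\<lambda>_. 0)"
  by (simp add: L2pos_def set_borel_measurable_def set_integrable_def)

lemma L2pos_cmult: "L2pos g \<Longrightarrow> L2pos (\<lambda>r. c * g r)"
  using L2pos_add_cmult[of "\<lambda>_. 0" g c] L2pos_0 by (simp only: add_0_left)

section \<open>The decaying solution as a candidate eigenfunction\<close>

context green_pair
begin

lemma \<xi>_L2: "L2pos \<xi>"
proof -
  have m: "(\<lambda>r. indicator {0<..} r *\<^sub>R \<xi> r) \<in> borel_measurable borel"
    using borel_measurable_continuous_on_indicator[OF _ cont_fns(3)] by simp
  have eq: "(\<lambda>r. indicator {0<..} r *\<^sub>R (norm (\<xi> r))\<^sup>2) = (\<lambda>r. (norm (indicator {0<..} r *\<^sub>R \<xi> r))\<^sup>2)"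
    by (auto simp: indicator_def)
  have "integrable lborel (\<lambda>r. (norm (indicator {0<..} r *\<^sub>R \<xi> r))\<^sup>2)"
  proof (rule integrableI_nonneg)
    show "(\<lambda>r. (norm (indicator {0<..} r *\<^sub>R \<xi> r))\<^sup>2) \<in> borel_measurable lborel"
      by (intro borel_measurable_power borel_measurable_norm[THEN measurable_compose[rotated]]) (use m in simp)
    have "(\<integral>\<^sup>+r. ennreal ((norm (indicator {0<..} r *\<^sub>R \<xi> r))\<^sup>2) \<partial>lborel) \<le> (\<integral>\<^sup>+r. ennreal ((w r)\<^sup>2 * exp (- \<eta> * \<bar>0 - r\<bar>)) \<partial>lborel)"
    proof (intro nn_integral_mono ennreal_leI)
      fix r :: real
      show "(norm (indicator {0<..} r *\<^sub>R \<xi> r))\<^sup>2 \<le> (w r)\<^sup>2 * exp (- \<eta> * \<bar>0 - r\<bar>)"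
      proof (cases "r > 0")
        case True
        have "(norm (\<xi> r))\<^sup>2 \<le> (w r * exp (- \<eta> * r))\<^sup>2" by (intro power_mono \<xi>_bound True) auto
        also have "\<dots> = (w r)\<^sup>2 * (exp (- \<eta> * r) * exp (- \<eta> * r))" by (simp add: power2_eq_square)
        \<comment> \<open>Squaring yields exp(-2 eta r); one of the two factors is given up to reach
          \<open>w_bound\<close> at the point 0.\<close>
        also have "\<dots> \<le> (w r)\<^sup>2 * (1 * exp (- \<eta> * r))" using True \<eta> by (intro mult_left_mono mult_right_mono) auto
        finally show ?thesis using True by simp
      qed simp
    qed
    also have "\<dots> \<le> ennreal M" by (rule w_bound)
    finally show "(\<integral>\<^sup>+r. ennreal ((norm (indicator {0<..} r *\<^sub>R \<xi> r))\<^sup>2) \<partial>lborel) < \<infinity>"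
      by (rule le_less_trans) simp
  qed auto
  thus ?thesis unfolding L2pos_def set_borel_measurable_def set_integrable_def eq using m by simp
qed

text \<open>By continuity the set where xi is nonzero is open; if null it is empty, and then xi and
  its derivative vanish at 1, against the Wronskian -1.\<close>

lemma \<xi>_not_AE_zero: "\<not> (AE r in lborel. r > 0 \<longrightarrow> \<xi> r = 0)"
proof
  assume AE: "AE r in lborel. r > 0 \<longrightarrow> \<xi> r = 0"
  define S where "S = {r \<in> {0<..}. \<xi> r \<noteq> 0}"
  have eq: "S = {0<..} \<inter> \<xi> -` (- {0})" by (auto simp: S_def)
  have S: "open S" unfolding eq by (rule continuous_open_preimage[OF cont_fns(3)]) auto
  have "AE r in lborel. r \<notin> S" using AE by eventually_elim (auto simp: S_def)
  hence "S \<in> null_sets lborel" using S by (subst AE_iff_null_sets) auto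
  hence "negligible S" by (simp add: negligible_iff_null_sets null_sets_completionI)
  hence "S = {}" using S open_not_negligible by blast
  hence z: "\<xi> r = 0" if "r > 0" for r using that by (auto simp: S_def)
  have "(\<xi> has_vector_derivative 0) (at 1)"
    by (rule has_vector_derivative_transform_within_open[of "\<lambda>_. 0" _ _ "{0<..}"]) (use z in auto)
  with \<xi>_deriv[of 1] have "\<xi>' 1 = 0" using vector_derivative_unique_at by fastforce
  thus False using wronskian[of 1] z[of 1] by simp
qed

lemma \<xi>''_integral:
  assumes "0 < a" "a \<le> b"
  shows "set_integrable lborel {a..b} (\<lambda>x. q x * \<xi> x)" and "\<xi>' b - \<xi>' a = (LINT x:{a..b}|lborel. q x * \<xi> x)"
proof -
  have c: "continuous_on {a..b} (\<lambda>x. q x * \<xi> x)"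
    by (rule continuous_on_subset[OF continuous_on_mult[OF q_cont cont_fns(3)]]) (use assms in auto)
  thus "set_integrable lborel {a..b} (\<lambda>x. q x * \<xi> x)" by (rule borel_integrable_atLeastAtMost')
  show "\<xi>' b - \<xi>' a = (LINT x:{a..b}|lborel. q x * \<xi> x)"
    unfolding set_lebesgue_integral_def
    by (rule integral_FTC_atLeastAtMost[symmetric, OF assms(2) _ c])
       (use assms in \<open>auto intro!: has_vector_derivative_at_within \<xi>'_deriv\<close>)
qed

end

section \<open>The Bessel solutions as a Green pair\<close>

text \<open>Carries the singularity at 0 of both solutions. It is 1 also for t <= 0, where any
  bounded nonnegative measurable choice would do, because the locale takes its integrals over the
  whole line.\<close>

definition bessel_weight :: "real \<Rightarrow> real \<Rightarrow> real" where
  "bessel_weight \<alpha> t = (if 0 < t \<and> t \<le> 1 then t powr (- \<alpha> / 2) else 1)"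

lemma bessel_weight_measurable [measurable]: "bessel_weight \<alpha> \<in> borel_measurable borel"
  unfolding bessel_weight_def[abs_def] by measurable

text \<open>The squared weight is at most 1 plus t^(-alpha) on (0, 1]; the two parts integrate to at
  most 2/eta and 1/(1 - alpha), uniformly in r.\<close>

lemma bessel_weight_bound:
  assumes \<alpha>: "0 < \<alpha>" "\<alpha> < 1" and \<eta>: "\<eta> > 0"
  shows "(\<integral>\<^sup>+t. ennreal ((c * bessel_weight \<alpha> t)\<^sup>2 * exp (- \<eta> * \<bar>r - t\<bar>)) \<partial>lborel) \<le> ennreal (c\<^sup>2 * (2 / \<eta> + 1 / (1 - \<alpha>)))"
proof -
  let ?e = "\<lambda>t. exp (- \<eta> * \<bar>r - t\<bar>)" and ?p = "\<lambda>t::real. if t \<in> {0..1} then t powr (- \<alpha>) else 0"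
  have "(c * bessel_weight \<alpha> t)\<^sup>2 * ?e t \<le> c\<^sup>2 * (?e t + ?p t)" for t
  proof -
    have "(bessel_weight \<alpha> t)\<^sup>2 * ?e t \<le> ?e t + ?p t"
    proof (cases "0 < t \<and> t \<le> 1")
      case True
      have "(bessel_weight \<alpha> t)\<^sup>2 = t powr (- \<alpha>)"
        using True by (simp add: bessel_weight_def power2_eq_square flip: powr_add)
      moreover have "t powr (- \<alpha>) * ?e t \<le> t powr (- \<alpha>) * 1" using \<eta> by (intro mult_left_mono) auto
      ultimately show ?thesis using True by (simp add: add_increasing)
    next
      case False
      have "(bessel_weight \<alpha> t)\<^sup>2 = 1" using False unfolding bessel_weight_def by auto
      moreover have "?p t \<ge> 0" by simp
      ultimately show ?thesis by (simp only: mult_1_left le_add_same_cancel1)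
    qed
    thus ?thesis by (simp only: power_mult_distrib mult.assoc) (rule mult_left_mono, auto)
  qed
  moreover have eq: "ennreal (c\<^sup>2) * (ennreal (?e t) + ennreal (?p t)) = ennreal (c\<^sup>2 * (?e t + ?p t))" for t
    by (subst ennreal_plus[symmetric], simp, simp, rule ennreal_mult[symmetric], simp, simp)
  ultimately have "(\<integral>\<^sup>+t. ennreal ((c * bessel_weight \<alpha> t)\<^sup>2 * ?e t) \<partial>lborel) \<le> (\<integral>\<^sup>+t. ennreal (c\<^sup>2) * (ennreal (?e t) + ennreal (?p t)) \<partial>lborel)"
    unfolding eq by (intro nn_integral_mono ennreal_leI)
  also have "\<dots> = ennreal (c\<^sup>2) * ((\<integral>\<^sup>+t. ennreal (?e t) \<partial>lborel) + (\<integral>\<^sup>+t. ennreal (?p t) \<partial>lborel))"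
    by (subst nn_integral_cmult, measurable, subst nn_integral_add, measurable)
  also have "(\<integral>\<^sup>+t. ennreal (?p t) \<partial>lborel) = ennreal (1 / (1 - \<alpha>))"
  proof (rule nn_integral_has_integral_lborel)
    have "((\<lambda>t. t powr (- \<alpha>)) has_integral (1 powr (- \<alpha> + 1) / (- \<alpha> + 1))) {0..1}"
      using \<alpha> by (intro has_integral_powr_from_0) auto
    thus "(?p has_integral (1 / (1 - \<alpha>))) UNIV" by (subst has_integral_restrict_UNIV) simp
  qed auto
  also have "ennreal (c\<^sup>2) * ((\<integral>\<^sup>+t. ennreal (?e t) \<partial>lborel) + ennreal (1 / (1 - \<alpha>)))
      \<le> ennreal (c\<^sup>2) * (ennreal (2 / \<eta>) + ennreal (1 / (1 - \<alpha>)))"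
    by (intro mult_left_mono add_right_mono nn_integral_exp_minus_abs_le \<eta>) auto
  also have "\<dots> = ennreal (c\<^sup>2 * (2 / \<eta> + 1 / (1 - \<alpha>)))"
    using \<alpha> \<eta> by (simp add: ennreal_mult ennreal_plus)
  finally show ?thesis .
qed

text \<open>The general solution at energy k^2 in coordinates (a, b): Wronskians become 2 x 2
  determinants and boundary values linear forms.\<close>

definition bsol :: "complex \<Rightarrow> real \<Rightarrow> complex \<Rightarrow> complex \<Rightarrow> real \<Rightarrow> complex" where
  "bsol k \<alpha> a b r = a * bessel_sol (- k\<^sup>2 / 4) (- \<alpha>) r + b * bessel_sol (- k\<^sup>2 / 4) \<alpha> r"

definition bsol' :: "complex \<Rightarrow> real \<Rightarrow> complex \<Rightarrow> complex \<Rightarrow> real \<Rightarrow> complex" where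
  "bsol' k \<alpha> a b r = a * bessel_sol' (- k\<^sup>2 / 4) (- \<alpha>) r + b * bessel_sol' (- k\<^sup>2 / 4) \<alpha> r"

lemma bsol_deriv: "r > 0 \<Longrightarrow> (bsol k \<alpha> a b has_vector_derivative bsol' k \<alpha> a b r) (at r)"
  unfolding bsol_def[abs_def] bsol'_def
  by (rule has_vector_derivative_add[OF has_vector_derivative_mult_right[OF bessel_sol_deriv]
        has_vector_derivative_mult_right[OF bessel_sol_deriv]])

lemma bsol'_deriv:
  assumes "r > 0"
  shows "(bsol' k \<alpha> a b has_vector_derivative (of_real (Vpot \<alpha> r) - k\<^sup>2) * bsol k \<alpha> a b r) (at r)"
proof -
  note d = has_vector_derivative_add[OF has_vector_derivative_mult_right[OF bessel_sol'_deriv[OF assms, of "- k\<^sup>2 / 4" "- \<alpha>"], of a]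
    has_vector_derivative_mult_right[OF bessel_sol'_deriv[OF assms, of "- k\<^sup>2 / 4" \<alpha>], of b]]
  show ?thesis unfolding bsol'_def[abs_def]
    by (rule has_vector_derivative_eq_rhs[OF d]) (simp add: bsol_def Vpot_def algebra_simps)
qed

lemma bsol_wronskian:
  assumes r: "r > 0"
  shows "bsol k \<alpha> a b r * bsol' k \<alpha> a1 b1 r - bsol' k \<alpha> a b r * bsol k \<alpha> a1 b1 r
    = (a * b1 - b * a1) * of_real (2 * sin (pi * \<alpha>) / pi)"
proof -
  let ?m = "bessel_sol (- k\<^sup>2 / 4) (- \<alpha>) r" and ?p = "bessel_sol (- k\<^sup>2 / 4) \<alpha> r"
  let ?m' = "bessel_sol' (- k\<^sup>2 / 4) (- \<alpha>) r" and ?p' = "bessel_sol' (- k\<^sup>2 / 4) \<alpha> r"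
  have "bsol k \<alpha> a b r * bsol' k \<alpha> a1 b1 r - bsol' k \<alpha> a b r * bsol k \<alpha> a1 b1 r
    = - (a * b1 - b * a1) * (?p * ?m' - ?p' * ?m)"
    unfolding bsol_def bsol'_def by (simp add: algebra_simps)
  moreover have "complex_of_real (- 2 * sin (pi * \<alpha>) / pi) = - of_real (2 * sin (pi * \<alpha>) / pi)" by simp
  ultimately show ?thesis unfolding bessel_sol_wronskian[OF r] by (simp only: minus_mult_minus)
qed

lemma bsol_bound_at_0:
  assumes "0 < \<alpha>" "\<alpha> < 1"
  obtains C where "C \<ge> 0" "\<And>r. 0 < r \<Longrightarrow> r \<le> 1 \<Longrightarrow> norm (bsol k \<alpha> a b r) \<le> C * r powr (- \<alpha> / 2)"
proof -
  obtain C1 where C1: "C1 \<ge> 0" "\<And>r. 0 < r \<Longrightarrow> r \<le> 1 \<Longrightarrow> norm (bessel_sol (- k\<^sup>2 / 4) (- \<alpha>) r) \<le> C1 * r powr (- \<alpha> / 2)"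
    using bessel_sol_bound_at_0[OF assms, of "- \<alpha>" "- k\<^sup>2 / 4"] assms by auto
  obtain C2 where C2: "C2 \<ge> 0" "\<And>r. 0 < r \<Longrightarrow> r \<le> 1 \<Longrightarrow> norm (bessel_sol (- k\<^sup>2 / 4) \<alpha> r) \<le> C2 * r powr (- \<alpha> / 2)"
    using bessel_sol_bound_at_0[OF assms, of \<alpha> "- k\<^sup>2 / 4"] assms by auto
  show ?thesis
  proof
    show "norm a * C1 + norm b * C2 \<ge> 0" using C1 C2 by simp
    fix r :: real assume r: "0 < r" "r \<le> 1"
    have "norm (bsol k \<alpha> a b r) \<le> norm a * norm (bessel_sol (- k\<^sup>2 / 4) (- \<alpha>) r) + norm b * norm (bessel_sol (- k\<^sup>2 / 4) \<alpha> r)"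
      unfolding bsol_def norm_mult[symmetric] by (rule norm_triangle_ineq)
    also have "\<dots> \<le> norm a * (C1 * r powr (- \<alpha> / 2)) + norm b * (C2 * r powr (- \<alpha> / 2))"
      using C1 C2 r by (intro add_mono mult_left_mono) auto
    finally show "norm (bsol k \<alpha> a b r) \<le> (norm a * C1 + norm b * C2) * r powr (- \<alpha> / 2)" by (simp add: algebra_simps)
  qed
qed

lemma green_pair_bsol:
  assumes \<alpha>: "0 < \<alpha>" "\<alpha> < 1" and k: "Im k > 0"
    and det: "(a * hankel_plus k \<alpha> - b * hankel_minus k \<alpha>) * of_real (2 * sin (pi * \<alpha>) / pi) = -1"
  obtains w M where "green_pair (bsol k \<alpha> a b) (bsol' k \<alpha> a b)
    (bsol k \<alpha> (hankel_minus k \<alpha>) (hankel_plus k \<alpha>)) (bsol' k \<alpha> (hankel_minus k \<alpha>) (hankel_plus k \<alpha>))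
    (\<lambda>r. of_real (Vpot \<alpha> r) - k\<^sup>2) w (Im k) M"
proof -
  let ?\<phi> = "bsol k \<alpha> a b" and ?\<xi> = "bsol k \<alpha> (hankel_minus k \<alpha>) (hankel_plus k \<alpha>)"
  obtain C1 where C1: "C1 \<ge> 0" "\<And>r. 0 < r \<Longrightarrow> r \<le> 1 \<Longrightarrow> norm (?\<phi> r) \<le> C1 * r powr (- \<alpha> / 2)"
    using bsol_bound_at_0[OF \<alpha>] by blast
  obtain C2 where C2: "C2 \<ge> 0" "\<And>r. 0 < r \<Longrightarrow> r \<le> 1 \<Longrightarrow> norm (?\<xi> r) \<le> C2 * r powr (- \<alpha> / 2)"
    using bsol_bound_at_0[OF \<alpha>] by blast
  \<comment> \<open>With kappa = -i k, kappa^2 = -k^2 and |Re kappa| = Im k, the growth rate wanted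
    for phi.\<close>
  have "- \<i> * k \<noteq> 0" using k by auto
  moreover have "(bsol' k \<alpha> a b has_vector_derivative ((- \<i> * k)\<^sup>2 + of_real ((\<alpha>\<^sup>2 - 1/4) / r\<^sup>2)) * ?\<phi> r) (at r)" if "r > 0" for r
    using bsol'_deriv[OF that, of k \<alpha> a b] by (simp add: Vpot_def power_mult_distrib)
  ultimately obtain C3 where C3: "C3 \<ge> 0" "\<And>r. r \<ge> 1 \<Longrightarrow> norm (?\<phi> r) \<le> C3 * exp (\<bar>Re (- \<i> * k)\<bar> * r)"
    using exponential_growth_bound[of "- \<i> * k" ?\<phi> "bsol' k \<alpha> a b" "\<alpha>\<^sup>2 - 1/4", OF _ bsol_deriv] by blast
  obtain C4 where C4: "C4 \<ge> 0" "\<And>r. r \<ge> 1 \<Longrightarrow> norm (?\<xi> r) \<le> C4 * exp (- Im k * r)"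
    unfolding bsol_def using hankel_sol_decay[OF \<alpha> k] by blast
  \<comment> \<open>The factor exp(Im k) compensates exp(-Im k r) on (0, 1], where the bound for xi
    at the origin has no exponential.\<close>
  define C where "C = C1 + C2 * exp (Im k) + C3 + C4"
  have C: "C \<ge> 0" "C1 \<le> C" "C2 * exp (Im k) \<le> C" "C3 \<le> C" "C4 \<le> C"
    using C1(1) C2(1) C3(1) C4(1) by (auto simp: C_def)
  have "green_pair ?\<phi> (bsol' k \<alpha> a b) ?\<xi> (bsol' k \<alpha> (hankel_minus k \<alpha>) (hankel_plus k \<alpha>))
    (\<lambda>r. of_real (Vpot \<alpha> r) - k\<^sup>2) (\<lambda>t. C * bessel_weight \<alpha> t) (Im k) (C\<^sup>2 * (2 / Im k + 1 / (1 - \<alpha>)))"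
  proof
    show "(\<lambda>t. C * bessel_weight \<alpha> t) \<in> borel_measurable borel" by measurable
    show "C * bessel_weight \<alpha> t \<ge> 0" for t using C by (simp add: bessel_weight_def)
    show "(\<integral>\<^sup>+t. ennreal ((C * bessel_weight \<alpha> t)\<^sup>2 * exp (- Im k * \<bar>r - t\<bar>)) \<partial>lborel) \<le> ennreal (C\<^sup>2 * (2 / Im k + 1 / (1 - \<alpha>)))" for r
      by (rule bessel_weight_bound[OF \<alpha> k])
    show "continuous_on {0<..} (\<lambda>r. complex_of_real (Vpot \<alpha> r) - k\<^sup>2)"
      unfolding Vpot_def by (intro continuous_intros) auto
    show "?\<phi> r * bsol' k \<alpha> (hankel_minus k \<alpha>) (hankel_plus k \<alpha>) r - bsol' k \<alpha> a b r * ?\<xi> r = - 1" if "r > 0" for r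
      unfolding bsol_wronskian[OF that] by (rule det)
    show "norm (?\<phi> r) \<le> C * bessel_weight \<alpha> r * exp (Im k * r)" if r: "r > 0" for r
    proof (cases "r \<le> 1")
      case True
      have "norm (?\<phi> r) \<le> C1 * r powr (- \<alpha> / 2)" using C1 r True by blast
      also have "\<dots> \<le> C * r powr (- \<alpha> / 2)" using C by (intro mult_right_mono) auto
      also have "\<dots> \<le> C * r powr (- \<alpha> / 2) * exp (Im k * r)" 
        using mult_left_mono[of 1 "exp (Im k * r)" "C * r powr (- \<alpha> / 2)"] C r k by simp
      finally show ?thesis using r True by (simp add: bessel_weight_def)
    next
      case False
      have "norm (?\<phi> r) \<le> C3 * exp (Im k * r)" using C3(2)[of r] False k by simp
      also have "\<dots> \<le> C * exp (Im k * r)" using C by (intro mult_right_mono) auto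
      finally show ?thesis using False by (simp add: bessel_weight_def)
    qed
    show "norm (?\<xi> r) \<le> C * bessel_weight \<alpha> r * exp (- Im k * r)" if r: "r > 0" for r
    proof (cases "r \<le> 1")
      case True
      have "norm (?\<xi> r) \<le> C2 * r powr (- \<alpha> / 2)" using C2 r True by blast
      also have "\<dots> = (C2 * r powr (- \<alpha> / 2)) * 1" by simp
      also have "\<dots> \<le> (C2 * r powr (- \<alpha> / 2)) * exp (Im k + - Im k * r)"
        using C2(1) k True r by (intro mult_left_mono) auto
      also have "\<dots> = (C2 * exp (Im k)) * (r powr (- \<alpha> / 2) * exp (- Im k * r))"
        by (simp only: exp_add mult_ac)
      also have "\<dots> \<le> C * (r powr (- \<alpha> / 2) * exp (- Im k * r))" using C by (intro mult_right_mono) auto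
      finally show ?thesis using r True by (simp add: bessel_weight_def)
    next
      case False
      have "norm (?\<xi> r) \<le> C4 * exp (- Im k * r)" using C4(2)[of r] False k by simp
      also have "\<dots> \<le> C * exp (- Im k * r)" using C by (intro mult_right_mono) auto
      finally show ?thesis using False by (simp add: bessel_weight_def)
    qed
  qed (use k bsol_deriv bsol'_deriv in auto)
  thus ?thesis by (rule that)
qed

section \<open>The resolvent kernel\<close>

lemma A_coef_eq_denom: "A_coef k \<alpha> s = of_real (pi / 2) * inverse (A_coef_denom k \<alpha> s)"
  by (simp only: A_coef_def A_coef_denom_def)

lemma hankel_minus_mult_powr:
  assumes "0 < \<alpha>" "\<alpha> < 1" "k \<noteq> 0"
  shows "(k / 2) powr of_real \<alpha> * hankel_minus k \<alpha> = - \<i> / of_real (sin (pi * \<alpha>))"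
proof -
  have "sin (pi * \<alpha>) > 0" using assms by (intro sin_gt_zero) auto
  moreover have "(k / 2) powr of_real \<alpha> * (k / 2) powr of_real (- \<alpha>) = 1"
    using assms by (simp add: powr_minus)
  ultimately show ?thesis unfolding hankel_minus_def by (simp add: divide_simps)
qed

text \<open>The Hankel product is symmetric in r and t, so it may be evaluated at min and max; the
  Hankel factor at max is then common to both terms of the kernel.\<close>

lemma res_kernel_eq:
  assumes k: "k \<noteq> 0" and r: "r > 0" "t > 0"
  shows "res_kernel \<alpha> s k r t =
    bsol k \<alpha> (- A_coef k \<alpha> s * hankel_minus k \<alpha>)
       (\<i> * of_real (pi / 2) * (k / 2) powr of_real \<alpha> - A_coef k \<alpha> s * hankel_plus k \<alpha>) (min r t)
    * bsol k \<alpha> (hankel_minus k \<alpha>) (hankel_plus k \<alpha>) (max r t)"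
proof -
  define A where "A = A_coef k \<alpha> s"
  define m M where "m = min r t" and "M = max r t"
  have mM: "m > 0" "M > 0" using r by (auto simp: m_def M_def)
  let ?J = "\<lambda>x. complex_of_real (sqrt x) * BesselJ \<alpha> (k * of_real x)" and ?H = "\<lambda>x. complex_of_real (sqrt x) * Hankel1 \<alpha> (k * of_real x)"
  have sq: "sqrt (r * t) = sqrt m * sqrt M" by (auto simp: m_def M_def min_def max_def real_sqrt_mult)
  have HH: "Hankel1 \<alpha> (k * of_real r) * Hankel1 \<alpha> (k * of_real t) = Hankel1 \<alpha> (k * of_real m) * Hankel1 \<alpha> (k * of_real M)"
    by (auto simp: m_def M_def min_def max_def)
  have "res_kernel \<alpha> s k r t = \<i> * of_real (pi / 2) * (of_real (sqrt m * sqrt M)) * BesselJ \<alpha> (k * of_real m) * Hankel1 \<alpha> (k * of_real M)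
     - A * of_real (sqrt m * sqrt M) * (Hankel1 \<alpha> (k * of_real r) * Hankel1 \<alpha> (k * of_real t))"
    unfolding res_kernel_def sq A_def[symmetric] m_def[symmetric] M_def[symmetric] by (simp only: mult.assoc)
  also have "\<dots> = (\<i> * of_real (pi / 2) * ?J m - A * ?H m) * ?H M"
    unfolding HH of_real_mult by (simp add: algebra_simps)
  also have "\<dots> = bsol k \<alpha> (- A * hankel_minus k \<alpha>) (\<i> * of_real (pi / 2) * (k / 2) powr of_real \<alpha> - A * hankel_plus k \<alpha>) m
      * bsol k \<alpha> (hankel_minus k \<alpha>) (hankel_plus k \<alpha>) M"
    unfolding sqrt_BesselJ[OF mM(1) k] sqrt_Hankel1[OF mM(1) k] sqrt_Hankel1[OF mM(2) k] bsol_def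
    by (simp add: algebra_simps)
  finally show ?thesis unfolding A_def m_def M_def .
qed

lemma Wr_bsol_limit:
  assumes "0 < \<alpha>" "\<alpha> < 1"
  shows "((Wr \<alpha> s (bsol k \<alpha> a b) (bsol' k \<alpha> a b))
     \<longlongrightarrow> b * of_real (rGamma (1 + \<alpha>)) - a * of_real ((2 * \<alpha> * s - 1) * rGamma (1 - \<alpha>))) (at_right 0)"
  unfolding bsol_def[abs_def] bsol'_def[abs_def] by (rule Wr_bessel_sol_limit[OF assms])

text \<open>The resolvent is characterised by its action: for each f in L2 the kernel integral
  converges, lies in the domain of h(s), and solves (h(s) - k^2) u = f. The assumption that k^2 is
  not an eigenvalue makes this solution unique and keeps the bracket in A away from 0.\<close>

theorem theorem7:
  fixes \<alpha> s :: real and k :: complex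
  assumes "0 < \<alpha>" and "\<alpha> < 1"
    and "0 < Arg k" and "Arg k < pi"
    and not_eig: "\<not> (\<exists>\<psi> \<psi>' \<psi>''. in_dom_s \<alpha> s \<psi> \<psi>' \<psi>'' \<and>
                     \<not> (AE r in lborel. r > 0 \<longrightarrow> \<psi> r = 0) \<and>
                     (AE r in lborel. r > 0 \<longrightarrow>
                        - \<psi>'' r + of_real (Vpot \<alpha> r) * \<psi> r = k\<^sup>2 * \<psi> r))"
  shows "\<forall>f. L2pos f \<longrightarrow>
           (\<forall>r>0. set_integrable lborel {0<..} (\<lambda>r'. res_kernel \<alpha> s k r r' * f r')) \<and>
           (\<exists>u' u''. in_dom_s \<alpha> s (\<lambda>r. LINT r':{0<..}|lborel. res_kernel \<alpha> s k r r' * f r') u' u'' \<and>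
              (AE r in lborel. r > 0 \<longrightarrow>
                 - u'' r + of_real (Vpot \<alpha> r) * (LINT r':{0<..}|lborel. res_kernel \<alpha> s k r r' * f r')
                 - k\<^sup>2 * (LINT r':{0<..}|lborel. res_kernel \<alpha> s k r r' * f r') = f r))"
proof -
  note \<alpha> = assms(1,2)
  have Imk: "Im k > 0" using assms(3,4) Arg_lt_pi by blast
  have k0: "k \<noteq> 0" using Imk by auto
  have sin0: "sin (pi * \<alpha>) > 0" using \<alpha> by (intro sin_gt_zero) auto
  define A where "A = A_coef k \<alpha> s"
  define P where "P = (k / 2) powr complex_of_real \<alpha>"
  define am ap where "am = hankel_minus k \<alpha>" and "ap = hankel_plus k \<alpha>"
  define a b where "a = - A * am" and "b = \<i> * of_real (pi / 2) * P - A * ap"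
  define \<phi> \<phi>' where "\<phi> = bsol k \<alpha> a b" and "\<phi>' = bsol' k \<alpha> a b"
  define \<xi> \<xi>' where "\<xi> = bsol k \<alpha> am ap" and "\<xi>' = bsol' k \<alpha> am ap"
  define q where "q = (\<lambda>r. complex_of_real (Vpot \<alpha> r) - k\<^sup>2)"
  \<comment> \<open>A drops out, since adding a multiple of xi to phi does not change their
    Wronskian; the factor i pi/2 normalises it to -1.\<close>
  have "a * ap - b * am = - \<i> * of_real (pi / 2) * (P * am)"
    by (simp add: a_def b_def algebra_simps)
  also have "P * am = - \<i> / of_real (sin (pi * \<alpha>))"
    unfolding P_def am_def by (rule hankel_minus_mult_powr[OF \<alpha> k0])
  finally have "(a * ap - b * am) * of_real (2 * sin (pi * \<alpha>) / pi) = -1"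
    using sin0 by (simp add: field_simps)
  then obtain w M where gp: "green_pair \<phi> \<phi>' \<xi> \<xi>' q w (Im k) M"
    unfolding \<phi>_def \<phi>'_def \<xi>_def \<xi>'_def q_def am_def ap_def using green_pair_bsol[OF \<alpha> Imk] by blast
  interpret G: green_pair \<phi> \<phi>' \<xi> \<xi>' q w "Im k" M by (rule gp)
  have W\<xi>: "(Wr \<alpha> s \<xi> \<xi>' \<longlongrightarrow> \<i> * A_coef_denom k \<alpha> s * (P * of_real (rGamma (1 + \<alpha>)))) (at_right 0)"
    using Wr_bsol_limit[OF \<alpha>, of s k am ap] hankel_boundary_value[OF \<alpha> k0, of s]
    unfolding \<xi>_def \<xi>'_def am_def ap_def P_def by (simp only:)
  \<comment> \<open>Since \<open>inverse 0 = 0\<close>, a vanishing bracket would silently give A =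
    0, and the boundary value of phi would not cancel.\<close>
  have br: "A_coef_denom k \<alpha> s \<noteq> 0"
  proof
    assume "A_coef_denom k \<alpha> s = 0"
    hence "(Wr \<alpha> s \<xi> \<xi>' \<longlongrightarrow> 0) (at_right 0)" using W\<xi> by simp
    moreover have "in_dom_adj \<alpha> \<xi> \<xi>' (\<lambda>r. q r * \<xi> r)"
      unfolding in_dom_adj_def
    proof (intro conjI allI impI)
      have "(\<lambda>r. - (q r * \<xi> r) + of_real (Vpot \<alpha> r) * \<xi> r) = (\<lambda>r. k\<^sup>2 * \<xi> r)"
        by (simp add: q_def left_diff_distrib)
      thus "L2pos (\<lambda>r. - (q r * \<xi> r) + of_real (Vpot \<alpha> r) * \<xi> r)"
        using L2pos_cmult[OF G.\<xi>_L2, of "k\<^sup>2"] by (simp only:)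
    qed (fact G.\<xi>_deriv G.\<xi>''_integral G.\<xi>_L2 | erule (1) G.\<xi>''_integral | erule G.\<xi>_deriv)+
    ultimately have "in_dom_s \<alpha> s \<xi> \<xi>' (\<lambda>r. q r * \<xi> r)" by (simp add: in_dom_s_def)
    moreover have "AE r in lborel. r > 0 \<longrightarrow> - (q r * \<xi> r) + of_real (Vpot \<alpha> r) * \<xi> r = k\<^sup>2 * \<xi> r"
      by (simp add: q_def left_diff_distrib)
    ultimately show False using not_eig G.\<xi>_not_AE_zero by blast
  qed
  have W\<phi>: "(Wr \<alpha> s \<phi> \<phi>' \<longlongrightarrow> 0) (at_right 0)"
  proof -
    have "b * of_real (rGamma (1 + \<alpha>)) - a * of_real ((2 * \<alpha> * s - 1) * rGamma (1 - \<alpha>))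
      = \<i> * of_real (pi / 2) * (P * of_real (rGamma (1 + \<alpha>)))
        - A * (ap * of_real (rGamma (1 + \<alpha>)) - am * of_real ((2 * \<alpha> * s - 1) * rGamma (1 - \<alpha>)))"
      by (simp add: a_def b_def algebra_simps)
    also have "ap * of_real (rGamma (1 + \<alpha>)) - am * of_real ((2 * \<alpha> * s - 1) * rGamma (1 - \<alpha>))
      = \<i> * A_coef_denom k \<alpha> s * (P * of_real (rGamma (1 + \<alpha>)))"
      unfolding am_def ap_def P_def by (rule hankel_boundary_value[OF \<alpha> k0])
    also have "\<i> * of_real (pi / 2) * (P * of_real (rGamma (1 + \<alpha>))) - A * (\<i> * A_coef_denom k \<alpha> s * (P * of_real (rGamma (1 + \<alpha>)))) = 0"
      using br by (simp add: A_def A_coef_eq_denom field_simps)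
    finally show ?thesis using Wr_bsol_limit[OF \<alpha>, of s k a b] unfolding \<phi>_def \<phi>'_def by (simp only:)
  qed
  have ker: "res_kernel \<alpha> s k r t = G.green r t" if "r > 0" "t > 0" for r t
    using res_kernel_eq[OF k0 that, of \<alpha> s]
    unfolding G.green_def unfolding \<phi>_def \<xi>_def a_def b_def A_def P_def am_def ap_def .
  show ?thesis
  proof (intro allI impI conjI)
    fix f :: "real \<Rightarrow> complex" and r :: real
    assume f: "L2pos f" and r: "r > 0"
    show "set_integrable lborel {0<..} (\<lambda>r'. res_kernel \<alpha> s k r r' * f r')"
      using G.green_integrable[OF f r] by (subst set_integrable_cong[OF refl refl, of _ _ "\<lambda>t. G.green r t * f t"]) (auto simp: ker r)
  next
    fix f :: "real \<Rightarrow> complex"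
    assume f: "L2pos f"
    define u where "u = (\<lambda>r. LINT r':{0<..}|lborel. res_kernel \<alpha> s k r r' * f r')"
    define v v' where "v = G.gu f" and "v' = G.gu' f"
    \<comment> \<open>This choice of representative makes the differential equation hold at every r
      > 0, not merely almost everywhere.\<close>
    define u'' where "u'' = (\<lambda>r. q r * v r - f r)"
    have uv: "u r = v r" if r: "r > 0" for r
    proof -
      have "u r = (LINT t:{0<..}|lborel. G.green r t * f t)"
        unfolding u_def by (rule set_lebesgue_integral_cong) (auto simp: ker r)
      thus ?thesis using G.green_integral[OF f r] by (simp add: v_def G.gu_def[OF f])
    qed
    have "in_dom_adj \<alpha> u v' u''"
      unfolding in_dom_adj_def
    proof (intro conjI allI impI)
      fix r :: real assume r: "r > 0"
      show "(u has_vector_derivative v' r) (at r)"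
        by (rule has_vector_derivative_transform_within_open[OF G.gu_deriv[OF f r, folded v_def v'_def], of "{0<..}"])
           (use r uv in auto)
    next
      fix a b :: real assume "0 < a" "a \<le> b"
      thus "set_integrable lborel {a..b} u''" "v' b - v' a = (LINT x:{a..b}|lborel. u'' x)"
        unfolding u''_def v_def v'_def by (fact G.gu''_integral[OF f])+
    next
      show "L2pos u" by (rule L2pos_cong[OF G.gu_L2[OF f, folded v_def] uv])
      show "L2pos (\<lambda>r. - u'' r + of_real (Vpot \<alpha> r) * u r)"
        by (rule L2pos_cong[OF L2pos_add_cmult[OF f G.gu_L2[OF f, folded v_def], of "k\<^sup>2"]])
           (simp add: uv u''_def q_def left_diff_distrib)
    qed
    moreover have "(Wr \<alpha> s u v' \<longlongrightarrow> 0) (at_right 0)"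
    proof -
      \<comment> \<open>\<open>Wr\<close> is linear in the function and its derivative, and u and v'
        have the same coefficients \<open>gA\<close>, \<open>gB\<close>. The first term vanishes
        because \<open>gA\<close> does, although xi violates the boundary condition; the second
        because phi satisfies it.\<close>
      have "((\<lambda>r. Wr \<alpha> s \<xi> \<xi>' r * G.gA f r + Wr \<alpha> s \<phi> \<phi>' r * G.gB f r) \<longlongrightarrow>
          (\<i> * A_coef_denom k \<alpha> s * (P * of_real (rGamma (1 + \<alpha>)))) * 0 + 0 * G.gB f 0) (at_right 0)"
        by (intro tendsto_add tendsto_mult W\<xi> W\<phi> G.gA_at_0[OF f] G.gB_at_0[OF f])
      moreover have "\<forall>\<^sub>F r in at_right 0. Wr \<alpha> s \<xi> \<xi>' r * G.gA f r + Wr \<alpha> s \<phi> \<phi>' r * G.gB f r = Wr \<alpha> s u v' r"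
      proof (rule eventually_at_right_less[THEN eventually_mono])
        fix r :: real assume r: "0 < r"
        show "Wr \<alpha> s \<xi> \<xi>' r * G.gA f r + Wr \<alpha> s \<phi> \<phi>' r * G.gB f r = Wr \<alpha> s u v' r"
          unfolding Wr_def uv[OF r] unfolding v_def v'_def G.gu_def[OF f] G.gu'_def[OF f]
          by (simp add: algebra_simps)
      qed
      ultimately have "(Wr \<alpha> s u v' \<longlongrightarrow> (\<i> * A_coef_denom k \<alpha> s * (P * of_real (rGamma (1 + \<alpha>)))) * 0 + 0 * G.gB f 0) (at_right 0)"
        by (rule Lim_transform_eventually)
      thus ?thesis by (simp only: mult_zero_left mult_zero_right add_0_left)
    qed
    moreover have "AE r in lborel. r > 0 \<longrightarrow> - u'' r + of_real (Vpot \<alpha> r) * u r - k\<^sup>2 * u r = f r"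
      by (simp add: uv u''_def q_def left_diff_distrib)
    ultimately show "\<exists>u' u''. in_dom_s \<alpha> s (\<lambda>r. LINT r':{0<..}|lborel. res_kernel \<alpha> s k r r' * f r') u' u'' \<and>
        (AE r in lborel. r > 0 \<longrightarrow>
           - u'' r + of_real (Vpot \<alpha> r) * (LINT r':{0<..}|lborel. res_kernel \<alpha> s k r r' * f r')
           - k\<^sup>2 * (LINT r':{0<..}|lborel. res_kernel \<alpha> s k r r' * f r') = f r)"
      unfolding u_def in_dom_s_def by blast
  qed
qed

end
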